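(* Let $S_0:=\bigl(xyz=x^3+y^3+1\bigr)\subset \mathbb{A}^3_{\mathbb{Z}}$, and let $\mathrm{Aut}_{\mathbb{Z}}(S_0)$ be its group of automorphisms over $\mathbb{Z}$. Then the following hold. (1) The group $\mathrm{Aut}_{\mathbb{Z}}(S_0)$ is generated by the three involutions $$\tau:(x,y,z)\mapsto (y,x,z),$$ $$\sigma_x:(x,y,z)\mapsto \bigl(x,\ xz-y^2,\ xz^2-y^2z-x^2y\bigr),$$ $$\sigma_y:(x,y,z)\mapsto \bigl(yz-x^2,\ y,\ yz^2-x^2z-xy^2\bigr).$$ (2) $\mathrm{Aut}_{\mathbb{Z}}(S_0)\cong \mathbb{Z}\rtimes \mathbb{Z}/2$ (the infinite dihedral group). (3) The set $\{(x,y,z)\in S_0\cap(\mathbb{R}^+)^3 : x\le y\le (x^3+1)^{1/2}\}$ is a fundamental domain for the action of $\mathrm{Aut}_{\mathbb{Z}}(S_0)$ on $S_0\cap(\mathbb{R}^+)^3$.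
   Context: $\mathrm{Aut}_{\mathbb{Z}}(S_0)$ is the group of automorphisms of the affine $\mathbb{Z}$-scheme $S_0=\mathrm{Spec}\,\mathbb{Z}[x,y,z]/(xyz-x^3-y^3-1)$. $\mathbb{R}^+$ denotes the positive reals, and $S_0\cap(\mathbb{R}^+)^3$ is the set of real points of $S_0$ with all coordinates positive. In $\mathbb{Z}\rtimes\mathbb{Z}/2$ the generator of $\mathbb{Z}/2$ acts on $\mathbb{Z}$ by $-1$, so the group is $\cong \mathbb{Z}/2*\mathbb{Z}/2$. A fundamental domain is a closed subset whose translates by the group cover the space, and whose interior is disjoint from the interior of its translate by any non-identity group element. *)

theory Defs
  imports
    "HOL-Analysis.Analysis"
    "HOL-Algebra.Bij"
    "HOL-Algebra.Elementary_Groups"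
    "HOL-Algebra.Generated_Groups"
    "HOL-Algebra.Group_Action"
    "HOL-Algebra.QuotRing"
    "HOL-Computational_Algebra.Polynomial"
    "HOL-Decision_Procs.Algebra_Aux"
begin

section \<open>The coordinate ring of the cubic surface\<close>

text \<open>
  \<open>\<int>[x,y,z]\<close> is the iterated polynomial ring \<open>\<int>[x][y][z]\<close>: the innermost polynomial
  variable is \<open>x\<close>, the outermost one is \<open>z\<close>.
\<close>

type_synonym poly3 = "int poly poly poly"

definition var_x :: poly3 where "var_x = [:[:[:0, 1:]:]:]"
definition var_y :: poly3 where "var_y = [:[:0, 1:]:]"
definition var_z :: poly3 where "var_z = [:0, 1:]"

text \<open>The value \<open>g(a,b,c)\<close> of an integral polynomial at a triple of elements of any commutative
  ring; the cases used are \<open>poly3\<close> (substitution) and \<open>real\<close>.\<close>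

definition eval3 :: "'a::comm_ring_1 \<times> 'a \<times> 'a \<Rightarrow> poly3 \<Rightarrow> 'a" where
  "eval3 = (\<lambda>(a, b, c) g.
     poly (map_poly (\<lambda>h. poly (map_poly (\<lambda>k. poly (map_poly of_int k) a) h) b) g) c)"

definition poly3_ring :: "poly3 ring" where
  "poly3_ring = cring_class_ops"

definition S0_eqn :: poly3 where
  "S0_eqn = var_x * var_y * var_z - (var_x ^ 3 + var_y ^ 3 + 1)"

definition S0_ideal :: "poly3 set" where
  "S0_ideal = PIdl\<^bsub>poly3_ring\<^esub> S0_eqn"

definition S0_ring :: "poly3 set ring" where
  "S0_ring = poly3_ring Quot S0_ideal"

definition S0_class :: "poly3 \<Rightarrow> poly3 set" where
  "S0_class g = S0_ideal +>\<^bsub>poly3_ring\<^esub> g"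


section \<open>Automorphisms of affine schemes over the integers\<close>

text \<open>
  A morphism of affine schemes \<open>\<Phi> : Spec R \<rightarrow> Spec R\<close> is given by its comorphism
  \<open>\<Phi>\<^sup># : R \<rightarrow> R\<close>, an arbitrary ring homomorphism (compatibility with the structure morphism
  to \<open>Spec \<int>\<close> is automatic), and \<open>(\<Phi> \<circ> \<Psi>)\<^sup># = \<Psi>\<^sup># \<circ> \<Phi>\<^sup>#\<close>.  So the
  automorphism group of \<open>Spec R\<close> consists of the ring automorphisms of \<open>R\<close>, with the
  order of composition reversed.  As in \<^const>\<open>BijGroup\<close>, maps are extensional on the carrier.
\<close>

definition Aut_Spec :: "('a, 'm) ring_scheme \<Rightarrow> ('a \<Rightarrow> 'a) monoid" where
  "Aut_Spec R =
    \<lparr>carrier = ring_hom R R \<inter> Bij (carrier R),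
     mult = (\<lambda>\<phi> \<psi>. compose (carrier R) \<psi> \<phi>),
     one = (\<lambda>r\<in>carrier R. r)\<rparr>"

abbreviation Aut_S0 :: "(poly3 set \<Rightarrow> poly3 set) monoid" where
  "Aut_S0 \<equiv> Aut_Spec S0_ring"

text \<open>
  The comorphism of the self-map \<open>(x,y,z) \<mapsto> (p,q,r)\<close> of \<open>S\<^sub>0\<close>: the class of \<open>g\<close> is sent to the
  class of \<open>g(p,q,r)\<close>.  This is well defined exactly if \<open>(p,q,r)\<close> satisfies the equation of
  \<open>S\<^sub>0\<close> modulo the ideal.
\<close>

definition S0_map :: "poly3 \<times> poly3 \<times> poly3 \<Rightarrow> (poly3 set \<Rightarrow> poly3 set)" where
  "S0_map pqr = (\<lambda>C\<in>carrier S0_ring. the_elem ((\<lambda>g. S0_class (eval3 pqr g)) ` C))"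

definition tau :: "poly3 set \<Rightarrow> poly3 set" where
  "tau = S0_map (var_y, var_x, var_z)"

definition sigma_x :: "poly3 set \<Rightarrow> poly3 set" where
  "sigma_x = S0_map
    (var_x, var_x * var_z - var_y\<^sup>2, var_x * var_z\<^sup>2 - var_y\<^sup>2 * var_z - var_x\<^sup>2 * var_y)"

definition sigma_y :: "poly3 set \<Rightarrow> poly3 set" where
  "sigma_y = S0_map
    (var_y * var_z - var_x\<^sup>2, var_y, var_y * var_z\<^sup>2 - var_x\<^sup>2 * var_z - var_x * var_y\<^sup>2)"

definition is_involution :: "('a, 'm) monoid_scheme \<Rightarrow> 'a \<Rightarrow> bool" where
  "is_involution G g \<longleftrightarrow> g \<in> carrier G \<and> g \<noteq> \<one>\<^bsub>G\<^esub> \<and> g \<otimes>\<^bsub>G\<^esub> g = \<one>\<^bsub>G\<^esub>"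


section \<open>The infinite dihedral group\<close>

definition semidirect_product ::
  "('a, 'm) monoid_scheme \<Rightarrow> ('b, 'n) monoid_scheme \<Rightarrow> ('b \<Rightarrow> 'a \<Rightarrow> 'a) \<Rightarrow> ('a \<times> 'b) monoid" where
  "semidirect_product N H \<theta> =
    \<lparr>carrier = carrier N \<times> carrier H,
     mult = (\<lambda>(n, h) (n', h'). (n \<otimes>\<^bsub>N\<^esub> \<theta> h n', h \<otimes>\<^bsub>H\<^esub> h')),
     one = (\<one>\<^bsub>N\<^esub>, \<one>\<^bsub>H\<^esub>)\<rparr>"

definition infinite_dihedral_group :: "(int \<times> int) monoid" where
  "infinite_dihedral_group =
    semidirect_product integer_group (integer_mod_group 2) (\<lambda>h n. if h = 0 then n else - n)"


section \<open>The action on positive real points\<close>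

definition S0_pos :: "(real \<times> real \<times> real) set" where
  "S0_pos = {(x, y, z). x * y * z = x ^ 3 + y ^ 3 + 1 \<and> 0 < x \<and> 0 < y \<and> 0 < z}"

text \<open>The value of a regular function of \<open>S\<^sub>0\<close> (a residue class) at a real point of \<open>S\<^sub>0\<close>.\<close>

definition S0_value :: "real \<times> real \<times> real \<Rightarrow> poly3 set \<Rightarrow> real" where
  "S0_value p C = the_elem (eval3 p ` C)"

text \<open>The coordinates of \<open>\<Phi>(p)\<close> are the values at \<open>p\<close> of the pulled back coordinate functions.\<close>

definition S0_pos_action ::
  "(poly3 set \<Rightarrow> poly3 set) \<Rightarrow> real \<times> real \<times> real \<Rightarrow> real \<times> real \<times> real" where
  "S0_pos_action \<phi> = (\<lambda>p\<in>S0_pos.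
     (S0_value p (\<phi> (S0_class var_x)), S0_value p (\<phi> (S0_class var_y)), S0_value p (\<phi> (S0_class var_z))))"

definition fundamental_domain ::
  "('g, 'm) monoid_scheme \<Rightarrow> 'a topology \<Rightarrow> ('g \<Rightarrow> 'a \<Rightarrow> 'a) \<Rightarrow> 'a set \<Rightarrow> bool" where
  "fundamental_domain G T \<alpha> D \<longleftrightarrow>
     group_action G (topspace T) \<alpha> \<and>
     closedin T D \<and>
     (\<Union>g\<in>carrier G. \<alpha> g ` D) = topspace T \<and>
     (\<forall>g\<in>carrier G. g \<noteq> \<one>\<^bsub>G\<^esub> \<longrightarrow> T interior_of D \<inter> T interior_of (\<alpha> g ` D) = {})"

end

theory Submission
  imports Defs "HOL-Computational_Algebra.Polynomial_Factorial" "HOL-Library.Poly_Mapping"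
begin

text \<open>
  The coordinate ring is the cluster algebra with exchange relation
  \<open>x\<^sub>n\<^sub>-\<^sub>1 x\<^sub>n\<^sub>+\<^sub>1 = x\<^sub>n\<^sup>3 + 1\<close>, realised inside the Laurent polynomials in \<open>x, y\<close> by
  \<open>z = (x\<^sup>3 + y\<^sup>3 + 1) / (x y)\<close>; the involution \<open>\<sigma>\<^sub>x\<close> replaces \<open>y\<close> by
  \<open>x z - y\<^sup>2 = (x\<^sup>3 + 1) / y\<close>.  Let \<open>\<Phi>\<close> be an automorphism and let \<open>a, b\<close> be the total
  degrees of \<open>\<Phi> x, \<Phi> y\<close>.  For \<open>a \<le> b\<close>, composing with \<open>\<sigma>\<^sub>x\<close> replaces \<open>b\<close> by
  \<open>3 a - b\<close>, so by descent one may assume \<open>a \<le> b \<le> 3 a / 2\<close>.  The log-canonical Poisson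
  bracket \<open>{x, y} = x y\<close> is preserved by \<open>\<Phi>\<close> up to a constant, and this forces
  \<open>f \<mapsto> deg (\<Phi> f)\<close> to be the monomial valuation with weights \<open>a, b\<close>.  In the reduced range
  every non-constant element has weight at least \<open>a\<close>, because negative powers of \<open>y\<close> come with
  powers of \<open>x\<^sup>3 + 1\<close> and vice versa.  Applied to \<open>\<Phi>\<^sup>-\<^sup>1 x\<close> this gives \<open>a = b = 1\<close>, and
  then \<open>\<Phi>\<close> is the identity or \<open>\<tau>\<close>.

  On positive points the ratios \<open>x\<^sub>n\<^sub>+\<^sub>1 / x\<^sub>n\<close> grow at least by the factor \<open>3 / 2\<close>, since
  \<open>x\<^sub>n\<^sup>3 + 1 \<ge> (3 / 2) x\<^sub>n\<^sup>2\<close>.  Hence the translation \<open>\<sigma>\<^sub>x \<tau>\<close> has infinite order, and the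
  place where the ratio crosses \<open>1\<close> locates the representative in the fundamental domain.
\<close>

section \<open>Evaluation of integral polynomials in three variables\<close>

text \<open>The obstacle is cancellation among leading forms: those of \<open>\<Phi> x\<close> and
  \<open>\<Phi> y\<close> might be algebraically dependent, the degree of \<open>\<Phi> f\<close>
  could then drop below what the monomials of \<open>f\<close> suggest, and \<open>a\<close>,
  \<open>b\<close> would say nothing about the preimage of \<open>x\<close>. The bracket removes
  this obstacle. It does not raise the sum of two degrees, and \<open>{\<Phi> x, \<Phi> y}\<close>
  is a nonzero rational constant times the product, so bracketing with \<open>\<Phi> x\<close> or
  \<open>\<Phi> y\<close> separates the monomials of \<open>f\<close> on the image side while the
  degree bound is kept. The ratio 3/2 has two sources: \<open>3 a - b < b\<close> holds exactly when
  \<open>2 b > 3 a\<close>, so the descent stops there, and below it the weight estimate for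
  negative exponents works. Coefficients stay integral, hence the factor 3 in front of brackets of
  images. Positivity of an automorphism on real points is visible only on generators, so the third
  claim rests on the first.\<close>

definition ring_map :: "('a::comm_ring_1 \<Rightarrow> 'b::comm_ring_1) \<Rightarrow> bool" where
  "ring_map f \<longleftrightarrow> f 1 = 1 \<and> (\<forall>a b. f (a + b) = f a + f b) \<and> (\<forall>a b. f (a * b) = f a * f b)"

lemma ring_mapD:
  assumes "ring_map f"
  shows "f 0 = 0" "f 1 = 1" "f (a + b) = f a + f b" "f (a * b) = f a * f b"
    "f (- a) = - f a" "f (a - b) = f a - f b" "f (a ^ n) = f a ^ n" "f (of_int k) = of_int k"
proof -
  have add: "f (a + b) = f a + f b" for a b
    using assms by (simp add: ring_map_def)
  show zero: "f 0 = 0"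
    using add[of 0 0] by simp
  have minus: "f (- a) = - f a" for a
    using add[of a "- a"] zero by (simp add: eq_neg_iff_add_eq_0 add.commute)
  have nat: "f (of_nat n) = of_nat n" for n
    using assms by (induction n) (auto simp: zero add ring_map_def)
  show "f (of_int k) = of_int k"
    by (cases k rule: int_cases2) (auto simp: minus nat)
  show "f (a ^ n) = f a ^ n"
    using assms by (induction n) (auto simp: ring_map_def)
  show "f (a - b) = f a - f b"
    using add[of a "- b"] by (simp add: minus)
  show "f (- a) = - f a"
    by (rule minus)
qed (use assms in \<open>auto simp: ring_map_def\<close>)

lemma ring_map_poly:
  assumes "ring_map f"
  shows "ring_map (\<lambda>g. poly (map_poly f g) c)"
proof -
  note f = ring_mapD[OF assms]
  have add: "map_poly f (p + q) = map_poly f p + map_poly f q" for p q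
    by (rule poly_eqI) (simp add: coeff_map_poly f)
  have smult: "map_poly f (smult a p) = smult (f a) (map_poly f p)" for a p
    by (rule poly_eqI) (simp add: coeff_map_poly f)
  have mult: "map_poly f (p * q) = map_poly f p * map_poly f q" for p q
    by (induction p) (simp_all add: f add smult map_poly_pCons)
  show ?thesis
    by (simp add: ring_map_def add mult) (simp add: f map_poly_1)
qed

lemma ring_map_of_int: "ring_map (of_int :: int \<Rightarrow> 'a::comm_ring_1)"
  by (simp add: ring_map_def)

lemma ring_map_eval3: "ring_map (eval3 p)"
proof (cases p)
  case (fields a b c)
  show ?thesis
    unfolding eval3_def fields prod.case
    by (intro ring_map_poly ring_map_of_int)
qed

lemmas eval3_hom = ring_mapD[OF ring_map_eval3]

lemma eval3_const: "eval3 (a, b, c) [:[:[:k:]:]:] = of_int k"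
  by (simp add: eval3_def map_poly_pCons)

lemma eval3_var:
  "eval3 (a, b, c) var_x = a" "eval3 (a, b, c) var_y = b" "eval3 (a, b, c) var_z = c"
  by (simp_all add: eval3_def map_poly_pCons var_x_def var_y_def var_z_def)

lemma poly3_induct [case_names const x y z add mult]:
  fixes g :: poly3
  assumes const: "\<And>k. P [:[:[:k:]:]:]"
    and x: "P var_x" and y: "P var_y" and z: "P var_z"
    and add: "\<And>g h. P g \<Longrightarrow> P h \<Longrightarrow> P (g + h)"
    and mult: "\<And>g h. P g \<Longrightarrow> P h \<Longrightarrow> P (g * h)"
  shows "P g"
proof -
  have 1: "P [:[:k:]:]" for k :: "int poly"
  proof (induction k)
    case 0
    show ?case using const[of 0] by simp
  next
    case (pCons a k)
    have "[:[:pCons a k:]:] = [:[:[:a:]:]:] + var_x * [:[:k:]:]"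
      by (simp add: var_x_def)
    then show ?case using add[OF const mult[OF x pCons.IH]] by metis
  qed
  have 2: "P [:k:]" for k :: "int poly poly"
  proof (induction k)
    case 0
    show ?case using const[of 0] by simp
  next
    case (pCons a k)
    have "[:pCons a k:] = [:[:a:]:] + var_y * [:k:]"
      by (simp add: var_y_def)
    then show ?case using add[OF 1 mult[OF y pCons.IH]] by metis
  qed
  show ?thesis
  proof (induction g)
    case 0
    show ?case using const[of 0] by simp
  next
    case (pCons a k)
    have "pCons a k = [:a:] + var_z * k"
      by (simp add: var_z_def)
    then show ?case using add[OF 2 mult[OF z pCons.IH]] by metis
  qed
qed

text \<open>The universal property of the polynomial ring. It later computes composites of
  comorphisms and their action on points without unfolding polynomials.\<close>

lemma ring_map_eq_eval3:
  assumes "ring_map f"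
  shows "f g = eval3 (f var_x, f var_y, f var_z) g"
proof (induction g rule: poly3_induct)
  case (const k)
  have "[:[:[:k:]:]:] = (of_int k :: poly3)"
    by (simp add: of_int_poly)
  then show ?case
    by (simp add: ring_mapD(8)[OF assms] eval3_hom)
qed (simp_all add: eval3_var eval3_hom ring_mapD[OF assms])

lemma ring_map_comp: "ring_map f \<Longrightarrow> ring_map g \<Longrightarrow> ring_map (f \<circ> g)"
  by (simp add: ring_map_def)

section \<open>Laurent polynomials\<close>

type_synonym laurent = "(int \<times> int) \<Rightarrow>\<^sub>0 int"

abbreviation "lookup \<equiv> Poly_Mapping.lookup"
abbreviation "keys \<equiv> Poly_Mapping.keys"
abbreviation "single \<equiv> Poly_Mapping.single"

abbreviation X :: laurent where "X \<equiv> single (1, 0) 1"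
abbreviation Y :: laurent where "Y \<equiv> single (0, 1) 1"

lemma laurent_eq_sum: "(f :: 'a \<Rightarrow>\<^sub>0 int) = (\<Sum>e\<in>keys f. single e (lookup f e))"
proof -
  have "lookup (\<Sum>e\<in>I. single e (lookup f e)) k = (if k \<in> I then lookup f k else 0)"
    if "finite I" for I k
    using that by (induction I) (auto simp: lookup_add lookup_single when_def)
  then show ?thesis
    by (intro poly_mapping_eqI) (simp add: in_keys_iff)
qed

text \<open>No cancellation occurs at an exponent that splits in only one way. This serves leading
  terms as well as multiplication by a monomial.\<close>

lemma lookup_mult_extreme:
  fixes f g :: "'k::cancel_comm_monoid_add \<Rightarrow>\<^sub>0 'a::comm_ring_1"
  assumes "\<And>a' b'. a' \<in> keys f \<Longrightarrow> b' \<in> keys g \<Longrightarrow> a' + b' = a + b \<Longrightarrow> a' = a"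
  shows "lookup (f * g) (a + b) = lookup f a * lookup g b"
proof -
  have inner: "(\<Sum>q. lookup g q when a + b = a + q) = lookup g b"
    by simp
  have "lookup f l * (\<Sum>q. lookup g q when a + b = l + q) = (lookup f a * lookup g b when l = a)" for l
  proof (cases "l = a")
    case True
    then show ?thesis using inner by simp
  next
    case False
    have "lookup f l = 0 \<or> (lookup g q when a + b = l + q) = 0" for q
      by (metis False assms in_keys_iff when_neq_zero)
    then have "lookup f l = 0 \<or> (\<forall>q. (lookup g q when a + b = l + q) = 0)"
      by blast
    then show ?thesis using False by auto
  qed
  then show ?thesis
    by (simp add: lookup_mult)
qed

lemma keys_multE:
  assumes "e \<in> keys (f * g)"
  obtains a b where "a \<in> keys f" "b \<in> keys g" "e = a + b"
  using assms keys_mult[of f g] by blast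

lemma keys_minus_subset:
  fixes f g :: "'a \<Rightarrow>\<^sub>0 'b::ab_group_add"
  shows "keys (f - g) \<subseteq> keys f \<union> keys g"
  by (auto simp: in_keys_iff lookup_minus)

lemma finite_keys_int_bounds:
  fixes F :: "int \<Rightarrow>\<^sub>0 'a::zero"
  assumes "F \<noteq> 0"
  shows "Max (keys F) \<in> keys F" "Min (keys F) \<in> keys F"
    "\<And>k. k \<in> keys F \<Longrightarrow> k \<le> Max (keys F)" "\<And>k. k \<in> keys F \<Longrightarrow> Min (keys F) \<le> k"
  using assms by (auto intro!: Max_in Min_in simp: keys_eq_empty)

text \<open>The one-variable Newton polygon: over a domain the extreme coefficients cannot
  cancel.\<close>

lemma Max_Min_keys_mult:
  fixes F G :: "int \<Rightarrow>\<^sub>0 'a::idom"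
  assumes "F \<noteq> 0" "G \<noteq> 0"
  shows "Max (keys (F * G)) = Max (keys F) + Max (keys G)"
    and "Min (keys (F * G)) = Min (keys F) + Min (keys G)"
proof -
  note bF = finite_keys_int_bounds[OF assms(1)] and bG = finite_keys_int_bounds[OF assms(2)]
  have "lookup (F * G) (Max (keys F) + Max (keys G)) = lookup F (Max (keys F)) * lookup G (Max (keys G))"
    using bF bG by (intro lookup_mult_extreme) (smt (verit))
  then have *: "Max (keys F) + Max (keys G) \<in> keys (F * G)"
    using bF(1) bG(1) by (simp add: in_keys_iff)
  have "k \<le> Max (keys F) + Max (keys G)" if "k \<in> keys (F * G)" for k
    using that by (elim keys_multE) (use bF bG in \<open>auto intro: add_mono\<close>)
  with * show "Max (keys (F * G)) = Max (keys F) + Max (keys G)"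
    by (intro Max_eqI) auto
  have "lookup (F * G) (Min (keys F) + Min (keys G)) = lookup F (Min (keys F)) * lookup G (Min (keys G))"
    using bF bG by (intro lookup_mult_extreme) (smt (verit))
  then have *: "Min (keys F) + Min (keys G) \<in> keys (F * G)"
    using bF(2) bG(2) by (simp add: in_keys_iff)
  have "k \<ge> Min (keys F) + Min (keys G)" if "k \<in> keys (F * G)" for k
    using that by (elim keys_multE) (use bF bG in \<open>auto intro: add_mono\<close>)
  with * show "Min (keys (F * G)) = Min (keys F) + Min (keys G)"
    by (intro Min_eqI) auto
qed

subsection \<open>Total degree\<close>

text \<open>A bound besides the value: \<open>tdeg 0\<close> is the maximum of an empty set, so
  estimates whose terms may vanish use \<open>tle\<close>, which 0 satisfies for every
  \<open>d\<close>.\<close>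

definition tle :: "laurent \<Rightarrow> int \<Rightarrow> bool" where
  "tle f d \<longleftrightarrow> (\<forall>(m, n)\<in>keys f. m + n \<le> d)"

definition tdeg :: "laurent \<Rightarrow> int" where
  "tdeg f = Max ((\<lambda>(m, n). m + n) ` keys f)"

lemma tle_iff_tdeg: "f \<noteq> 0 \<Longrightarrow> tle f d \<longleftrightarrow> tdeg f \<le> d"
  unfolding tle_def tdeg_def by (subst Max_le_iff) (auto simp: keys_eq_empty)

lemma tle_add: "tle f d \<Longrightarrow> tle g d \<Longrightarrow> tle (f + g) d"
  using keys_add[of f g] by (fastforce simp: tle_def)

lemma tle_diff: "tle f d \<Longrightarrow> tle g d \<Longrightarrow> tle (f - g) d"
  using keys_minus_subset[of f g] by (fastforce simp: tle_def)

lemma tle_mult: "tle f d \<Longrightarrow> tle g e \<Longrightarrow> tle (f * g) (d + e)"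
  by (fastforce simp: tle_def elim!: keys_multE)

lemma tle_of_int: "0 \<le> d \<Longrightarrow> tle (of_int k) d"
  by (auto simp: tle_def in_keys_iff lookup_of_int when_def zero_prod_def split: if_splits)

text \<open>The top form can have several monomials; taking the largest exponent of \<open>X\<close>
  breaks the tie and makes the product of two leading terms split uniquely.\<close>

lemma ex_leading:
  assumes "f \<noteq> 0"
  obtains m where "(m, tdeg f - m) \<in> keys f" "\<And>m'. (m', tdeg f - m') \<in> keys f \<Longrightarrow> m' \<le> m"
proof -
  let ?S = "{m. (m, tdeg f - m) \<in> keys f}"
  have "?S \<subseteq> fst ` keys f" by force
  then have fin: "finite ?S" by (rule finite_subset) simp
  have "tdeg f \<in> (\<lambda>(m, n). m + n) ` keys f"
    unfolding tdeg_def using assms by (intro Max_in) (auto simp: keys_eq_empty)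
  then obtain i j where "tdeg f = i + j" "(i, j) \<in> keys f" by auto
  then have "i \<in> ?S" by simp
  then have "?S \<noteq> {}" by blast
  then have "Max ?S \<in> ?S"
    by (rule Max_in[OF fin])
  moreover have "\<And>m'. m' \<in> ?S \<Longrightarrow> m' \<le> Max ?S"
    by (rule Max_ge[OF fin])
  ultimately show ?thesis by (intro that[of "Max ?S"]) auto
qed

lemma tdeg_mult_aux:
  assumes "f \<noteq> 0" "g \<noteq> 0"
  shows "f * g \<noteq> 0 \<and> tdeg (f * g) = tdeg f + tdeg g"
proof -
  obtain m where m: "(m, tdeg f - m) \<in> keys f" "\<And>m'. (m', tdeg f - m') \<in> keys f \<Longrightarrow> m' \<le> m"
    using ex_leading[OF assms(1)] by blast
  obtain n where n: "(n, tdeg g - n) \<in> keys g" "\<And>n'. (n', tdeg g - n') \<in> keys g \<Longrightarrow> n' \<le> n"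
    using ex_leading[OF assms(2)] by blast
  have F: "i + j \<le> tdeg f" if "(i, j) \<in> keys f" for i j
    using tle_iff_tdeg[OF assms(1), of "tdeg f"] that by (auto simp: tle_def)
  have G: "i + j \<le> tdeg g" if "(i, j) \<in> keys g" for i j
    using tle_iff_tdeg[OF assms(2), of "tdeg g"] that by (auto simp: tle_def)
  have "lookup (f * g) ((m, tdeg f - m) + (n, tdeg g - n))
      = lookup f (m, tdeg f - m) * lookup g (n, tdeg g - n)"
  proof (rule lookup_mult_extreme)
    fix a b assume a: "a \<in> keys f" and b: "b \<in> keys g"
      and e: "a + b = (m, tdeg f - m) + (n, tdeg g - n)"
    obtain a1 a2 b1 b2 where ab: "a = (a1, a2)" "b = (b1, b2)" by fastforce
    have "a2 = tdeg f - a1" "b2 = tdeg g - b1"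
      using F[of a1 a2] G[of b1 b2] a b e ab by auto
    then show "a = (m, tdeg f - m)"
      using m(2)[of a1] n(2)[of b1] a b e ab by auto
  qed
  then have k: "(m + n, tdeg f + tdeg g - (m + n)) \<in> keys (f * g)"
    using m(1) n(1) by (simp add: in_keys_iff algebra_simps)
  then have nz: "f * g \<noteq> 0" by auto
  have "tle (f * g) (tdeg f + tdeg g)"
    using tle_iff_tdeg assms by (intro tle_mult) auto
  with nz have "tdeg (f * g) \<le> tdeg f + tdeg g"
    by (simp add: tle_iff_tdeg)
  moreover have "tdeg f + tdeg g \<le> tdeg (f * g)"
    using k tle_iff_tdeg[OF nz, of "tdeg (f * g)"] by (auto simp: tle_def)
  ultimately show ?thesis using nz by simp
qed

lemma tdeg_mult: "f \<noteq> 0 \<Longrightarrow> g \<noteq> 0 \<Longrightarrow> tdeg (f * g) = tdeg f + tdeg g"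
  using tdeg_mult_aux by blast

lemma laurent_mult_eq_0_iff: "(f :: laurent) * g = 0 \<longleftrightarrow> f = 0 \<or> g = 0"
  using tdeg_mult_aux[of f g] by auto

lemma laurent_mult_left_cancel: "(f :: laurent) \<noteq> 0 \<Longrightarrow> f * g = f * h \<longleftrightarrow> g = h"
  using laurent_mult_eq_0_iff[of f "g - h"] by (auto simp: algebra_simps)

lemma laurent_power_eq_0_iff: "(f :: laurent) ^ n = 0 \<longleftrightarrow> f = 0 \<and> n > 0"
  by (induction n) (auto simp: laurent_mult_eq_0_iff)

lemma tdeg_single: "c \<noteq> 0 \<Longrightarrow> tdeg (single (m, n) c) = m + n"
  by (simp add: tdeg_def)

lemma single_0_of_int: "single (0, 0) (c :: int) = of_int c"
  by (metis single_of_int of_int_eq_id id_apply zero_prod_def)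

lemma of_int_laurent_eq_0_iff: "(of_int c :: laurent) = 0 \<longleftrightarrow> c = 0"
  by (metis single_0_of_int lookup_single_eq lookup_zero of_int_0)

lemma tdeg_of_int: "tdeg (of_int c) = 0" if "c \<noteq> 0"
  using tdeg_single[OF that, of 0 0] by (simp add: single_0_of_int)

lemma tdeg_power: "f \<noteq> 0 \<Longrightarrow> tdeg (f ^ n) = int n * tdeg f"
proof (induction n)
  case 0
  show ?case using tdeg_of_int[of 1] by simp
next
  case (Suc n)
  then show ?case
    by (simp add: tdeg_mult laurent_power_eq_0_iff algebra_simps)
qed

subsection \<open>Rows and columns\<close>

text \<open>For \<open>h\<close> the identity this regroups by powers of \<open>X\<close> with
  coefficients in \<open>Y\<close> (columns), for \<open>prod.swap\<close> the other way round
  (rows).\<close>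

definition view :: "(int \<times> int \<Rightarrow> int \<times> int) \<Rightarrow> laurent \<Rightarrow> int \<Rightarrow>\<^sub>0 int \<Rightarrow>\<^sub>0 int" where
  "view h f = (\<Sum>e\<in>keys f. single (fst (h e)) (single (snd (h e)) (lookup f e)))"

lemma view_superset:
  "finite S \<Longrightarrow> keys f \<subseteq> S \<Longrightarrow> view h f = (\<Sum>e\<in>S. single (fst (h e)) (single (snd (h e)) (lookup f e)))"
  unfolding view_def by (rule sum.mono_neutral_left) (auto simp: in_keys_iff)

lemma view_single: "view h (single e c) = single (fst (h e)) (single (snd (h e)) c)"
  by (subst view_superset[of "{e}"]) auto

lemma view_add: "view h (f + g) = view h f + view h g"
proof -
  let ?S = "keys f \<union> keys g"
  show ?thesis
    using keys_add[of f g]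
    by (simp add: view_superset[of ?S] sum.distrib single_add lookup_add)
qed

lemma view_sum: "finite I \<Longrightarrow> view h (sum f I) = (\<Sum>i\<in>I. view h (f i))"
  by (induction I rule: finite_induct) (auto simp: view_add, simp add: view_def)

lemma view_mult:
  assumes h: "\<And>a b. h (a + b) = h a + h b"
  shows "view h (f * g) = view h f * view h g"
proof -
  have "f * g = (\<Sum>a\<in>keys f. \<Sum>b\<in>keys g. single (a + b) (lookup f a * lookup g b))"
    by (subst laurent_eq_sum[of f], subst laurent_eq_sum[of g])
      (simp add: sum_product mult_single)
  then have "view h (f * g) = (\<Sum>a\<in>keys f. \<Sum>b\<in>keys g. view h (single (a + b) (lookup f a * lookup g b)))"
    by (simp add: view_sum)
  also have "\<dots> = view h f * view h g"
    by (simp add: view_def[of h f] view_def[of h g] sum_product view_single mult_single h)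
  finally show ?thesis .
qed

lemma lookup_view_id: "lookup (lookup (view (\<lambda>e. e) f) n) m = lookup f (n, m)"
proof -
  have "lookup (lookup (view (\<lambda>e. e) f) n) m = (\<Sum>e\<in>insert (n, m) (keys f). if e = (n, m) then lookup f e else 0)"
    by (subst view_superset[of "insert (n, m) (keys f)"])
      (auto simp: lookup_sum lookup_single when_def prod_eq_iff intro!: sum.cong)
  then show ?thesis by simp
qed

lemma lookup_view_swap: "lookup (lookup (view prod.swap f) n) m = lookup f (m, n)"
proof -
  have "lookup (lookup (view prod.swap f) n) m = (\<Sum>e\<in>insert (m, n) (keys f). if e = (m, n) then lookup f e else 0)"
    by (subst view_superset[of "insert (m, n) (keys f)"])
      (auto simp: lookup_sum lookup_single when_def prod_eq_iff intro!: sum.cong)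
  then show ?thesis by simp
qed

section \<open>The coordinate ring inside the Laurent polynomials\<close>

definition Z :: laurent where
  "Z = single (2, -1) 1 + single (-1, 2) 1 + single (-1, -1) 1"

lemma XYZ_eqn: "X * Y * Z = X ^ 3 + Y ^ 3 + 1"
  by (simp add: Z_def distrib_left mult_single power3_eq_cube single_one[symmetric] zero_prod_def del: single_one)

lemma XY_nonzero: "X \<noteq> 0" "Y \<noteq> 0"
  by (auto simp: poly_mapping_eq_iff fun_eq_iff lookup_single when_def)

definition coord_ring :: "laurent set" where
  "coord_ring = range (eval3 (X, Y, Z))"

lemma eval3_in_coord_ring [simp]: "eval3 (X, Y, Z) g \<in> coord_ring"
  by (simp add: coord_ring_def)

lemma coord_ring_closed:
  shows "of_int k \<in> coord_ring" "X \<in> coord_ring" "Y \<in> coord_ring" "Z \<in> coord_ring"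
    and "f \<in> coord_ring \<Longrightarrow> g \<in> coord_ring \<Longrightarrow> f + g \<in> coord_ring"
    and "f \<in> coord_ring \<Longrightarrow> g \<in> coord_ring \<Longrightarrow> f - g \<in> coord_ring"
    and "f \<in> coord_ring \<Longrightarrow> g \<in> coord_ring \<Longrightarrow> f * g \<in> coord_ring"
  using eval3_in_coord_ring[of "of_int k"] eval3_in_coord_ring[of var_x] eval3_in_coord_ring[of var_y]
    eval3_in_coord_ring[of var_z]
  by (auto simp: eval3_hom eval3_var coord_ring_def simp flip: eval3_hom(3,4,6))

lemma coord_ring_power: "f \<in> coord_ring \<Longrightarrow> f ^ n \<in> coord_ring"
  by (induction n) (use coord_ring_closed(1)[of 1] in \<open>auto intro: coord_ring_closed\<close>)

lemma coord_ring_numeral: "numeral k \<in> coord_ring" "1 \<in> coord_ring"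
  using coord_ring_closed(1)[of "numeral k"] coord_ring_closed(1)[of 1] by auto

lemma coord_ring_induct [consumes 1, case_names const X Y Z add mult]:
  assumes "f \<in> coord_ring"
    and "\<And>k. P (of_int k)" "P X" "P Y" "P Z"
    and "\<And>f g. f \<in> coord_ring \<Longrightarrow> g \<in> coord_ring \<Longrightarrow> P f \<Longrightarrow> P g \<Longrightarrow> P (f + g)"
    and "\<And>f g. f \<in> coord_ring \<Longrightarrow> g \<in> coord_ring \<Longrightarrow> P f \<Longrightarrow> P g \<Longrightarrow> P (f * g)"
  shows "P f"
proof -
  have "P (eval3 (X, Y, Z) g)" for g
    by (induction g rule: poly3_induct) (auto simp: eval3_const eval3_var eval3_hom assms)
  then show ?thesis
    using assms(1) by (auto simp: coord_ring_def)
qed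

subsection \<open>Negative rows and columns\<close>

abbreviation cube_plus_1 :: "int \<Rightarrow>\<^sub>0 int" where
  "cube_plus_1 \<equiv> single 3 1 + 1"

text \<open>The trace of the exchange relation: a negative power of one variable should enter only
  through \<open>(t ^ 3 + 1)\<close> divided by that variable, \<open>t\<close> being the other one.
  For \<open>n \<ge> 0\<close> the exponent \<open>nat (- n)\<close> is 0 and nothing is
  required.\<close>

definition cube_divisible :: "(int \<Rightarrow>\<^sub>0 int \<Rightarrow>\<^sub>0 int) \<Rightarrow> bool" where
  "cube_divisible F \<longleftrightarrow> (\<forall>n. cube_plus_1 ^ nat (- n) dvd lookup F n)"

lemma cube_divisible_single:
  "cube_plus_1 ^ nat (- n) dvd c \<Longrightarrow> cube_divisible (single n c)"
  by (auto simp: cube_divisible_def lookup_single when_def)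

lemma cube_divisible_add: "cube_divisible F \<Longrightarrow> cube_divisible G \<Longrightarrow> cube_divisible (F + G)"
  by (simp add: cube_divisible_def lookup_add)

text \<open>The exponent \<open>nat (- n)\<close> is subadditive in \<open>n\<close>, so each
  summand of a convolution already has enough factors.\<close>

lemma cube_divisible_mult:
  assumes "cube_divisible F" "cube_divisible G"
  shows "cube_divisible (F * G)"
  unfolding cube_divisible_def
proof
  fix n
  have "(n = l + q) = (n - l = q)" for l q :: int
    by auto
  then have "lookup (F * G) n = (\<Sum>l. lookup F l * lookup G (n - l))"
    by (simp add: lookup_mult)
  also have "\<dots> = (\<Sum>l\<in>keys F. lookup F l * lookup G (n - l))"
    by (rule Sum_any.expand_superset) (auto simp: in_keys_iff)
  also have "cube_plus_1 ^ nat (- n) dvd \<dots>"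
  proof (rule dvd_sum)
    fix l
    have "cube_plus_1 ^ (nat (- l) + nat (- (n - l))) dvd lookup F l * lookup G (n - l)"
      unfolding power_add using assms unfolding cube_divisible_def by (intro mult_dvd_mono) blast+
    moreover have "cube_plus_1 ^ nat (- n) dvd cube_plus_1 ^ (nat (- l) + nat (- (n - l)))"
      by (rule le_imp_power_dvd) arith
    ultimately show "cube_plus_1 ^ nat (- n) dvd lookup F l * lookup G (n - l)"
      by (rule dvd_trans[rotated])
  qed
  finally show "cube_plus_1 ^ nat (- n) dvd lookup (F * G) n" .
qed

text \<open>Only \<open>Z\<close> has negative exponents among the generators, and its coefficient
  at exponent -1 is \<open>t ^ 2 + 1 / t = (t ^ 3 + 1) / t\<close>.\<close>

lemma coord_ring_cube_divisible:
  assumes "f \<in> coord_ring" and h: "h = (\<lambda>e. e) \<or> h = prod.swap"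
  shows "cube_divisible (view h f)"
proof -
  have h_add: "h (a + b) = h a + h b" for a b
    using h by (cases a; cases b) auto
  have Z': "single 2 1 + single (- 1) 1 = cube_plus_1 * single (- 1) 1"
    by (simp add: distrib_right mult_single)
  show ?thesis
    using assms(1)
  proof (induction f rule: coord_ring_induct)
    case (const k)
    have "view h (of_int k) = single 0 (single 0 k)"
      unfolding single_0_of_int[symmetric] using h by (auto simp: view_single)
    then show ?case by (auto intro!: cube_divisible_single)
  next
    case X
    show ?case using h by (auto simp: view_single intro!: cube_divisible_single)
  next
    case Y
    show ?case using h by (auto simp: view_single intro!: cube_divisible_single)
  next
    case Z
    have "view h Z = single (- 1) (single 2 1 + single (- 1) 1) + single 2 (single (- 1) 1)"
      using h by (auto simp: Z_def view_add view_single single_add)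
    also have "cube_divisible \<dots>"
      unfolding Z' by (intro cube_divisible_add cube_divisible_single) auto
    finally show ?case .
  qed (auto simp: view_add view_mult[OF h_add] intro: cube_divisible_add cube_divisible_mult)
qed

lemma cube_plus_1_keys: "keys cube_plus_1 = {0, 3}"
  by (auto simp: in_keys_iff lookup_add lookup_single lookup_one when_def split: if_splits)

lemma cube_plus_1_power_keys:
  "cube_plus_1 ^ k \<noteq> 0 \<and> Max (keys (cube_plus_1 ^ k)) = 3 * int k \<and> Min (keys (cube_plus_1 ^ k)) = 0"
proof (induction k)
  case (Suc k)
  have "cube_plus_1 \<noteq> 0"
    using cube_plus_1_keys by force
  with Suc show ?case
    by (simp add: Max_Min_keys_mult cube_plus_1_keys)
qed simp

lemma cube_divisible_cofactor:
  assumes "cube_divisible F" "n \<le> 0" "lookup F n \<noteq> 0"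
  obtains c where "c \<noteq> 0" "lookup F n = cube_plus_1 ^ nat (- n) * c"
    "Max (keys (lookup F n)) = 3 * (- n) + Max (keys c)" "Min (keys (lookup F n)) = Min (keys c)"
proof -
  obtain c where c: "lookup F n = cube_plus_1 ^ nat (- n) * c"
    using assms(1) unfolding cube_divisible_def dvd_def by blast
  with assms(3) have "c \<noteq> 0" by auto
  with cube_plus_1_power_keys[of "nat (- n)"] assms(2) show ?thesis
    by (intro that[OF _ c]) (auto simp: c Max_Min_keys_mult)
qed

text \<open>The factor \<open>(t ^ 3 + 1) ^ (- n)\<close> alone has exponents from 0 to
  \<open>3 * (- n)\<close>, and extents add under multiplication.\<close>

lemma cube_divisible_spread:
  assumes "cube_divisible F" "n < 0" "lookup F n \<noteq> 0"
  shows "Max (keys (lookup F n)) \<ge> Min (keys (lookup F n)) + 3 * (- n)"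
proof -
  obtain c where "c \<noteq> 0" "lookup F n = cube_plus_1 ^ nat (- n) * c"
    "Max (keys (lookup F n)) = 3 * (- n) + Max (keys c)" "Min (keys (lookup F n)) = Min (keys c)"
    using cube_divisible_cofactor[OF assms(1) less_imp_le[OF assms(2)] assms(3)] by blast
  with finite_keys_int_bounds(3)[OF \<open>c \<noteq> 0\<close> finite_keys_int_bounds(2)] show ?thesis by simp
qed

text \<open>The window from -1 to 2 has exactly the width 3 of \<open>t ^ 3 + 1\<close>, so the
  cofactor is a multiple of a single monomial.\<close>

lemma cube_divisible_row_minus_1:
  assumes "cube_divisible F" "\<And>k. k \<in> keys (lookup F (-1)) \<Longrightarrow> -1 \<le> k \<and> k \<le> 2"
  shows "\<exists>a. lookup F (-1) = single (-1) a + single 2 a"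
proof (cases "lookup F (-1) = 0")
  case True
  then show ?thesis by (intro exI[of _ 0]) simp
next
  case False
  obtain c where c: "c \<noteq> 0" "lookup F (-1) = cube_plus_1 ^ nat (- (-1)) * c"
    "Max (keys (lookup F (-1))) = 3 * (- (-1)) + Max (keys c)" "Min (keys (lookup F (-1))) = Min (keys c)"
    using cube_divisible_cofactor[OF assms(1) _ False, where thesis = thesis] by (simp only: neg_le_0_iff_le zero_le_one)
  have "Max (keys (lookup F (-1))) \<le> 2" "-1 \<le> Min (keys (lookup F (-1)))"
    using finite_keys_int_bounds(1,2)[OF False] assms(2) by auto
  with c(3,4) have "Max (keys c) \<le> -1" "-1 \<le> Min (keys c)"
    by linarith+
  then have "k = -1" if "k \<in> keys c" for k
    using finite_keys_int_bounds(3,4)[OF c(1) that] by linarith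
  then have "keys c \<subseteq> {-1}"
    by blast
  then have "c = single (-1) (lookup c (-1))"
    by (intro poly_mapping_eqI) (auto simp: in_keys_iff lookup_single when_def subset_iff)
  with c(2) have "lookup F (-1) = cube_plus_1 * single (-1) (lookup c (-1))"
    by (metis nat_one_as_int minus_minus power_one_right)
  then show ?thesis
    by (intro exI[of _ "lookup c (-1)"]) (simp add: distrib_right mult_single add.commute)
qed

lemma coord_ring_column_spread:
  assumes "f \<in> coord_ring" "(m, n) \<in> keys f" "m < 0"
  obtains n1 n2 where "(m, n1) \<in> keys f" "(m, n2) \<in> keys f" "n1 \<le> n" "n1 + 3 * (- m) \<le> n2"
proof -
  let ?c = "lookup (view (\<lambda>e. e) f) m"
  have k: "k \<in> keys ?c \<longleftrightarrow> (m, k) \<in> keys f" for k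
    by (simp add: in_keys_iff lookup_view_id)
  have nz: "?c \<noteq> 0"
    using assms(2) k by fastforce
  show ?thesis
    using cube_divisible_spread[OF coord_ring_cube_divisible[OF assms(1)] assms(3) nz]
      finite_keys_int_bounds[OF nz] assms(2)
    by (intro that[of "Min (keys ?c)" "Max (keys ?c)"]) (auto simp: k[symmetric])
qed

lemma coord_ring_row_spread:
  assumes "f \<in> coord_ring" "(m, n) \<in> keys f" "n < 0"
  obtains m1 m2 where "(m1, n) \<in> keys f" "(m2, n) \<in> keys f" "m1 \<le> m" "m1 + 3 * (- n) \<le> m2"
proof -
  let ?c = "lookup (view prod.swap f) n"
  have k: "k \<in> keys ?c \<longleftrightarrow> (k, n) \<in> keys f" for k
    by (simp add: in_keys_iff lookup_view_swap)
  have nz: "?c \<noteq> 0"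
    using assms(2) k by fastforce
  show ?thesis
    using cube_divisible_spread[OF coord_ring_cube_divisible[OF assms(1)] assms(3) nz]
      finite_keys_int_bounds[OF nz] assms(2)
    by (intro that[of "Min (keys ?c)" "Max (keys ?c)"]) (auto simp: k[symmetric])
qed

subsection \<open>Newton polygons of elements of small weight\<close>

text \<open>By the spread, a column \<open>i < 0\<close> that stays in \<open>j \<ge> 0\<close> has
  a monomial of weight at least \<open>2 * \<alpha>\<close>. A row \<open>j < 0\<close> that stays
  in \<open>i \<ge> 0\<close> has one of weight at least \<open>3 * \<alpha> - \<beta>\<close>,
  which is at least \<open>3 / 2 * \<alpha>\<close>. Small weight therefore pushes the support into
  the negative quadrant, and the spread of its leftmost column and lowest row gives the two far
  monomials.\<close>

lemma coord_ring_negative_corner: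
  assumes f: "f \<in> coord_ring" and \<alpha>: "0 < \<alpha>" "\<alpha> \<le> \<beta>" "2 * \<beta> \<le> 3 * \<alpha>"
    and small: "\<And>m n. (m, n) \<in> keys f \<Longrightarrow> 2 * (\<alpha> * m + \<beta> * n) < 3 * \<alpha>"
    and mn: "(m, n) \<in> keys f" "m < 0 \<or> n < 0"
  obtains a b m' n' where "a \<ge> 1" "b \<ge> 1" "\<And>i j. (i, j) \<in> keys f \<Longrightarrow> - a \<le> i \<and> - b \<le> j"
    "(- a, n') \<in> keys f" "3 * a - b \<le> n'" "(m', - b) \<in> keys f" "3 * b - a \<le> (m' :: int)"
proof -
  have col: "\<exists>j<0. (i, j) \<in> keys f" if ik: "(i, k) \<in> keys f" "i < 0" for i k
  proof -
    obtain n1 n2 where n: "(i, n1) \<in> keys f" "(i, n2) \<in> keys f" "n1 + 3 * (- i) \<le> n2"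
      using coord_ring_column_spread[OF f ik] by blast
    have "n1 < 0"
    proof (rule ccontr)
      assume "\<not> n1 < 0"
      then have "\<beta> * n2 \<ge> \<beta> * (3 * (- i))"
        using n \<alpha> by (intro mult_left_mono) auto
      moreover have "\<beta> * (- i) \<ge> \<alpha> * (- i)"
        using \<alpha> that by (intro mult_right_mono) auto
      moreover have "\<alpha> * (- i) \<ge> \<alpha> * 1"
        using \<alpha> that by (intro mult_left_mono) auto
      ultimately show False
        using small[OF n(2)] \<alpha> by (auto simp: algebra_simps)
    qed
    with n show ?thesis by blast
  qed
  have row: "\<exists>i<0. (i, j) \<in> keys f" if kj: "(k, j) \<in> keys f" "j < 0" for j k
  proof -
    obtain n1 n2 where n: "(n1, j) \<in> keys f" "(n2, j) \<in> keys f" "n1 + 3 * (- j) \<le> n2"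
      using coord_ring_row_spread[OF f kj] by blast
    have "n1 < 0"
    proof (rule ccontr)
      assume "\<not> n1 < 0"
      then have "\<alpha> * n2 \<ge> \<alpha> * (3 * (- j))"
        using n \<alpha> by (intro mult_left_mono) auto
      moreover have "2 * \<beta> * (- j) \<le> 3 * \<alpha> * (- j)"
        using \<alpha> that by (intro mult_right_mono) auto
      moreover have "\<alpha> * (- j) \<ge> \<alpha> * 1"
        using \<alpha> that by (intro mult_left_mono) auto
      ultimately show False
        using small[OF n(2)] \<alpha> by (auto simp: algebra_simps)
    qed
    with n show ?thesis by blast
  qed
  let ?I = "fst ` keys f" and ?J = "snd ` keys f"
  obtain i j where neg: "(i, j) \<in> keys f" "i < 0" "j < 0"
    using mn row col by blast
  have fin: "finite ?I" "finite ?J" "?I \<noteq> {}" "?J \<noteq> {}"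
    using mn(1) by auto
  \<comment> \<open>\<open>(- a, - b)\<close> is the lower left corner of the bounding box of the
    support; it need not belong to the support.\<close>
  define a where "a = - Min ?I"
  define b where "b = - Min ?J"
  have min: "- a \<le> i \<and> - b \<le> j" if "(i, j) \<in> keys f" for i j
    using that fin unfolding a_def b_def by (force intro!: Min_le)
  have "- a \<in> ?I" "- b \<in> ?J"
    unfolding a_def b_def minus_minus by (rule Min_in[OF fin(1,3)], rule Min_in[OF fin(2,4)])
  then obtain n0 m0 where ab: "(- a, n0) \<in> keys f" "(m0, - b) \<in> keys f"
    by auto
  have ab1: "a \<ge> 1" "b \<ge> 1"
    using min[OF neg(1)] neg by auto
  then have neg_ab: "- a < 0" "- b < 0"
    by auto
  obtain n1 n' where n': "(- a, n1) \<in> keys f" "(- a, n') \<in> keys f" "n1 + 3 * (- (- a)) \<le> n'"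
    using coord_ring_column_spread[OF f ab(1) neg_ab(1)] by blast
  obtain m1 m' where m': "(m1, - b) \<in> keys f" "(m', - b) \<in> keys f" "m1 + 3 * (- (- b)) \<le> m'"
    using coord_ring_row_spread[OF f ab(2) neg_ab(2)] by blast
  show ?thesis
    using min[OF n'(1)] min[OF m'(1)] n' m' by (intro that[OF ab1 min n'(2) _ m'(2)]) auto
qed

text \<open>Negative exponents would yield monomials in column \<open>- a\<close> and row
  \<open>- b\<close> whose weights add up to at least \<open>(3 * \<beta> - 2 * \<alpha>) * a + (3 *
  \<alpha> - 2 * \<beta>) * b\<close>. Both coefficients are nonnegative in the given range and
  \<open>a, b \<ge> 1\<close>, so the sum is at least
  \<open>\<alpha> + \<beta> \<ge> 2 * \<alpha>\<close>, too much for two weights below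
  \<open>\<alpha>\<close>.\<close>

lemma coord_ring_const:
  assumes f: "f \<in> coord_ring" and \<alpha>: "0 < \<alpha>" "\<alpha> \<le> \<beta>" "2 * \<beta> \<le> 3 * \<alpha>"
    and small: "\<And>m n. (m, n) \<in> keys f \<Longrightarrow> \<alpha> * m + \<beta> * n < \<alpha>"
  shows "\<exists>k. f = of_int k"
proof -
  have nonneg: "0 \<le> i \<and> 0 \<le> j" if ij: "(i, j) \<in> keys f" for i j
  proof (rule ccontr)
    assume "\<not> (0 \<le> i \<and> 0 \<le> j)"
    then have "i < 0 \<or> j < 0" by auto
    moreover have "2 * (\<alpha> * m + \<beta> * n) < 3 * \<alpha>" if "(m, n) \<in> keys f" for m n
      using small[OF that] \<alpha> by (simp add: algebra_simps)
    ultimately obtain a b m' n' where ab: "a \<ge> 1" "b \<ge> 1"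
      "(- a, n') \<in> keys f" "3 * a - b \<le> n'" "(m', - b) \<in> keys f" "3 * b - a \<le> m'"
      using coord_ring_negative_corner[OF f \<alpha> _ ij] by metis
    have "\<beta> * (3 * a - b) \<le> \<beta> * n'" "\<alpha> * (3 * b - a) \<le> \<alpha> * m'"
      using ab \<alpha> by (auto intro!: mult_left_mono)
    with small[OF ab(3)] small[OF ab(5)]
    have "\<beta> * (3 * a - b) - \<alpha> * a + \<alpha> * (3 * b - a) - \<beta> * b < 2 * \<alpha>"
      by (auto simp: algebra_simps)
    then have "(3 * \<beta> - 2 * \<alpha>) * a + (3 * \<alpha> - 2 * \<beta>) * b < 2 * \<alpha>"
      by (simp add: algebra_simps)
    moreover have "(3 * \<beta> - 2 * \<alpha>) * 1 \<le> (3 * \<beta> - 2 * \<alpha>) * a" "(3 * \<alpha> - 2 * \<beta>) * 1 \<le> (3 * \<alpha> - 2 * \<beta>) * b"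
      using mult_left_mono[OF ab(1), of "3 * \<beta> - 2 * \<alpha>"] mult_left_mono[OF ab(2), of "3 * \<alpha> - 2 * \<beta>"] \<alpha>
      by simp_all
    ultimately show False using \<alpha> by (simp add: algebra_simps)
  qed
  have "(i, j) = 0" if ij: "(i, j) \<in> keys f" for i j
  proof (rule ccontr)
    assume "(i, j) \<noteq> 0"
    with nonneg[OF ij] have "i \<ge> 1 \<or> j \<ge> 1" by (auto simp: zero_prod_def)
    moreover have "\<alpha> * i \<ge> 0" "\<beta> * j \<ge> 0"
      using nonneg[OF ij] \<alpha> by auto
    moreover have "\<alpha> * 1 \<le> \<alpha> * i" if "1 \<le> i"
      using mult_left_mono[OF that, of \<alpha>] \<alpha>(1) by linarith
    moreover have "\<beta> * 1 \<le> \<beta> * j" if "1 \<le> j"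
      using mult_left_mono[OF that, of \<beta>] \<alpha>(1,2) by linarith
    ultimately show False
      using small[OF ij] \<alpha> by linarith
  qed
  then have "f = of_int (lookup f 0)"
    by (intro poly_mapping_eqI) (auto simp: lookup_of_int when_def in_keys_iff)
  then show ?thesis by blast
qed

lemma coord_ring_tle_0: "f \<in> coord_ring \<Longrightarrow> tle f 0 \<Longrightarrow> \<exists>k. f = of_int k"
  by (rule coord_ring_const[of f 1 1]) (auto simp: tle_def)

lemma coord_ring_tdeg_pos: "f \<in> coord_ring \<Longrightarrow> \<nexists>k. f = of_int k \<Longrightarrow> 1 \<le> tdeg f"
  using coord_ring_tle_0[of f] tle_iff_tdeg[of f 0] by (metis int_one_le_iff_zero_less not_le of_int_0)

text \<open>The support lies in the triangle with vertices \<open>(-1, -1)\<close>,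
  \<open>(2, -1)\<close>, \<open>(-1, 2)\<close>. On the two edges through \<open>(-1, -1)\<close>
  divisibility leaves a multiple of \<open>Z\<close>, and off them only \<open>(0, 0)\<close>,
  \<open>(1, 0)\<close>, \<open>(0, 1)\<close> remain.\<close>

lemma coord_ring_tle_1:
  assumes f: "f \<in> coord_ring" and small: "tle f 1"
  obtains e c d w where "f = of_int e + of_int c * X + of_int d * Y + of_int w * Z"
proof -
  have sm: "m + n \<le> 1" if "(m, n) \<in> keys f" for m n
    using small that by (auto simp: tle_def)
  have low: "-1 \<le> i \<and> -1 \<le> j" if ij: "(i, j) \<in> keys f" for i j
  proof (cases "i < 0 \<or> j < 0")
    case True
    show ?thesis
    proof (rule coord_ring_negative_corner[OF f, of 1 1 i j])
      fix a b m' n' assume ab: "\<And>i j. (i, j) \<in> keys f \<Longrightarrow> - a \<le> i \<and> - b \<le> j"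
        "(- a, n') \<in> keys f" "3 * a - b \<le> n'" "(m', - b) \<in> keys f" "3 * b - a \<le> m'"
      \<comment> \<open>The far monomials have total degree at most 1, so
        \<open>2 * a - b \<le> 1\<close> and \<open>2 * b - a \<le> 1\<close>.\<close>
      have "a \<le> 1" "b \<le> 1"
        using sm[OF ab(2)] sm[OF ab(4)] ab(3,5) by linarith+
      with ab(1)[OF ij] show ?thesis by linarith
    next
      show "2 * (1 * m + 1 * n) < 3 * (1 :: int)" if "(m, n) \<in> keys f" for m n
        using sm[OF that] by simp
    qed (use ij True in auto)
  qed auto
  let ?col = "view (\<lambda>e. e) f" and ?row = "view prod.swap f"
  have kcol: "k \<in> keys (lookup ?col (-1)) \<longleftrightarrow> (-1, k) \<in> keys f"
    and krow: "k \<in> keys (lookup ?row (-1)) \<longleftrightarrow> (k, -1) \<in> keys f" for k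
    by (simp_all add: in_keys_iff lookup_view_id lookup_view_swap)
  have small_col: "-1 \<le> k \<and> k \<le> 2" if "(-1, k) \<in> keys f" for k
    using low[OF that] sm[OF that] by simp
  have small_row: "-1 \<le> k \<and> k \<le> 2" if "(k, -1) \<in> keys f" for k
    using low[OF that] sm[OF that] by simp
  have "\<exists>a. lookup ?col (-1) = single (-1) a + single 2 a"
    by (rule cube_divisible_row_minus_1[OF coord_ring_cube_divisible[OF f]])
      (simp_all add: kcol small_col)
  then obtain a where "lookup ?col (-1) = single (-1) a + single 2 a" by blast
  then have col: "lookup f (-1, k) = (if k = -1 \<or> k = 2 then a else 0)" for k
    unfolding lookup_view_id[of f "-1" k, symmetric] by (simp add: lookup_add lookup_single when_def)
  have "\<exists>a. lookup ?row (-1) = single (-1) a + single 2 a"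
    by (rule cube_divisible_row_minus_1[OF coord_ring_cube_divisible[OF f]])
      (simp_all add: krow small_row)
  then obtain b where "lookup ?row (-1) = single (-1) b + single 2 b" by blast
  then have row: "lookup f (k, -1) = (if k = -1 \<or> k = 2 then b else 0)" for k
    unfolding lookup_view_swap[of f "-1" k, symmetric] by (simp add: lookup_add lookup_single when_def)
  \<comment> \<open>Row and column share the corner \<open>(-1, -1)\<close>.\<close>
  have "b = a" using row[of "-1"] col[of "-1"] by simp
  have "f = of_int (lookup f (0, 0)) + of_int (lookup f (1, 0)) * X + of_int (lookup f (0, 1)) * Y + of_int a * Z"
    (is "f = ?g")
  proof (rule poly_mapping_eqI)
    fix k :: "int \<times> int"
    obtain i j where k: "k = (i, j)" by fastforce
    have g: "lookup ?g (i, j) = (lookup f (0, 0) when i = 0 \<and> j = 0) + (lookup f (1, 0) when i = 1 \<and> j = 0)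
        + (lookup f (0, 1) when i = 0 \<and> j = 1)
        + (a when i = 2 \<and> j = -1) + (a when i = -1 \<and> j = 2) + (a when i = -1 \<and> j = -1)"
      by (auto simp: single_0_of_int[symmetric] Z_def distrib_left mult_single lookup_add lookup_single when_def)
    have "i = -1 \<or> j = -1 \<or> (i = 0 \<and> j = 0) \<or> (i = 1 \<and> j = 0) \<or> (i = 0 \<and> j = 1)"
      if "(i, j) \<in> keys f"
      using low[OF that] sm[OF that] by presburger
    then consider "i = -1" | "j = -1" | "i = 0" "j = 0" | "i = 1" "j = 0" | "i = 0" "j = 1"
      | "(i, j) \<notin> keys f" "i \<noteq> -1" "j \<noteq> -1" "\<not> (i = 0 \<and> j = 0)" "\<not> (i = 1 \<and> j = 0)" "\<not> (i = 0 \<and> j = 1)"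
      by blast
    then show "lookup f k = lookup ?g k"
      unfolding k g using col[of j] row[of i] \<open>b = a\<close> by cases (auto simp: when_def in_keys_iff)
  qed
  then show ?thesis by (rule that)
qed

section \<open>The log-canonical bracket\<close>

text \<open>For \<open>w = fst\<close> and \<open>w = snd\<close> these are the derivations
  \<open>x d/dx\<close> and \<open>y d/dy\<close>. Unlike partial derivatives they do not move
  exponents.\<close>

definition euler :: "(int \<times> int \<Rightarrow> int) \<Rightarrow> laurent \<Rightarrow> laurent" where
  "euler w f = (\<Sum>e\<in>keys f. single e (w e * lookup f e))"

lemma lookup_euler: "lookup (euler w f) e = w e * lookup f e"
proof -
  have "lookup (euler w f) e = (\<Sum>k\<in>keys f. if k = e then w k * lookup f k else 0)"
    by (auto simp: euler_def lookup_sum lookup_single when_def intro!: sum.cong)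
  then show ?thesis by (simp add: in_keys_iff)
qed

lemma keys_euler: "keys (euler w f) \<subseteq> keys f"
  by (auto simp: in_keys_iff lookup_euler)

lemma euler_add: "euler w (f + g) = euler w f + euler w g"
  by (rule poly_mapping_eqI) (simp add: lookup_euler lookup_add algebra_simps)

lemma euler_sum: "finite I \<Longrightarrow> euler w (sum f I) = (\<Sum>i\<in>I. euler w (f i))"
  by (induction I rule: finite_induct) (auto simp: euler_add, simp add: euler_def)

lemma euler_single: "euler w (single e c) = single e (w e * c)"
  by (simp add: euler_def)

lemma euler_mult:
  assumes w: "\<And>a b. w (a + b) = w a + w b"
  shows "euler w (f * g) = euler w f * g + f * euler w g"
proof -
  have "f * g = (\<Sum>a\<in>keys f. \<Sum>b\<in>keys g. single (a + b) (lookup f a * lookup g b))"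
    by (subst laurent_eq_sum[of f], subst laurent_eq_sum[of g])
      (simp add: sum_product mult_single)
  then have "euler w (f * g) = (\<Sum>a\<in>keys f. \<Sum>b\<in>keys g.
      single a (w a * lookup f a) * single b (lookup g b) + single a (lookup f a) * single b (w b * lookup g b))"
    by (simp add: euler_sum euler_single w mult_single algebra_simps flip: single_add)
  also have "\<dots> = euler w f * (\<Sum>b\<in>keys g. single b (lookup g b)) + (\<Sum>a\<in>keys f. single a (lookup f a)) * euler w g"
    by (simp add: sum.distrib sum_product euler_def)
  finally show ?thesis
    by (simp flip: laurent_eq_sum)
qed

text \<open>This is \<open>x y (f_x g_y - f_y g_x)\<close>, the Poisson bracket dual to the form
  \<open>dx dy / (x y)\<close>.\<close>

definition bracket :: "laurent \<Rightarrow> laurent \<Rightarrow> laurent" where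
  "bracket f g = euler fst f * euler snd g - euler snd f * euler fst g"

lemma lookup_single_mult: "lookup (single a c * f) (a + e) = c * lookup (f :: laurent) e"
  by (subst lookup_mult_extreme) (auto split: if_splits)

lemma euler_of_int: "w 0 = 0 \<Longrightarrow> euler w (of_int k) = 0"
  by (rule poly_mapping_eqI) (auto simp: lookup_euler lookup_of_int when_def)

lemma bracket_simps:
  "bracket (f + g) h = bracket f h + bracket g h"
  "bracket h (f + g) = bracket h f + bracket h g"
  "bracket (f * g) h = f * bracket g h + g * bracket f h"
  "bracket h (f * g) = f * bracket h g + g * bracket h f"
  "bracket (of_int k) h = 0" "bracket h (of_int k) = 0" "bracket f f = 0"
  by (simp_all add: bracket_def euler_add euler_mult euler_of_int algebra_simps)

lemma bracket_one: "bracket h 1 = 0"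
  using bracket_simps(6)[of h 1] by simp

lemma bracket_power3: "bracket h (f ^ 3) = 3 * f ^ 2 * bracket h f"
  by (simp add: power3_eq_cube power2_eq_square bracket_simps algebra_simps)

lemma bracket_swap: "bracket f g = - bracket g f"
  by (simp add: bracket_def)

lemma tle_bracket:
  assumes "tle f d" "tle g e"
  shows "tle (bracket f g) (d + e)"
proof -
  have "tle (euler w f) d" "tle (euler w g) e" for w
    using assms keys_euler unfolding tle_def by fast+
  then show ?thesis
    unfolding bracket_def by (intro tle_diff tle_mult)
qed

lemma bracket_X: "bracket X g = X * euler snd g" and bracket_Y: "bracket g Y = Y * euler fst g"
  by (simp_all add: bracket_def euler_single)

text \<open>Up to sign these are the partial derivatives of \<open>x y z - x^3 - y^3 - 1\<close>.
  Being polynomial in \<open>X\<close>, \<open>Y\<close>, \<open>Z\<close>, they show by the Leibniz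
  rule that the bracket preserves \<open>coord_ring\<close>.\<close>

lemma bracket_generators:
  "bracket X Y = X * Y" "bracket X Z = 3 * Y ^ 2 - X * Z" "bracket Z Y = 3 * X ^ 2 - Y * Z"
proof -
  show "bracket X Y = X * Y"
    by (simp add: bracket_X euler_single)
  have three: "(3 :: laurent) = single (0, 0) 3"
    using single_0_of_int[of 3] by simp
  show "bracket X Z = 3 * Y ^ 2 - X * Z" "bracket Z Y = 3 * X ^ 2 - Y * Z"
    by (simp_all add: bracket_X bracket_Y Z_def euler_add euler_single distrib_left mult_single
        power2_eq_square three)
      (rule poly_mapping_eqI, simp add: lookup_add lookup_minus lookup_single when_def)+
qed

lemma coord_ring_bracket:
  assumes "f \<in> coord_ring" "g \<in> coord_ring"
  shows "bracket f g \<in> coord_ring"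
proof -
  have gen: "bracket h g \<in> coord_ring"
    if "bracket h X \<in> coord_ring" "bracket h Y \<in> coord_ring" "bracket h Z \<in> coord_ring"
      "g \<in> coord_ring" for h g
    using that(4) by (induction g rule: coord_ring_induct)
      (use that coord_ring_closed(1)[of 0] in \<open>auto simp: bracket_simps intro: coord_ring_closed\<close>)
  have neg: "- h \<in> coord_ring" if "h \<in> coord_ring" for h
    using coord_ring_closed(6)[OF coord_ring_closed(1)[of 0] that] by simp
  note c = coord_ring_closed coord_ring_numeral coord_ring_power
  have XY: "bracket X Y \<in> coord_ring" and XZ: "bracket X Z \<in> coord_ring" and ZY: "bracket Z Y \<in> coord_ring"
    unfolding bracket_generators by (intro c)+
  have zero: "bracket h h \<in> coord_ring" for h
    using coord_ring_closed(1)[of 0] by (simp add: bracket_simps)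
  have swap: "bracket h g \<in> coord_ring" if "bracket g h \<in> coord_ring" for g h
    using neg[OF that] by (simp only: bracket_swap[of h g])
  note left = gen[OF zero XY XZ assms(2)] gen[OF swap[OF XY] zero swap[OF ZY] assms(2)]
    gen[OF swap[OF XZ] ZY zero assms(2)]
  show ?thesis
    by (rule swap[OF gen[OF swap[OF left(1)] swap[OF left(2)] swap[OF left(3)] assms(1)]])
qed

section \<open>Automorphisms of the coordinate ring\<close>

text \<open>Automorphisms of \<open>coord_ring\<close> as functions on all Laurent polynomials,
  constrained only on the subring, where \<open>X\<close> and \<open>Y\<close> need not be
  invertible.\<close>

locale coord_aut =
  fixes \<Phi> :: "laurent \<Rightarrow> laurent"
  assumes closed: "f \<in> coord_ring \<Longrightarrow> \<Phi> f \<in> coord_ring"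
    and add: "f \<in> coord_ring \<Longrightarrow> g \<in> coord_ring \<Longrightarrow> \<Phi> (f + g) = \<Phi> f + \<Phi> g"
    and mult: "f \<in> coord_ring \<Longrightarrow> g \<in> coord_ring \<Longrightarrow> \<Phi> (f * g) = \<Phi> f * \<Phi> g"
    and one: "\<Phi> 1 = 1"
    and inj: "inj_on \<Phi> coord_ring"
    and surj: "g \<in> coord_ring \<Longrightarrow> \<exists>f\<in>coord_ring. \<Phi> f = g"
begin

abbreviation "p \<equiv> \<Phi> X"
abbreviation "q \<equiv> \<Phi> Y"
abbreviation "r \<equiv> \<Phi> Z"

lemma zero: "\<Phi> 0 = 0"
  using add[of 0 0] coord_ring_closed(1)[of 0] by simp

lemma diff: "f \<in> coord_ring \<Longrightarrow> g \<in> coord_ring \<Longrightarrow> \<Phi> (f - g) = \<Phi> f - \<Phi> g"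
  using add[of "f - g" g] by (simp add: coord_ring_closed)

lemma const: "\<Phi> (of_int k) = of_int k"
proof -
  have nat: "\<Phi> (of_nat n) = of_nat n" for n
  proof (induction n)
    case (Suc n)
    then show ?case
      using add[of 1 "of_nat n"] coord_ring_closed(1)[of "int n"] by (simp add: one coord_ring_numeral)
  qed (simp add: zero)
  have "\<Phi> (- of_nat n) = - of_nat n" for n
    using diff[of 0 "of_nat n"] coord_ring_closed(1)[of "int n"] coord_ring_closed(1)[of 0]
    by (simp add: zero nat)
  with nat show ?thesis
    by (cases k rule: int_cases2) auto
qed

lemma power: "f \<in> coord_ring \<Longrightarrow> \<Phi> (f ^ n) = \<Phi> f ^ n"
  by (induction n) (auto simp: one mult coord_ring_power)

lemma nonzero: "f \<in> coord_ring \<Longrightarrow> f \<noteq> 0 \<Longrightarrow> \<Phi> f \<noteq> 0"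
  using inj zero coord_ring_closed(1)[of 0] unfolding inj_on_def by force

lemma const_iff: "f \<in> coord_ring \<Longrightarrow> \<Phi> f = of_int k \<longleftrightarrow> f = of_int k"
  using inj const[of k] coord_ring_closed(1)[of k] unfolding inj_on_def by metis

lemma pqr_closed: "p \<in> coord_ring" "q \<in> coord_ring" "r \<in> coord_ring"
  by (simp_all add: closed coord_ring_closed)

lemma pq_nonzero: "p \<noteq> 0" "q \<noteq> 0"
  using nonzero XY_nonzero by (simp_all add: coord_ring_closed)

lemma pqr_eqn: "p * q * r = p ^ 3 + q ^ 3 + 1"
proof -
  note c = coord_ring_closed coord_ring_numeral coord_ring_power
  have "\<Phi> (X * Y * Z) = \<Phi> (X ^ 3 + Y ^ 3 + 1)"
    by (simp only: XYZ_eqn)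
  then show ?thesis
    by (simp add: mult add power one c)
qed

lemma generators_nonconst: "\<nexists>k. X = of_int k" "\<nexists>k. Y = of_int k"
proof -
  have "lookup X (1, 0) \<noteq> lookup (of_int k :: laurent) (1, 0)" "lookup Y (0, 1) \<noteq> lookup (of_int k :: laurent) (0, 1)" for k
    by (simp_all add: lookup_of_int zero_prod_def when_def)
  then show "\<nexists>k. X = of_int k" "\<nexists>k. Y = of_int k"
    by metis+
qed

lemma tdeg_pq_pos: "1 \<le> tdeg p" "1 \<le> tdeg q"
  using generators_nonconst pqr_closed
  by (auto intro!: coord_ring_tdeg_pos simp: const_iff coord_ring_closed)

text \<open>Apply the derivation \<open>{p, -}\<close> to the equation of the surface;
  \<open>{p, p} = 0\<close> leaves a multiple of \<open>p\<close> on one side and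
  \<open>3 q^2 {p, q}\<close> on the other.\<close>

lemma bracket_pqr: "p * (r * bracket p q + q * bracket p r) = 3 * q ^ 2 * bracket p q"
proof -
  have "bracket p (p * q * r) = bracket p (p ^ 3 + q ^ 3 + 1)"
    by (simp only: pqr_eqn)
  then show ?thesis
    by (simp add: bracket_simps bracket_power3 bracket_one algebra_simps)
qed

lemma bracket_rpq: "q * (r * bracket p q + p * bracket r q) = 3 * p ^ 2 * bracket p q"
proof -
  have "bracket (p * q * r) q = bracket (p ^ 3 + q ^ 3 + 1) q"
    by (simp only: pqr_eqn)
  then have "bracket q (p * q * r) = bracket q (p ^ 3 + q ^ 3 + 1)"
    by (simp only: bracket_swap[of q])
  then show ?thesis
    by (simp add: bracket_simps bracket_power3 bracket_one bracket_swap[of q p] bracket_swap[of q r] algebra_simps)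
qed

text \<open>Since \<open>p (q r - p\<^sup>2) = q\<^sup>3 + 1\<close>, the element \<open>q\<close> is a unit modulo \<open>p\<close>, and
  differentiating the equation shows that both \<open>p\<close> and \<open>q\<close> divide \<open>3 {p, q}\<close>.
  The quotient \<open>\<lambda> = 3 {p, q} / (p q)\<close> has degree at most zero.\<close>

lemma bracket_pq_const: "\<exists>l. 3 * bracket p q = of_int l * (p * q)"
proof -
  define h where "h = bracket p q"
  define u where "u = r * h + q * bracket p r"
  define v where "v = r * h + p * bracket r q"
  note c = coord_ring_closed coord_ring_numeral coord_ring_power coord_ring_bracket pqr_closed
  have u: "p * u = 3 * q ^ 2 * h" and v: "q * v = 3 * p ^ 2 * h"
    using bracket_pqr bracket_rpq by (simp_all add: u_def v_def h_def)
  have cl: "u \<in> coord_ring" "v \<in> coord_ring" "h \<in> coord_ring"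
    by (simp_all add: u_def v_def h_def c)
  have 1: "p * (q * r - p ^ 2) = q ^ 3 + 1" and 2: "q * (p * r - q ^ 2) = p ^ 3 + 1"
    using pqr_eqn by (simp_all add: algebra_simps power2_eq_square power3_eq_cube)
  \<comment> \<open>Multiply \<open>3 * h\<close> by \<open>1 = p * (q * r - p ^ 2) - q ^ 3\<close>
    and replace \<open>3 * q ^ 2 * h\<close> by \<open>p * u\<close>: a factor \<open>p\<close>
    comes out.\<close>
  define u' where "u' = (q * r - p ^ 2) * (3 * h) - q * u"
  define v' where "v' = (p * r - q ^ 2) * (3 * h) - p * v"
  have u': "p * u' = 3 * h"
  proof -
    have "p * u' = (p * (q * r - p ^ 2)) * (3 * h) - q * (p * u)"
      by (simp add: u'_def algebra_simps)
    also have "\<dots> = 3 * h"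
      unfolding 1 u by (simp add: algebra_simps power2_eq_square power3_eq_cube)
    finally show ?thesis .
  qed
  have v': "q * v' = 3 * h"
  proof -
    have "q * v' = (q * (p * r - q ^ 2)) * (3 * h) - p * (q * v)"
      by (simp add: v'_def algebra_simps)
    also have "\<dots> = 3 * h"
      unfolding 2 v by (simp add: algebra_simps power2_eq_square power3_eq_cube)
    finally show ?thesis .
  qed
  \<comment> \<open>The same relation \<open>1 = p * (q * r - p ^ 2) - q ^ 3\<close>, now with
    \<open>3 * h = q * v'\<close> in the first summand and \<open>3 * h = p * u'\<close> in the
    second, shows both factors \<open>p * q\<close> at once.\<close>
  define l where "l = (q * r - p ^ 2) * v' - q ^ 2 * u'"
  have "p * q * l = (p * (q * r - p ^ 2)) * (q * v') - q ^ 3 * (p * u')"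
    by (simp add: l_def algebra_simps power2_eq_square power3_eq_cube)
  also have "\<dots> = 3 * h"
    unfolding 1 u' v' by (simp add: algebra_simps)
  finally have l: "p * q * l = 3 * h" .
  have l_closed: "l \<in> coord_ring"
    unfolding l_def u'_def v'_def by (intro c cl)
  have "tle l 0"
  proof (cases "l = 0")
    case False
    have "tle (3 * h) (0 + (tdeg p + tdeg q))"
      unfolding h_def using tle_of_int[of 0 3] pq_nonzero
      by (intro tle_mult tle_bracket) (auto simp: tle_iff_tdeg)
    then have "tle (p * q * l) (tdeg p + tdeg q)"
      by (simp add: l)
    then show ?thesis
      using False pq_nonzero by (simp add: tle_iff_tdeg tdeg_mult laurent_mult_eq_0_iff)
  qed (simp add: tle_def)
  from coord_ring_tle_0[OF l_closed this] obtain k where "l = of_int k" by blast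
  with l show ?thesis
    by (intro exI[of _ k]) (simp add: h_def mult.commute)
qed

text \<open>\<open>\<Phi>\<close> is Poisson up to the factor \<open>l / 3\<close>. Both sides are
  derivations along \<open>\<Phi>\<close> in \<open>g\<close>, so generators suffice; at
  \<open>Z\<close> the differentiated equation gives the claim times \<open>p * q\<close>, which
  cancels.\<close>

lemma bracket_images:
  assumes l: "3 * bracket p q = of_int l * (p * q)" and g: "g \<in> coord_ring"
  shows "3 * bracket p (\<Phi> g) = of_int l * \<Phi> (bracket X g)"
    and "3 * bracket (\<Phi> g) q = of_int l * \<Phi> (bracket g Y)"
proof -
  note c = coord_ring_closed coord_ring_numeral coord_ring_power coord_ring_bracket pqr_closed
  have three: "\<Phi> 3 = 3"
    using const[of 3] by simp
  have "p * q * (3 * bracket p r) = p * q * (of_int l * \<Phi> (bracket X Z))"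
  proof -
    have "p * q * (3 * bracket p r) = 3 * (p * (r * bracket p q + q * bracket p r) - p * (r * bracket p q))"
      by (simp add: algebra_simps)
    also have "\<dots> = (3 * q ^ 2 - p * r) * (3 * bracket p q)"
      unfolding bracket_pqr by (simp add: algebra_simps)
    also have "\<dots> = p * q * (of_int l * \<Phi> (bracket X Z))"
      unfolding l bracket_generators by (simp add: diff mult power three c algebra_simps)
    finally show ?thesis .
  qed
  then have Z1: "3 * bracket p r = of_int l * \<Phi> (bracket X Z)"
    using pq_nonzero by (simp add: laurent_mult_left_cancel laurent_mult_eq_0_iff)
  have "p * q * (3 * bracket r q) = p * q * (of_int l * \<Phi> (bracket Z Y))"
  proof -
    have "p * q * (3 * bracket r q) = 3 * (q * (r * bracket p q + p * bracket r q) - q * (r * bracket p q))"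
      by (simp add: algebra_simps)
    also have "\<dots> = (3 * p ^ 2 - q * r) * (3 * bracket p q)"
      unfolding bracket_rpq by (simp add: algebra_simps)
    also have "\<dots> = p * q * (of_int l * \<Phi> (bracket Z Y))"
      unfolding l bracket_generators by (simp add: diff mult power three c algebra_simps)
    finally show ?thesis .
  qed
  then have Z2: "3 * bracket r q = of_int l * \<Phi> (bracket Z Y)"
    using pq_nonzero by (simp add: laurent_mult_left_cancel laurent_mult_eq_0_iff)
  show "3 * bracket p (\<Phi> g) = of_int l * \<Phi> (bracket X g)"
    using g
  proof (induction g rule: coord_ring_induct)
    case (mult f g)
    have "3 * bracket p (\<Phi> (f * g)) = \<Phi> f * (3 * bracket p (\<Phi> g)) + \<Phi> g * (3 * bracket p (\<Phi> f))"
      by (simp add: coord_aut.mult[OF coord_aut_axioms] mult bracket_simps algebra_simps)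
    with mult show ?case
      by (simp add: coord_aut.mult[OF coord_aut_axioms] add bracket_simps c algebra_simps)
  qed (simp_all add: bracket_simps const zero l Z1 bracket_generators(1) add mult c distrib_left)
  show "3 * bracket (\<Phi> g) q = of_int l * \<Phi> (bracket g Y)"
    using g
  proof (induction g rule: coord_ring_induct)
    case (mult f g)
    have "3 * bracket (\<Phi> (f * g)) q = \<Phi> f * (3 * bracket (\<Phi> g) q) + \<Phi> g * (3 * bracket (\<Phi> f) q)"
      by (simp add: coord_aut.mult[OF coord_aut_axioms] mult bracket_simps algebra_simps)
    with mult show ?case
      by (simp add: coord_aut.mult[OF coord_aut_axioms] add bracket_simps c algebra_simps)
  qed (simp_all add: bracket_simps const zero l Z2 bracket_generators(1) add mult c distrib_left)
qed

text \<open>If \<open>l = 0\<close>, surjectivity makes \<open>p\<close> commute with the whole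
  ring. The brackets with \<open>X\<close> and \<open>Y\<close> are the two Euler derivatives up to
  sign and a monomial factor, so \<open>p\<close> would be constant.\<close>

lemma bracket_pq_nonzero:
  assumes l: "3 * bracket p q = of_int l * (p * q)"
  shows "l \<noteq> 0"
proof
  assume "l = 0"
  have three: "(3 :: laurent) \<noteq> 0"
    using of_int_laurent_eq_0_iff[of 3] by simp
  have br: "bracket p h = 0" if "h \<in> coord_ring" for h
  proof -
    obtain g where "g \<in> coord_ring" "h = \<Phi> g"
      using surj \<open>h \<in> coord_ring\<close> by blast
    with bracket_images(1)[OF l] \<open>l = 0\<close> three show ?thesis
      by (auto simp: laurent_mult_eq_0_iff)
  qed
  have "euler snd p = 0"
    using br[of X] bracket_swap[of p X] XY_nonzero
    by (simp add: coord_ring_closed bracket_X laurent_mult_eq_0_iff)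
  moreover have "euler fst p = 0"
    using br[of Y] XY_nonzero by (simp add: coord_ring_closed bracket_Y laurent_mult_eq_0_iff)
  ultimately have ev: "snd e * lookup p e = 0" "fst e * lookup p e = 0" for e
    by (metis lookup_euler lookup_zero)+
  then have "e = 0" if "e \<in> keys p" for e
    using that ev[of e] by (simp add: in_keys_iff prod_eq_iff)
  then have "tle p 0"
    by (fastforce simp: tle_def zero_prod_def)
  with tdeg_pq_pos pq_nonzero show False
    by (simp add: tle_iff_tdeg)
qed

text \<open>The bracket estimate makes \<open>f \<mapsto> tdeg (\<Phi> f)\<close> a monomial valuation: the operators
  \<open>{X, -} - k X\<close> and \<open>{-, Y} - k Y\<close> isolate a single monomial of \<open>f\<close> without raising the degree
  by more than that of \<open>p\<close> or \<open>q\<close>.\<close>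

lemma keys_weight_le:
  assumes "f \<in> coord_ring" "(m, n) \<in> keys f" "tle (\<Phi> f) d"
  shows "tdeg p * m + tdeg q * n \<le> d"
  using assms
proof (induction "card (keys f)" arbitrary: f m n d rule: less_induct)
  case less
  note c = coord_ring_closed coord_ring_numeral coord_ring_power coord_ring_bracket pqr_closed
  obtain l where l: "3 * bracket p q = of_int l * (p * q)"
    using bracket_pq_const by blast
  note l0 = bracket_pq_nonzero[OF l]
  have lcancel: "tle g e" if "tle (of_int l * g) e" for g e
  proof (cases "g = 0")
    case False
    then show ?thesis
      using that l0 tdeg_of_int[OF l0]
      by (simp add: tle_iff_tdeg tdeg_mult laurent_mult_eq_0_iff of_int_laurent_eq_0_iff)
  qed (simp add: tle_def)
  have pq: "tle p (tdeg p)" "tle q (tdeg q)"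
    using pq_nonzero by (simp_all add: tle_iff_tdeg)
  have const0: "tle (of_int k) 0" for k
    by (simp add: tle_of_int)
  consider (row) m' n' where "(m', n') \<in> keys f" "n' \<noteq> n"
    | (col) m' n' where "(m', n') \<in> keys f" "m' \<noteq> m"
    | (mono) "keys f = {(m, n)}"
    using less.prems(2) by fastforce
  then show ?case
  proof cases
    case row
    \<comment> \<open>\<open>{X, -}\<close> scales the coefficient at height \<open>j\<close> by
      \<open>j\<close> and shifts by \<open>X\<close>. Hence \<open>g\<close> loses all of row
      \<open>n'\<close> but keeps row \<open>n\<close>, and the shift by \<open>X\<close> costs
      \<open>tdeg p\<close> on both sides of the estimate.\<close>
    define g where "g = bracket X f - of_int n' * (X * f)"
    have g: "g \<in> coord_ring"
      unfolding g_def using less.prems(1) by (intro c)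
    have look: "lookup g ((1, 0) + e) = (snd e - n') * lookup f e" for e
      unfolding g_def bracket_X single_0_of_int[symmetric] mult.assoc[symmetric] mult_single
      by (simp add: lookup_minus lookup_single_mult lookup_euler left_diff_distrib)
    have sub: "keys g \<subseteq> (+) (1, 0) ` (keys f - {(m', n')})"
    proof
      fix e assume "e \<in> keys g"
      moreover have e: "e = (1, 0) + (e - (1, 0))" by simp
      ultimately have "(snd (e - (1, 0)) - n') * lookup f (e - (1, 0)) \<noteq> 0"
        using look by (metis in_keys_iff)
      then have "e - (1, 0) \<in> keys f - {(m', n')}"
        by (cases e) (auto simp: in_keys_iff)
      with e show "e \<in> (+) (1, 0) ` (keys f - {(m', n')})" by blast
    qed
    have "card (keys g) \<le> card (keys f - {(m', n')})"
      by (rule order_trans[OF card_mono[OF _ sub] card_image_le]) auto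
    also have "\<dots> < card (keys f)"
      using row by (intro psubset_card_mono) auto
    finally have "card (keys g) < card (keys f)" .
    moreover have "(m + 1, n) \<in> keys g"
      using look[of "(m, n)"] row less.prems(2) by (simp add: in_keys_iff add.commute)
    moreover have "tle (\<Phi> g) (tdeg p + d)"
    proof -
      have "tle (of_int 3 * bracket p (\<Phi> f)) (0 + (tdeg p + d))"
        by (intro tle_mult tle_bracket const0 pq less.prems)
      then have "tle (\<Phi> (bracket X f)) (tdeg p + d)"
        by - (rule lcancel, simp add: bracket_images(1)[OF l less.prems(1)])
      moreover have "tle (of_int n' * (p * \<Phi> f)) (0 + (tdeg p + d))"
        by (intro tle_mult const0 pq less.prems)
      ultimately show ?thesis
        using less.prems(1) by (simp add: g_def diff mult const c tle_diff)
    qed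
    ultimately have "tdeg p * (m + 1) + tdeg q * n \<le> tdeg p + d"
      using less.hyps[OF _ g] by blast
    then show ?thesis by (simp add: algebra_simps)
  next
    case col
    define g where "g = bracket f Y - of_int m' * (Y * f)"
    have g: "g \<in> coord_ring"
      unfolding g_def using less.prems(1) by (intro c)
    have look: "lookup g ((0, 1) + e) = (fst e - m') * lookup f e" for e
      unfolding g_def bracket_Y single_0_of_int[symmetric] mult.assoc[symmetric] mult_single
      by (simp add: lookup_minus lookup_single_mult lookup_euler left_diff_distrib)
    have sub: "keys g \<subseteq> (+) (0, 1) ` (keys f - {(m', n')})"
    proof
      fix e assume "e \<in> keys g"
      moreover have e: "e = (0, 1) + (e - (0, 1))" by simp
      ultimately have "(fst (e - (0, 1)) - m') * lookup f (e - (0, 1)) \<noteq> 0"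
        using look by (metis in_keys_iff)
      then have "e - (0, 1) \<in> keys f - {(m', n')}"
        by (cases e) (auto simp: in_keys_iff)
      with e show "e \<in> (+) (0, 1) ` (keys f - {(m', n')})" by blast
    qed
    have "card (keys g) \<le> card (keys f - {(m', n')})"
      by (rule order_trans[OF card_mono[OF _ sub] card_image_le]) auto
    also have "\<dots> < card (keys f)"
      using col by (intro psubset_card_mono) auto
    finally have "card (keys g) < card (keys f)" .
    moreover have "(m, n + 1) \<in> keys g"
      using look[of "(m, n)"] col less.prems(2) by (simp add: in_keys_iff add.commute)
    moreover have "tle (\<Phi> g) (tdeg q + d)"
    proof -
      have "tle (of_int 3 * bracket (\<Phi> f) q) (0 + (d + tdeg q))"
        by (intro tle_mult tle_bracket const0 pq less.prems)
      then have "tle (\<Phi> (bracket f Y)) (d + tdeg q)"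
        by - (rule lcancel, simp add: bracket_images(2)[OF l less.prems(1)])
      then have "tle (\<Phi> (bracket f Y)) (tdeg q + d)"
        by (simp only: add.commute)
      moreover have "tle (of_int m' * (q * \<Phi> f)) (0 + (tdeg q + d))"
        by (intro tle_mult const0 pq less.prems)
      ultimately show ?thesis
        using less.prems(1) by (simp add: g_def diff mult const c tle_diff)
    qed
    ultimately have "tdeg p * m + tdeg q * (n + 1) \<le> tdeg q + d"
      using less.hyps[OF _ g] by blast
    then show ?thesis by (simp add: algebra_simps)
  next
    case mono
    define k where "k = lookup f (m, n)"
    have f: "f = single (m, n) k"
      by (subst laurent_eq_sum) (simp add: mono k_def)
    have k0: "k \<noteq> 0"
      using less.prems(2) by (simp add: k_def in_keys_iff)
    \<comment> \<open>The exponents \<open>m\<close>, \<open>n\<close> may be negative, and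
      \<open>\<Phi>\<close> is multiplicative only on \<open>coord_ring\<close>, so the monomial is
      cleared of denominators first.\<close>
    define N where "N = max \<bar>m\<bar> \<bar>n\<bar>"
    have Xp: "X ^ i = single (int i, 0) 1" for i
      by (induction i) (auto simp: mult_single single_one[symmetric] zero_prod_def simp del: single_one)
    have Yp: "Y ^ i = single (0, int i) 1" for i
      by (induction i) (auto simp: mult_single single_one[symmetric] zero_prod_def simp del: single_one)
    have N: "N \<ge> 0" "N + m \<ge> 0" "N + n \<ge> 0"
      by (auto simp: N_def)
    have "X ^ nat N * Y ^ nat N * f = of_int k * (X ^ nat (N + m) * Y ^ nat (N + n))"
      using N by (simp add: f Xp Yp mult_single single_0_of_int[symmetric])
    then have "\<Phi> (X ^ nat N * Y ^ nat N * f) = \<Phi> (of_int k * (X ^ nat (N + m) * Y ^ nat (N + n)))"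
      by simp
    then have eq: "p ^ nat N * q ^ nat N * \<Phi> f = of_int k * (p ^ nat (N + m) * q ^ nat (N + n))"
      using less.prems(1) by (simp add: mult power const c)
    have "\<Phi> f \<noteq> 0"
      using nonzero[OF less.prems(1)] less.prems(2) by force
    then have "tdeg (p ^ nat N * q ^ nat N * \<Phi> f) = N * tdeg p + N * tdeg q + tdeg (\<Phi> f)"
      using pq_nonzero N by (simp add: tdeg_mult tdeg_power laurent_mult_eq_0_iff laurent_power_eq_0_iff)
    moreover have "tdeg (of_int k * (p ^ nat (N + m) * q ^ nat (N + n))) = (N + m) * tdeg p + (N + n) * tdeg q"
      using pq_nonzero N k0
      by (simp add: tdeg_mult tdeg_power laurent_mult_eq_0_iff laurent_power_eq_0_iff tdeg_of_int of_int_laurent_eq_0_iff)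
    ultimately have "tdeg p * m + tdeg q * n = tdeg (\<Phi> f)"
      using eq by (simp add: algebra_simps)
    with less.prems(3) \<open>\<Phi> f \<noteq> 0\<close> show ?thesis
      by (simp add: tle_iff_tdeg)
  qed
qed

end

lemma lookup_of_int_mult: "lookup (of_int k * f) e = k * lookup (f :: laurent) e"
  by (metis add_0 lookup_single_mult single_0_of_int zero_prod_def)

lemma lookup_numeral_mult: "lookup (numeral k * f) e = numeral k * lookup (f :: laurent) e"
  using lookup_of_int_mult[of "numeral k"] by simp

section \<open>Automorphisms of reduced degree and the degree recursion\<close>

context coord_aut
begin

lemma reduced_tdeg:
  assumes "tdeg p \<le> tdeg q" "2 * tdeg q \<le> 3 * tdeg p"
  shows "tdeg p = 1 \<and> tdeg q = 1"
proof -
  obtain g where g: "g \<in> coord_ring" "\<Phi> g = X"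
    using surj coord_ring_closed(2) by blast
  have "\<nexists>k. g = of_int k"
    using g generators_nonconst(1) const by metis
  then obtain m n where mn: "(m, n) \<in> keys g" "\<not> tdeg p * m + tdeg q * n < tdeg p"
    using coord_ring_const[OF g(1) _ assms] tdeg_pq_pos by (meson int_one_le_iff_zero_less)
  have "tle (\<Phi> g) 1"
    unfolding g(2) by (simp add: tle_def)
  from keys_weight_le[OF g(1) mn(1) this] mn(2) have "tdeg p \<le> 1"
    by linarith
  with assms tdeg_pq_pos show ?thesis by linarith
qed

text \<open>Elements of degree at most 1 are combinations of 1, \<open>X\<close>, \<open>Y\<close>,
  \<open>Z\<close>. Comparing coefficients in \<open>3 {p, q} = l p q\<close> with
  \<open>l \<noteq> 0\<close> leaves only multiples of the two variables.\<close>

lemma tle_1_images: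
  assumes "tle p 1" "tle q 1"
  shows "(\<exists>c d. p = of_int c * X \<and> q = of_int d * Y) \<or> (\<exists>c d. p = of_int c * Y \<and> q = of_int d * X)"
proof -
  obtain e1 c1 d1 w1 where p: "p = of_int e1 + of_int c1 * X + of_int d1 * Y + of_int w1 * Z"
    using coord_ring_tle_1[OF pqr_closed(1) assms(1)] .
  obtain e2 c2 d2 w2 where q: "q = of_int e2 + of_int c2 * X + of_int d2 * Y + of_int w2 * Z"
    using coord_ring_tle_1[OF pqr_closed(2) assms(2)] .
  obtain l where l: "3 * bracket p q = of_int l * (p * q)"
    using bracket_pq_const by blast
  have "l \<noteq> 0"
    by (rule bracket_pq_nonzero[OF l])
  have br: "bracket p q = of_int (c1 * d2 - c2 * d1) * (X * Y)
      + of_int (c1 * w2 - c2 * w1) * (3 * Y ^ 2 - X * Z)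
      + of_int (w1 * d2 - w2 * d1) * (3 * X ^ 2 - Y * Z)"
    unfolding p q bracket_generators[symmetric]
    by (simp add: bracket_simps bracket_swap[of Y X] bracket_swap[of Z X] bracket_swap[of Y Z] algebra_simps)
  have lookup_pq: "lookup (3 * bracket p q) e = l * lookup (p * q) e" for e
    by (simp only: l lookup_of_int_mult)
  note expand = distrib_left distrib_right left_diff_distrib right_diff_distrib mult_single
    lookup_add lookup_minus lookup_single when_def lookup_numeral_mult power2_eq_square
  \<comment> \<open>The exponents isolate products of generators: \<open>(4, -2)\<close> occurs only
    in \<open>Z^2\<close>, \<open>(3, -1)\<close> only in \<open>X Z\<close>, \<open>(-1, 3)\<close>
    only in \<open>Y Z\<close>. At \<open>(2, 0)\<close> and \<open>(0, 2)\<close> the squares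
    \<open>X^2\<close>, \<open>Y^2\<close> meet \<open>Y Z\<close>, \<open>X Z\<close>;
    \<open>(1, 0)\<close> and \<open>(0, 1)\<close> see the constant terms.\<close>
  have pq: "lookup (p * q) (4, -2) = w1 * w2"
    "lookup (p * q) (3, -1) = c1 * w2 + w1 * c2"
    "lookup (p * q) (-1, 3) = d1 * w2 + w1 * d2"
    "lookup (p * q) (2, 0) = c1 * c2 + d1 * w2 + w1 * d2"
    "lookup (p * q) (0, 2) = d1 * d2 + c1 * w2 + w1 * c2"
    "lookup (p * q) (1, 0) = e1 * c2 + c1 * e2"
    "lookup (p * q) (0, 1) = e1 * d2 + d1 * e2"
    unfolding p q Z_def single_0_of_int[symmetric] by (simp_all add: expand)
  have br': "lookup (bracket p q) (4, -2) = 0"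
    "lookup (bracket p q) (3, -1) = - (c1 * w2 - c2 * w1)"
    "lookup (bracket p q) (-1, 3) = - (w1 * d2 - w2 * d1)"
    "lookup (bracket p q) (2, 0) = 2 * (w1 * d2 - w2 * d1)"
    "lookup (bracket p q) (0, 2) = 2 * (c1 * w2 - c2 * w1)"
    "lookup (bracket p q) (1, 0) = 0"
    "lookup (bracket p q) (0, 1) = 0"
    unfolding br lookup_add lookup_of_int_mult Z_def by (simp_all add: expand)
  note eqs = lookup_pq[unfolded lookup_numeral_mult]
  have w: "w1 * w2 = 0"
    using eqs[of "(4, -2)"] \<open>l \<noteq> 0\<close> by (simp add: pq br')
  have XZ: "- 3 * (c1 * w2 - c2 * w1) = l * (c1 * w2 + w1 * c2)"
    using eqs[of "(3, -1)"] by (simp add: pq br')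
  have YZ: "- 3 * (w1 * d2 - w2 * d1) = l * (d1 * w2 + w1 * d2)"
    using eqs[of "(-1, 3)"] by (simp add: pq br')
  have XX: "9 * (w1 * d2 - w2 * d1) = l * (c1 * c2)"
    using eqs[of "(2, 0)"] YZ by (simp add: pq br' algebra_simps)
  have YY: "9 * (c1 * w2 - c2 * w1) = l * (d1 * d2)"
    using eqs[of "(0, 2)"] XZ by (simp add: pq br' algebra_simps)
  have X1: "e1 * c2 + c1 * e2 = 0"
    using eqs[of "(1, 0)"] \<open>l \<noteq> 0\<close> by (simp add: pq br')
  have Y1: "e1 * d2 + d1 * e2 = 0"
    using eqs[of "(0, 1)"] \<open>l \<noteq> 0\<close> by (simp add: pq br')
  have nonconst: "c1 \<noteq> 0 \<or> d1 \<noteq> 0 \<or> w1 \<noteq> 0" "c2 \<noteq> 0 \<or> d2 \<noteq> 0 \<or> w2 \<noteq> 0"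
    using const_iff[OF coord_ring_closed(2), of e1] const_iff[OF coord_ring_closed(3), of e2]
      generators_nonconst p q by auto
  have "w1 = 0"
  proof (rule ccontr)
    assume "w1 \<noteq> 0"
    with w have w2: "w2 = 0" by simp
    \<comment> \<open>The values 3 and -3 exclude each other, so one of \<open>c2\<close>,
      \<open>d2\<close> vanishes; \<open>XX\<close> and \<open>YY\<close> then kill the other, and
      \<open>q\<close> would be constant.\<close>
    have c: "c2 = 0 \<or> l = 3" and d: "d2 = 0 \<or> l = -3"
    proof -
      have "w1 * (c2 * (l - 3)) = 0" "w1 * (d2 * (l + 3)) = 0"
        using XZ YZ w2 by (simp_all add: algebra_simps)
      with \<open>w1 \<noteq> 0\<close> show "c2 = 0 \<or> l = 3" "d2 = 0 \<or> l = -3" by auto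
    qed
    with XX YY w2 \<open>w1 \<noteq> 0\<close> have "c2 = 0" "d2 = 0"
      by auto
    with nonconst w2 show False by simp
  qed
  moreover have "w2 = 0"
  proof (rule ccontr)
    assume "w2 \<noteq> 0"
    have c: "c1 = 0 \<or> l = -3" and d: "d1 = 0 \<or> l = 3"
    proof -
      have "w2 * (c1 * (l + 3)) = 0" "w2 * (d1 * (l - 3)) = 0"
        using XZ YZ \<open>w1 = 0\<close> by (simp_all add: algebra_simps)
      with \<open>w2 \<noteq> 0\<close> show "c1 = 0 \<or> l = -3" "d1 = 0 \<or> l = 3" by auto
    qed
    with XX YY \<open>w1 = 0\<close> \<open>w2 \<noteq> 0\<close> have "c1 = 0" "d1 = 0"
      by auto
    with nonconst \<open>w1 = 0\<close> show False by simp
  qed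
  ultimately have cd: "c1 * c2 = 0" "d1 * d2 = 0"
    using XX YY \<open>l \<noteq> 0\<close> by auto
  show ?thesis
  proof (cases "c1 = 0")
    case True
    with nonconst cd \<open>w1 = 0\<close> \<open>w2 = 0\<close> have "d1 \<noteq> 0" "d2 = 0" "c2 \<noteq> 0" by auto
    with X1 Y1 True have "e1 = 0" "e2 = 0" by auto
    with p q True \<open>d2 = 0\<close> \<open>w1 = 0\<close> \<open>w2 = 0\<close> show ?thesis by auto
  next
    case False
    with nonconst cd \<open>w1 = 0\<close> \<open>w2 = 0\<close> have "c2 = 0" "d2 \<noteq> 0" "d1 = 0" by auto
    with X1 Y1 False have "e1 = 0" "e2 = 0" by auto
    with p q False \<open>d1 = 0\<close> \<open>c2 = 0\<close> \<open>w1 = 0\<close> \<open>w2 = 0\<close> show ?thesis by auto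
  qed
qed

text \<open>By degrees \<open>r\<close> is also a combination of 1, \<open>X\<close>,
  \<open>Y\<close>, \<open>Z\<close>. At \<open>(0, 0)\<close>, \<open>(3, 0)\<close>,
  \<open>(0, 3)\<close> only its \<open>Z\<close>-part contributes to \<open>p q r\<close>, so
  \<open>c d w3\<close> equals 1, \<open>c^3\<close> and \<open>d^3\<close>; the only integral cube
  root of 1 is 1.\<close>

lemma scaling_trivial:
  assumes "p = of_int c * U \<and> q = of_int d * V" and UV: "{U, V} = {X, Y}" "U \<noteq> V"
  shows "c = 1 \<and> d = 1"
proof -
  have UV': "U = X \<and> V = Y \<or> U = Y \<and> V = X"
    using UV by (auto simp: doubleton_eq_iff)
  have UVdeg: "tle U 1" "tle V 1" "tdeg U = 1" "tdeg V = 1"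
    using UV' by (auto simp: tle_def tdeg_def)
  have cd: "c \<noteq> 0" "d \<noteq> 0"
    using pq_nonzero assms by auto
  have "tle (p ^ 3 + q ^ 3 + of_int 1) 3"
  proof -
    have "tle p 1" "tle q 1"
      using assms tle_mult[OF tle_of_int[of 0 c] UVdeg(1)] tle_mult[OF tle_of_int[of 0 d] UVdeg(2)] by auto
    moreover have "tle (f ^ 3) (1 + (1 + 1))" if "tle f 1" for f
      unfolding power3_eq_cube mult.assoc by (intro tle_mult that)
    ultimately show ?thesis
      by (intro tle_add tle_of_int) simp_all
  qed
  then have "tle (p * q * r) 3"
    by (simp add: pqr_eqn)
  moreover have r0: "r \<noteq> 0"
  proof -
    have "lookup Z (2, -1) = 1"
      by (simp add: Z_def lookup_add lookup_single when_def)
    then have "Z \<noteq> 0" by auto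
    then show ?thesis
      by (rule nonzero[OF coord_ring_closed(4)])
  qed
  moreover have "tdeg p = 1" "tdeg q = 1"
    using assms pq_nonzero UVdeg tdeg_of_int[OF cd(1)] tdeg_of_int[OF cd(2)]
    by (auto simp: tdeg_mult laurent_mult_eq_0_iff)
  ultimately have "tle r 1"
    using pq_nonzero by (simp add: tle_iff_tdeg tdeg_mult laurent_mult_eq_0_iff)
  then obtain e3 c3 d3 w3 where r: "r = of_int e3 + of_int c3 * X + of_int d3 * Y + of_int w3 * Z"
    using coord_ring_tle_1[OF pqr_closed(3)] by blast
  have "U * V = X * Y"
    using UV' by (auto simp: mult.commute)
  moreover have "p * q * r = of_int (c * d) * (U * V * (of_int e3 + of_int c3 * X + of_int d3 * Y + of_int w3 * Z))"
    unfolding r using assms(1) by (simp add: mult_ac)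
  moreover have "p ^ 3 + q ^ 3 + 1 = of_int (c ^ 3) * U ^ 3 + of_int (d ^ 3) * V ^ 3 + 1"
    using assms(1) by (simp add: power_mult_distrib)
  ultimately have "of_int (c * d) * (X * Y * (of_int e3 + of_int c3 * X + of_int d3 * Y + of_int w3 * Z))
      = of_int (c ^ 3) * U ^ 3 + of_int (d ^ 3) * V ^ 3 + 1"
    using pqr_eqn by metis
  then have eqs: "c * d * lookup (X * Y * (of_int e3 + of_int c3 * X + of_int d3 * Y + of_int w3 * Z)) e
      = c ^ 3 * lookup (U ^ 3) e + d ^ 3 * lookup (V ^ 3) e + lookup 1 e" for e
    by (metis lookup_add lookup_of_int_mult)
  have XYr: "lookup (X * Y * (of_int e3 + of_int c3 * X + of_int d3 * Y + of_int w3 * Z)) e = w3"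
    if "e = (0, 0) \<or> e = (3, 0) \<or> e = (0, 3)" for e
    using that unfolding Z_def single_0_of_int[symmetric]
    by (auto simp: distrib_left mult_single lookup_add lookup_single when_def)
  have cubes: "lookup (X ^ 3) e = (1 when e = (3, 0))" "lookup (Y ^ 3) e = (1 when e = (0, 3))" for e
    by (auto simp: power3_eq_cube mult_single lookup_single when_def)
  have "c * d * w3 = 1"
    using eqs[of "(0, 0)"] UV' by (auto simp: XYr cubes lookup_one zero_prod_def)
  moreover have "c * d * w3 = c ^ 3 \<and> c * d * w3 = d ^ 3"
    using eqs[of "(3, 0)"] eqs[of "(0, 3)"] UV' by (auto simp: XYr cubes lookup_one zero_prod_def)
  ultimately have "c ^ 3 = 1" "d ^ 3 = 1" by simp_all
  then show ?thesis
    by (auto simp: power3_eq_cube zmult_eq_1_iff)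
qed

lemma tdeg_1_images:
  assumes "tdeg p = 1" "tdeg q = 1"
  shows "(p = X \<and> q = Y) \<or> (p = Y \<and> q = X)"
proof -
  have XY: "X \<noteq> Y"
    by (auto simp: poly_mapping_eq_iff fun_eq_iff lookup_single when_def)
  have "tle p 1" "tle q 1"
    using assms pq_nonzero by (simp_all add: tle_iff_tdeg)
  from tle_1_images[OF this] show ?thesis
    using scaling_trivial[of _ X _ Y] scaling_trivial[of _ Y _ X] XY by fastforce
qed

text \<open>Degrees in \<open>q * (p * r - q ^ 2) = p ^ 3 + 1\<close>; the summand 1 does not affect
  the degree because \<open>tdeg p \<ge> 1\<close>.\<close>

lemma tdeg_involution:
  "tdeg (p * r - q ^ 2) = 3 * tdeg p - tdeg q"
proof -
  have eq: "q * (p * r - q ^ 2) = p ^ 3 + 1"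
    using pqr_eqn by (simp add: algebra_simps power2_eq_square power3_eq_cube)
  have p3: "p ^ 3 + 1 \<noteq> 0 \<and> tdeg (p ^ 3 + 1) = 3 * tdeg p"
  proof -
    have p3: "p ^ 3 \<noteq> 0" "tdeg (p ^ 3) = 3 * tdeg p"
      using pq_nonzero by (simp_all add: laurent_power_eq_0_iff tdeg_power)
    have le: "tle (p ^ 3 + 1) d \<Longrightarrow> tle (p ^ 3) d" "tle (p ^ 3) d \<Longrightarrow> tle (p ^ 3 + 1) d" if "d \<ge> 0" for d
      using tle_diff[of "p ^ 3 + 1" d 1] tle_add[of "p ^ 3" d 1] tle_of_int[OF that, of 1] by auto
    have nz: "p ^ 3 + 1 \<noteq> 0"
      using le(1)[of 0] p3 tdeg_pq_pos by (auto simp: tle_iff_tdeg tle_def[of 0])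
    have "tdeg (p ^ 3 + 1) \<le> 3 * tdeg p"
      using le(2)[of "3 * tdeg p"] p3 nz tdeg_pq_pos by (simp add: tle_iff_tdeg)
    \<comment> \<open>The constant 1 satisfies only nonnegative bounds, hence the maximum;
      \<open>3 * tdeg p > 0\<close> rules out its first argument.\<close>
    moreover have "3 * tdeg p \<le> max 0 (tdeg (p ^ 3 + 1))"
      using le(1)[of "max 0 (tdeg (p ^ 3 + 1))"] p3 nz by (simp add: tle_iff_tdeg)
    ultimately show ?thesis
      using nz tdeg_pq_pos by linarith
  qed
  then have "p * r - q ^ 2 \<noteq> 0"
    using eq by force
  with p3 pq_nonzero(2) tdeg_mult[of q "p * r - q ^ 2"] show ?thesis
    unfolding eq by linarith
qed

end

section \<open>The residue class ring as a subring of the Laurent polynomials\<close>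

abbreviation laurent_eval :: "poly3 \<Rightarrow> laurent" where
  "laurent_eval \<equiv> eval3 (X, Y, Z)"

lemma eval3_S0_eqn: "eval3 (a, b, c) S0_eqn = a * b * c - (a ^ 3 + b ^ 3 + 1)"
  by (simp add: S0_eqn_def eval3_hom eval3_var)

lemma laurent_eval_S0_eqn: "laurent_eval S0_eqn = 0"
  by (simp add: eval3_S0_eqn XYZ_eqn)

section \<open>The kernel of the evaluation at \<open>(X, Y, Z)\<close>\<close>

lemma prime_elem_var: "prime_elem var_x" "prime_elem var_y"
proof -
  have "prime_elem [:0, 1 :: int:]"
    by (rule prime_elem_linear_poly) simp_all
  then show "prime_elem var_x"
    by (simp add: var_x_def prime_elem_const_poly_iff)
  have "prime_elem [:0, 1 :: int poly:]"
    by (rule prime_elem_linear_poly) simp_all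
  then show "prime_elem var_y"
    by (simp add: var_y_def prime_elem_const_poly_iff)
qed

text \<open>\<open>x\<close> and \<open>y\<close> are not zero divisors modulo the equation: they
  are prime and vanish at the origin, where \<open>S0_eqn\<close> takes the value -1.\<close>

lemma S0_eqn_dvd_cancel:
  assumes "v = var_x \<or> v = var_y" "S0_eqn dvd v * g"
  shows "S0_eqn dvd g"
proof -
  obtain h where h: "v * g = S0_eqn * h"
    using assms(2) by blast
  have v: "prime_elem v" "v \<noteq> 0" "eval3 (0, 0, 0 :: int) v = 0"
    using assms(1) prime_elem_var by (auto simp: eval3_var)
  have "\<not> v dvd S0_eqn"
  proof
    assume "v dvd S0_eqn"
    then obtain k where "S0_eqn = v * k" by blast
    then have "eval3 (0, 0, 0 :: int) S0_eqn = 0"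
      using v(3) by (metis eval3_hom(4) mult_zero_left)
    then show False
      by (simp add: eval3_S0_eqn)
  qed
  moreover have "v dvd S0_eqn * h"
    by (simp flip: h)
  ultimately have "v dvd h"
    using v(1) by (simp add: prime_elem_dvd_mult_iff)
  then obtain h' where "h = v * h'" by blast
  with h have "v * g = v * (S0_eqn * h')"
    by (simp add: mult_ac)
  with v(2) have "g = S0_eqn * h'"
    by simp
  then show ?thesis by simp
qed

text \<open>The equation is linear in \<open>z\<close> with leading coefficient \<open>x y\<close>,
  so powers of \<open>x y\<close> eliminate \<open>z\<close>. The remainder \<open>[:r:]\<close> is
  constant in the outermost variable, i.e. a polynomial in \<open>x\<close>,
  \<open>y\<close>.\<close>

lemma S0_pseudo_division:
  obtains N h r where "(var_x * var_y) ^ N * g = S0_eqn * h + [:r:]"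
proof -
  have "\<exists>N h r. (var_x * var_y) ^ N * g = S0_eqn * h + [:r:]"
  proof (induction g rule: poly3_induct)
    case (const k)
    show ?case by (rule exI[of _ 0], rule exI[of _ 0]) auto
  next
    case x
    show ?case by (rule exI[of _ 0], rule exI[of _ 0]) (auto simp: var_x_def)
  next
    case y
    show ?case by (rule exI[of _ 0], rule exI[of _ 0]) (auto simp: var_y_def)
  next
    case z
    have "var_x ^ 3 + var_y ^ 3 + 1 = [:[:[:0, 1:]:] ^ 3 + [:0, 1:] ^ 3 + 1:]"
      by (simp add: var_x_def var_y_def power3_eq_cube one_pCons)
    moreover have "(var_x * var_y) ^ 1 * var_z = S0_eqn * 1 + (var_x ^ 3 + var_y ^ 3 + 1)"
      by (simp add: S0_eqn_def)
    ultimately show ?case by metis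
  next
    case (add g1 g2)
    then obtain N1 h1 r1 N2 h2 r2 where
      1: "(var_x * var_y) ^ N1 * g1 = S0_eqn * h1 + [:r1:]" and
      2: "(var_x * var_y) ^ N2 * g2 = S0_eqn * h2 + [:r2:]" by blast
    let ?w = "[:[:0, 1:]:] * [:0, 1:] :: int poly poly"
    have w: "(var_x * var_y) ^ n = [:?w ^ n:]" for n
      by (induction n) (simp_all add: var_x_def var_y_def one_pCons)
    have "(var_x * var_y) ^ (N1 + N2) * (g1 + g2)
        = (var_x * var_y) ^ N2 * ((var_x * var_y) ^ N1 * g1) + (var_x * var_y) ^ N1 * ((var_x * var_y) ^ N2 * g2)"
      by (simp add: power_add algebra_simps)
    also have "\<dots> = S0_eqn * ((var_x * var_y) ^ N2 * h1 + (var_x * var_y) ^ N1 * h2)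
        + [:?w ^ N2 * r1 + ?w ^ N1 * r2:]"
      unfolding 1 2 unfolding w by (simp add: algebra_simps smult_add_right)
    finally show ?case by blast
  next
    case (mult g1 g2)
    then obtain N1 h1 r1 N2 h2 r2 where
      1: "(var_x * var_y) ^ N1 * g1 = S0_eqn * h1 + [:r1:]" and
      2: "(var_x * var_y) ^ N2 * g2 = S0_eqn * h2 + [:r2:]" by blast
    have "(var_x * var_y) ^ (N1 + N2) * (g1 * g2) = ((var_x * var_y) ^ N1 * g1) * ((var_x * var_y) ^ N2 * g2)"
      by (simp add: power_add mult_ac)
    also have "\<dots> = S0_eqn * (h1 * (S0_eqn * h2 + [:r2:]) + [:r1:] * h2) + [:r1 * r2:]"
      unfolding 1 2 by (simp add: algebra_simps)
    finally show ?case by blast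
  qed
  then show ?thesis using that by blast
qed

text \<open>Polynomials in \<open>x\<close>, \<open>y\<close> embed coefficientwise. The sign
  conditions are needed since \<open>nat\<close> sends all negative exponents to 0.\<close>

lemma lookup_laurent_eval_xy:
  "lookup (laurent_eval [:r:]) (m, n) = (if 0 \<le> m \<and> 0 \<le> n then coeff (coeff r (nat n)) (nat m) else 0)"
proof -
  have shift_X: "lookup (X * f) (i, j) = lookup f (i - 1, j)" and
    shift_Y: "lookup (Y * f) (i, j) = lookup f (i, j - 1)" for f i j
    using lookup_single_mult[of "(1, 0)" 1 f "(i - 1, j)"] lookup_single_mult[of "(0, 1)" 1 f "(i, j - 1)"]
    by simp_all
  have 1: "lookup (laurent_eval [:[:k:]:]) (m, n) = (if 0 \<le> m \<and> n = 0 then coeff k (nat m) else 0)" for k m n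
  proof (induction k arbitrary: m)
    case 0
    show ?case by (simp add: eval3_hom)
  next
    case (pCons a k)
    have "[:[:pCons a k:]:] = [:[:[:a:]:]:] + var_x * [:[:k:]:]"
      by (simp add: var_x_def)
    then have "laurent_eval [:[:pCons a k:]:] = of_int a + X * laurent_eval [:[:k:]:]"
      by (simp only: eval3_hom eval3_const eval3_var)
    then have "lookup (laurent_eval [:[:pCons a k:]:]) (m, n)
        = (a when m = 0 \<and> n = 0) + (if 0 \<le> m - 1 \<and> n = 0 then coeff k (nat (m - 1)) else 0)"
      by (simp add: lookup_add shift_X lookup_of_int pCons.IH zero_prod_def)
    also have "\<dots> = (if 0 \<le> m \<and> n = 0 then coeff (pCons a k) (nat m) else 0)"
      by (auto simp: when_def coeff_pCons nat_diff_distrib split: nat.split)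
    finally show ?case .
  qed
  show ?thesis
  proof (induction r arbitrary: n)
    case 0
    show ?case by (simp add: eval3_hom)
  next
    case (pCons a k)
    have "[:pCons a k:] = [:[:a:]:] + var_y * [:k:]"
      by (simp add: var_y_def)
    then have "laurent_eval [:pCons a k:] = laurent_eval [:[:a:]:] + Y * laurent_eval [:k:]"
      by (simp only: eval3_hom eval3_var)
    then have "lookup (laurent_eval [:pCons a k:]) (m, n)
        = (if 0 \<le> m \<and> n = 0 then coeff a (nat m) else 0)
        + (if 0 \<le> m \<and> 0 \<le> n - 1 then coeff (coeff k (nat (n - 1))) (nat m) else 0)"
      by (simp add: lookup_add shift_Y 1 pCons.IH)
    also have "\<dots> = (if 0 \<le> m \<and> 0 \<le> n then coeff (coeff (pCons a k) (nat n)) (nat m) else 0)"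
      by (auto simp: coeff_pCons nat_diff_distrib split: nat.split)
    finally show ?case .
  qed
qed

text \<open>The remainder of the pseudo-division also evaluates to 0, hence is 0, and the power of
  \<open>x y\<close> can be cancelled. Thus the kernel is exactly the ideal of the surface.\<close>

lemma laurent_eval_eq_0_iff: "laurent_eval g = 0 \<longleftrightarrow> S0_eqn dvd g"
proof
  assume "S0_eqn dvd g"
  then show "laurent_eval g = 0"
    by (auto simp: eval3_hom laurent_eval_S0_eqn)
next
  assume g: "laurent_eval g = 0"
  obtain N h r where N: "(var_x * var_y) ^ N * g = S0_eqn * h + [:r:]"
    by (rule S0_pseudo_division)
  have "laurent_eval ((var_x * var_y) ^ N * g) = laurent_eval (S0_eqn * h + [:r:])"
    by (simp only: N)
  then have r0: "laurent_eval [:r:] = 0"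
    by (simp add: eval3_hom g laurent_eval_S0_eqn)
  have "coeff (coeff r n) m = 0" for m n
    using lookup_laurent_eval_xy[of r "int m" "int n"] by (simp add: r0)
  then have "r = 0"
    by (simp add: poly_eq_iff)
  with N have "S0_eqn dvd (var_x * var_y) ^ N * g" by simp
  then show "S0_eqn dvd g"
    by (induction N) (auto simp: mult.assoc dest: S0_eqn_dvd_cancel[OF disjI1[OF refl]] S0_eqn_dvd_cancel[OF disjI2[OF refl]])
qed

section \<open>Residue classes as fibres of the evaluation\<close>

lemma S0_ideal_iff: "g \<in> S0_ideal \<longleftrightarrow> laurent_eval g = 0"
  by (auto simp: S0_ideal_def cgenideal_def poly3_ring_def times_class carrier_class
      laurent_eval_eq_0_iff mult.commute elim!: dvdE)

lemma S0_class_iff: "h \<in> S0_class g \<longleftrightarrow> laurent_eval h = laurent_eval g"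
proof -
  have "h \<in> S0_class g \<longleftrightarrow> (\<exists>k\<in>S0_ideal. h = k + g)"
    by (auto simp: S0_class_def a_r_coset_def' poly3_ring_def plus_class)
  also have "\<dots> \<longleftrightarrow> h - g \<in> S0_ideal"
    by (metis add_diff_cancel diff_add_cancel)
  finally show ?thesis
    by (simp add: S0_ideal_iff eval3_hom)
qed

lemma S0_class_eq: "S0_class g = {h. laurent_eval h = laurent_eval g}"
  by (auto simp: S0_class_iff)

lemma S0_class_eq_iff: "S0_class g = S0_class h \<longleftrightarrow> laurent_eval g = laurent_eval h"
  unfolding S0_class_eq by auto

lemma ideal_S0_ideal: "ideal S0_ideal poly3_ring"
  unfolding S0_ideal_def poly3_ring_def
  by (rule cring.cgenideal_ideal[OF cring_class]) (simp add: carrier_class)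

lemma ring_S0_ring: "ring S0_ring"
  unfolding S0_ring_def by (rule ideal.quotient_is_ring[OF ideal_S0_ideal])

lemma S0_class_hom: "S0_class \<in> ring_hom poly3_ring S0_ring"
proof -
  have "S0_class = (+>\<^bsub>poly3_ring\<^esub>) S0_ideal"
    by (rule ext) (simp add: S0_class_def)
  then show ?thesis
    unfolding S0_ring_def using ideal.rcos_ring_hom[OF ideal_S0_ideal] by simp
qed

lemma carrier_S0_ring: "carrier S0_ring = range S0_class"
  by (auto simp: S0_ring_def FactRing_def A_RCOSETS_def' S0_class_def poly3_ring_def carrier_class)

lemma S0_class_closed [simp]: "S0_class g \<in> carrier S0_ring"
  by (simp add: carrier_S0_ring)

lemma S0_class_simps:
  "S0_class (g + h) = S0_class g \<oplus>\<^bsub>S0_ring\<^esub> S0_class h"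
  "S0_class (g * h) = S0_class g \<otimes>\<^bsub>S0_ring\<^esub> S0_class h"
  "S0_class 1 = \<one>\<^bsub>S0_ring\<^esub>"
  using ring_hom_add[OF S0_class_hom, of g h] ring_hom_mult[OF S0_class_hom, of g h] ring_hom_one[OF S0_class_hom]
  by (simp_all add: poly3_ring_def carrier_class plus_class times_class one_class)

text \<open>The evaluation is constant on a residue class. With its inverse
  \<open>value_class\<close> this identifies \<open>S0_ring\<close> with
  \<open>coord_ring\<close>.\<close>

definition class_value :: "poly3 set \<Rightarrow> laurent" where
  "class_value C = the_elem (laurent_eval ` C)"

definition value_class :: "laurent \<Rightarrow> poly3 set" where
  "value_class f = {g. laurent_eval g = f}"

lemma class_value_S0_class [simp]: "class_value (S0_class g) = laurent_eval g"
proof -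
  have "laurent_eval ` S0_class g = {laurent_eval g}"
    by (auto simp: S0_class_eq)
  then show ?thesis by (simp add: class_value_def)
qed

lemma value_class_laurent_eval [simp]: "value_class (laurent_eval g) = S0_class g"
  by (simp add: value_class_def S0_class_eq)

lemma value_class_class_value: "C \<in> carrier S0_ring \<Longrightarrow> value_class (class_value C) = C"
  by (auto simp: carrier_S0_ring)

lemma class_value_value_class: "f \<in> coord_ring \<Longrightarrow> class_value (value_class f) = f"
  by (auto simp: coord_ring_def)

section \<open>The automorphism group\<close>

lemma Aut_Spec_simps:
  "carrier (Aut_Spec R) = ring_hom R R \<inter> Bij (carrier R)"
  "\<phi> \<otimes>\<^bsub>Aut_Spec R\<^esub> \<psi> = compose (carrier R) \<psi> \<phi>"
  "\<one>\<^bsub>Aut_Spec R\<^esub> = (\<lambda>r\<in>carrier R. r)"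
  by (simp_all add: Aut_Spec_def)

lemma ring_hom_cong:
  assumes "ring R" "f \<in> ring_hom R S" "\<And>x. x \<in> carrier R \<Longrightarrow> f x = g x"
  shows "g \<in> ring_hom R S"
proof -
  interpret ring R by fact
  note f = ring_hom_memE[OF assms(2)]
  show ?thesis
  proof (rule ring_hom_memI)
    fix x y assume "x \<in> carrier R" "y \<in> carrier R"
    then show "g (x \<otimes>\<^bsub>R\<^esub> y) = g x \<otimes>\<^bsub>S\<^esub> g y" "g (x \<oplus>\<^bsub>R\<^esub> y) = g x \<oplus>\<^bsub>S\<^esub> g y"
      using f(2,3)[of x y] assms(3) by (metis m_closed, metis a_closed)
  qed (metis f(1) assms(3), metis f(4) assms(3) one_closed)
qed

lemma group_Aut_Spec:
  assumes "ring R"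
  shows "group (Aut_Spec R)"
proof -
  interpret ring R by fact
  let ?C = "carrier R"
  show ?thesis
  proof (rule groupI)
    fix \<phi> \<psi> assume "\<phi> \<in> carrier (Aut_Spec R)" "\<psi> \<in> carrier (Aut_Spec R)"
    then have *: "\<phi> \<in> ring_hom R R" "\<phi> \<in> Bij ?C" "\<psi> \<in> ring_hom R R" "\<psi> \<in> Bij ?C"
      by (auto simp: Aut_Spec_simps)
    have "compose ?C \<psi> \<phi> \<in> ring_hom R R"
      by (rule ring_hom_cong[OF assms ring_hom_trans[OF *(1,3)]]) (simp add: compose_def)
    with * show "\<phi> \<otimes>\<^bsub>Aut_Spec R\<^esub> \<psi> \<in> carrier (Aut_Spec R)"
      by (simp add: Aut_Spec_simps compose_Bij)
  next
    have "(\<lambda>r\<in>?C. r) \<in> ring_hom R R"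
      by (rule ring_hom_cong[OF assms, of id]) (auto intro: ring_hom_memI)
    then show "\<one>\<^bsub>Aut_Spec R\<^esub> \<in> carrier (Aut_Spec R)"
      by (simp add: Aut_Spec_simps id_Bij)
  next
    fix \<phi> \<psi> \<theta>
    assume "\<phi> \<in> carrier (Aut_Spec R)" "\<psi> \<in> carrier (Aut_Spec R)" "\<theta> \<in> carrier (Aut_Spec R)"
    then show "\<phi> \<otimes>\<^bsub>Aut_Spec R\<^esub> \<psi> \<otimes>\<^bsub>Aut_Spec R\<^esub> \<theta> = \<phi> \<otimes>\<^bsub>Aut_Spec R\<^esub> (\<psi> \<otimes>\<^bsub>Aut_Spec R\<^esub> \<theta>)"
      by (auto simp: Aut_Spec_simps compose_def fun_eq_iff ring_hom_closed)
  next
    fix \<phi> assume "\<phi> \<in> carrier (Aut_Spec R)"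
    then show "\<one>\<^bsub>Aut_Spec R\<^esub> \<otimes>\<^bsub>Aut_Spec R\<^esub> \<phi> = \<phi>"
      by (auto simp: Aut_Spec_simps Bij_def intro!: compose_Id bij_betw_imp_funcset)
  next
    fix \<phi> assume "\<phi> \<in> carrier (Aut_Spec R)"
    then have *: "\<phi> \<in> ring_hom R R" "\<phi> \<in> Bij ?C" "bij_betw \<phi> ?C ?C"
      by (auto simp: Aut_Spec_simps Bij_def)
    let ?\<psi> = "restrict (inv_into ?C \<phi>) ?C"
    have "\<phi> \<in> ring_iso R R"
      using * by (simp add: ring_iso_def)
    then have "inv_into ?C \<phi> \<in> ring_iso R R"
      by (rule ring_iso_set_sym[OF assms])
    then have "inv_into ?C \<phi> \<in> ring_hom R R"
      by (simp add: ring_iso_def)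
    then have "?\<psi> \<in> ring_hom R R"
      by (rule ring_hom_cong[OF assms]) simp
    moreover have "compose ?C \<phi> ?\<psi> = (\<lambda>r\<in>?C. r)"
      using * by (auto simp: compose_def fun_eq_iff bij_betw_inv_into_right)
    ultimately show "\<exists>\<psi>\<in>carrier (Aut_Spec R). \<psi> \<otimes>\<^bsub>Aut_Spec R\<^esub> \<phi> = \<one>\<^bsub>Aut_Spec R\<^esub>"
      using restrict_inv_into_Bij[OF *(2)] by (intro bexI[of _ ?\<psi>]) (auto simp: Aut_Spec_simps)
  qed
qed

lemma group_Aut_S0: "group Aut_S0"
  by (rule group_Aut_Spec[OF ring_S0_ring])

subsection \<open>Automorphisms as triples of regular functions\<close>

definition aut_images :: "(poly3 set \<Rightarrow> poly3 set) \<Rightarrow> laurent \<times> laurent \<times> laurent" where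
  "aut_images \<phi> = (class_value (\<phi> (S0_class var_x)), class_value (\<phi> (S0_class var_y)), class_value (\<phi> (S0_class var_z)))"

lemma coord_aut_of_Aut_S0:
  assumes "\<phi> \<in> carrier Aut_S0"
  shows "coord_aut (class_value \<circ> \<phi> \<circ> value_class)"
proof -
  have hom: "\<phi> \<in> ring_hom S0_ring S0_ring" and bij: "bij_betw \<phi> (carrier S0_ring) (carrier S0_ring)"
    using assms by (auto simp: Aut_Spec_simps Bij_def)
  have phi: "\<exists>h. \<phi> (S0_class g) = S0_class h" for g
    using ring_hom_closed[OF hom S0_class_closed, of g] by (auto simp: carrier_S0_ring)
  show ?thesis
  proof
    fix f assume "f \<in> coord_ring"
    then obtain g where "f = laurent_eval g"
      by (auto simp: coord_ring_def)
    with phi[of g] show "(class_value \<circ> \<phi> \<circ> value_class) f \<in> coord_ring"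
      by auto
  next
    fix f g assume "f \<in> coord_ring" "g \<in> coord_ring"
    then obtain f' g' where fg: "f = laurent_eval f'" "g = laurent_eval g'"
      by (auto simp: coord_ring_def)
    obtain f'' g'' where phi': "\<phi> (S0_class f') = S0_class f''" "\<phi> (S0_class g') = S0_class g''"
      using phi by metis
    show "(class_value \<circ> \<phi> \<circ> value_class) (f + g) = (class_value \<circ> \<phi> \<circ> value_class) f + (class_value \<circ> \<phi> \<circ> value_class) g"
      unfolding fg by (simp add: S0_class_simps ring_hom_add[OF hom] phi' flip: eval3_hom)
        (simp add: eval3_hom flip: S0_class_simps)
    show "(class_value \<circ> \<phi> \<circ> value_class) (f * g) = (class_value \<circ> \<phi> \<circ> value_class) f * (class_value \<circ> \<phi> \<circ> value_class) g"
      unfolding fg by (simp add: S0_class_simps ring_hom_mult[OF hom] phi' flip: eval3_hom)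
        (simp add: eval3_hom flip: S0_class_simps)
  next
    have "value_class 1 = S0_class 1"
      using value_class_laurent_eval[of 1] by (simp add: eval3_hom)
    moreover have "\<phi> (S0_class 1) = S0_class 1"
      using ring_hom_one[OF hom] by (simp add: S0_class_simps)
    ultimately show "(class_value \<circ> \<phi> \<circ> value_class) 1 = 1"
      by (simp add: eval3_hom)
  next
    have "inj_on class_value (carrier S0_ring)"
      by (rule inj_on_inverseI[of _ value_class]) (rule value_class_class_value)
    moreover have "inj_on value_class coord_ring"
      by (rule inj_on_inverseI[of _ class_value]) (rule class_value_value_class)
    moreover have "value_class ` coord_ring = carrier S0_ring"
      by (auto simp: coord_ring_def carrier_S0_ring image_image)
    moreover have "\<phi> ` carrier S0_ring = carrier S0_ring" "inj_on \<phi> (carrier S0_ring)"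
      using bij by (auto simp: bij_betw_def)
    ultimately show "inj_on (class_value \<circ> \<phi> \<circ> value_class) coord_ring"
      by (simp add: comp_inj_on image_comp[symmetric])
  next
    fix g assume "g \<in> coord_ring"
    then obtain g' where g: "g = laurent_eval g'"
      by (auto simp: coord_ring_def)
    have "S0_class g' \<in> \<phi> ` carrier S0_ring"
      using bij by (simp add: bij_betw_def)
    then obtain f where "S0_class g' = \<phi> (S0_class f)"
      by (auto simp: carrier_S0_ring)
    then show "\<exists>f\<in>coord_ring. (class_value \<circ> \<phi> \<circ> value_class) f = g"
      using class_value_S0_class[of g'] unfolding g by (intro bexI[of _ "laurent_eval f"]) auto
  qed
qed

lemma class_value_aut:
  assumes "\<phi> \<in> carrier Aut_S0"
  shows "class_value (\<phi> (S0_class g)) = eval3 (aut_images \<phi>) g"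
proof -
  interpret coord_aut "class_value \<circ> \<phi> \<circ> value_class"
    by (rule coord_aut_of_Aut_S0[OF assms])
  have "ring_map ((class_value \<circ> \<phi> \<circ> value_class) \<circ> laurent_eval)"
    unfolding ring_map_def using add mult one by (simp add: eval3_hom)
  from ring_map_eq_eval3[OF this, of g] show ?thesis
    by (simp add: aut_images_def)
qed

lemma aut_images_coord_aut:
  "aut_images \<phi> = ((class_value \<circ> \<phi> \<circ> value_class) X, (class_value \<circ> \<phi> \<circ> value_class) Y, (class_value \<circ> \<phi> \<circ> value_class) Z)"
  using value_class_laurent_eval[of var_x] value_class_laurent_eval[of var_y] value_class_laurent_eval[of var_z]
  by (simp add: aut_images_def eval3_var)

text \<open>The third coordinate is determined by \<open>p * q * r = p ^ 3 + q ^ 3 + 1\<close>, as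
  \<open>p * q \<noteq> 0\<close> can be cancelled.\<close>

lemma aut_S0_eqI:
  assumes "\<phi> \<in> carrier Aut_S0" "\<psi> \<in> carrier Aut_S0"
    and p: "fst (aut_images \<phi>) = fst (aut_images \<psi>)"
    and q: "fst (snd (aut_images \<phi>)) = fst (snd (aut_images \<psi>))"
  shows "\<phi> = \<psi>"
proof (rule extensionalityI)
  interpret a: coord_aut "class_value \<circ> \<phi> \<circ> value_class"
    by (rule coord_aut_of_Aut_S0[OF assms(1)])
  interpret b: coord_aut "class_value \<circ> \<psi> \<circ> value_class"
    by (rule coord_aut_of_Aut_S0[OF assms(2)])
  show "\<phi> \<in> extensional (carrier S0_ring)" "\<psi> \<in> extensional (carrier S0_ring)"
    using assms(1,2) by (auto simp: Aut_Spec_simps Bij_def)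
  have "a.p * a.q * a.r = a.p * a.q * b.r"
    using a.pqr_eqn b.pqr_eqn p q by (simp add: aut_images_coord_aut)
  then have "a.r = b.r"
    using a.pq_nonzero by (simp add: laurent_mult_left_cancel laurent_mult_eq_0_iff)
  with p q have eq: "aut_images \<phi> = aut_images \<psi>"
    by (simp add: aut_images_coord_aut)
  fix C assume C: "C \<in> carrier S0_ring"
  then obtain g where g: "C = S0_class g"
    by (auto simp: carrier_S0_ring)
  have "class_value (\<phi> C) = class_value (\<psi> C)"
    unfolding g using assms(1,2) by (simp add: class_value_aut eq)
  moreover have "\<phi> C \<in> carrier S0_ring" "\<psi> C \<in> carrier S0_ring"
    using assms(1,2) C by (auto simp: Aut_Spec_simps ring_hom_closed)
  ultimately show "\<phi> C = \<psi> C"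
    using value_class_class_value by metis
qed

text \<open>On functions the left factor acts first, so left multiplication by a generator
  transforms the triple of \<open>\<psi>\<close> by the formulas of that generator.\<close>

lemma aut_images_mult:
  assumes "\<phi> \<in> carrier Aut_S0" "\<psi> \<in> carrier Aut_S0"
    and "\<phi> (S0_class var_x) = S0_class a" "\<phi> (S0_class var_y) = S0_class b" "\<phi> (S0_class var_z) = S0_class c"
  shows "aut_images (\<phi> \<otimes>\<^bsub>Aut_S0\<^esub> \<psi>) = (eval3 (aut_images \<psi>) a, eval3 (aut_images \<psi>) b, eval3 (aut_images \<psi>) c)"
  by (subst aut_images_def) (use assms in \<open>simp add: Aut_Spec_simps(2) compose_def class_value_aut\<close>)

section \<open>The three involutions as comorphisms\<close>

lemma S0_map_S0_class:
  assumes "laurent_eval (a * b * c) = laurent_eval (a ^ 3 + b ^ 3 + 1)"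
  shows "S0_map (a, b, c) (S0_class g) = S0_class (eval3 (a, b, c) g)"
proof -
  have "laurent_eval (eval3 (a, b, c) h) = laurent_eval (eval3 (a, b, c) g)" if "h \<in> S0_class g" for h
  proof -
    have "S0_eqn dvd h - g"
      using that by (simp add: S0_class_iff eval3_hom flip: laurent_eval_eq_0_iff)
    then obtain k where "h = S0_eqn * k + g"
      by (metis diff_add_cancel dvdE)
    then show ?thesis
      using assms by (simp add: eval3_hom eval3_S0_eqn)
  qed
  then have "(\<lambda>h. S0_class (eval3 (a, b, c) h)) ` S0_class g = (\<lambda>h. S0_class (eval3 (a, b, c) g)) ` S0_class g"
    by (intro image_cong refl) (simp add: S0_class_eq_iff)
  also have "\<dots> = {S0_class (eval3 (a, b, c) g)}"
    using S0_class_iff[of g g] by blast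
  finally have "(\<lambda>h. S0_class (eval3 (a, b, c) h)) ` S0_class g = {S0_class (eval3 (a, b, c) g)}" .
  then show ?thesis
    by (simp add: S0_map_def)
qed

text \<open>A double substitution fixing the three coordinates fixes every class, and a self-inverse
  map is bijective.\<close>

lemma S0_map_involution:
  assumes eqn: "laurent_eval (a * b * c) = laurent_eval (a ^ 3 + b ^ 3 + 1)"
    and inv: "laurent_eval (eval3 (a, b, c) a) = X" "laurent_eval (eval3 (a, b, c) b) = Y"
      "laurent_eval (eval3 (a, b, c) c) = Z"
    and nontriv: "laurent_eval b \<noteq> Y \<or> laurent_eval a \<noteq> X"
  shows "is_involution Aut_S0 (S0_map (a, b, c))"
proof -
  let ?f = "S0_map (a, b, c)"
  note f = S0_map_S0_class[OF eqn]
  have ff: "?f (?f C) = C" if "C \<in> carrier S0_ring" for C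
  proof -
    obtain g where g: "C = S0_class g"
      using \<open>C \<in> carrier S0_ring\<close> by (auto simp: carrier_S0_ring)
    have "ring_map (laurent_eval \<circ> (eval3 (a, b, c) \<circ> eval3 (a, b, c)))"
      by (intro ring_map_comp ring_map_eval3)
    from ring_map_eq_eval3[OF this, of g] show ?thesis
      by (simp add: g f S0_class_eq_iff eval3_var inv)
  qed
  have closed: "?f C \<in> carrier S0_ring" if "C \<in> carrier S0_ring" for C
    using that by (auto simp: carrier_S0_ring f)
  have hom: "?f \<in> ring_hom S0_ring S0_ring"
  proof (rule ring_hom_memI)
    fix C D assume "C \<in> carrier S0_ring" "D \<in> carrier S0_ring"
    then obtain g h where gh: "C = S0_class g" "D = S0_class h"
      by (auto simp: carrier_S0_ring)
    show "?f (C \<otimes>\<^bsub>S0_ring\<^esub> D) = ?f C \<otimes>\<^bsub>S0_ring\<^esub> ?f D" "?f (C \<oplus>\<^bsub>S0_ring\<^esub> D) = ?f C \<oplus>\<^bsub>S0_ring\<^esub> ?f D"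
      unfolding gh by (simp_all add: f eval3_hom flip: S0_class_simps)
  next
    show "?f \<one>\<^bsub>S0_ring\<^esub> = \<one>\<^bsub>S0_ring\<^esub>"
      by (simp add: f eval3_hom flip: S0_class_simps)
  qed (rule closed)
  have "bij_betw ?f (carrier S0_ring) (carrier S0_ring)"
    by (rule bij_betwI[of _ _ _ ?f]) (use closed ff in auto)
  then have "?f \<in> carrier Aut_S0"
    using hom by (simp add: Aut_Spec_simps Bij_def S0_map_def)
  moreover have "?f \<otimes>\<^bsub>Aut_S0\<^esub> ?f = \<one>\<^bsub>Aut_S0\<^esub>"
    by (auto simp: Aut_Spec_simps compose_def ff intro!: restrict_ext)
  moreover have "?f \<noteq> \<one>\<^bsub>Aut_S0\<^esub>"
  proof
    assume "?f = \<one>\<^bsub>Aut_S0\<^esub>"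
    then have "S0_class (eval3 (a, b, c) g) = S0_class g" for g
      using f[of g] by (simp add: Aut_Spec_simps)
    from this[of var_x] this[of var_y] nontriv show False
      by (simp add: S0_class_eq_iff eval3_var)
  qed
  ultimately show ?thesis by (simp add: is_involution_def)
qed

text \<open>All follows from \<open>y * y' = x ^ 3 + 1\<close> and
  \<open>z' = y' * z - x\<^sup>2 * y\<close>, without division, so that the identities serve Laurent
  polynomials and real points alike.\<close>

lemma sigma_identities:
  fixes x y z :: "'a::comm_ring_1"
  assumes eqn: "x * y * z = x ^ 3 + y ^ 3 + 1"
  defines "y' \<equiv> x * z - y\<^sup>2" and "z' \<equiv> x * z\<^sup>2 - y\<^sup>2 * z - x\<^sup>2 * y"
  shows "x * y' * z' = x ^ 3 + y' ^ 3 + 1" "x * z' - y'\<^sup>2 = y" "x * z'\<^sup>2 - y'\<^sup>2 * z' - x\<^sup>2 * y' = z"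
proof -
  have z': "z' = y' * z - x\<^sup>2 * y"
    by (simp add: y'_def z'_def algebra_simps power2_eq_square)
  have yy': "y * y' = x ^ 3 + 1"
    using eqn by (simp add: y'_def algebra_simps power2_eq_square power3_eq_cube)
  have "x * z' - y'\<^sup>2 = y' * (x * z - y') - x ^ 3 * y"
    by (simp add: z' algebra_simps power2_eq_square power3_eq_cube)
  also have "\<dots> = y * (y * y') - x ^ 3 * y"
    by (simp add: y'_def algebra_simps power2_eq_square)
  also have "\<dots> = y"
    unfolding yy' by (simp add: algebra_simps)
  finally show y: "x * z' - y'\<^sup>2 = y" .
  have "x * y' * z' = y' * (x * z' - y'\<^sup>2) + y' ^ 3"
    by (simp add: algebra_simps power2_eq_square power3_eq_cube)
  then show "x * y' * z' = x ^ 3 + y' ^ 3 + 1"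
    using yy' by (simp add: y algebra_simps)
  have "x * z'\<^sup>2 - y'\<^sup>2 * z' - x\<^sup>2 * y' = (x * z' - y'\<^sup>2) * z' - x\<^sup>2 * y'"
    by (simp add: algebra_simps power2_eq_square)
  also have "\<dots> = y * y' * z - x\<^sup>2 * (y * y + y')"
    unfolding y by (simp add: z' algebra_simps)
  also have "\<dots> = z"
    unfolding yy' by (simp add: y'_def algebra_simps power2_eq_square power3_eq_cube)
  finally show "x * z'\<^sup>2 - y'\<^sup>2 * z' - x\<^sup>2 * y' = z" .
qed

lemma S0_triples:
  "laurent_eval (var_y * var_x * var_z) = laurent_eval (var_y ^ 3 + var_x ^ 3 + 1)"
  "laurent_eval (var_x * (var_x * var_z - var_y\<^sup>2) * (var_x * var_z\<^sup>2 - var_y\<^sup>2 * var_z - var_x\<^sup>2 * var_y))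
    = laurent_eval (var_x ^ 3 + (var_x * var_z - var_y\<^sup>2) ^ 3 + 1)"
  "laurent_eval ((var_y * var_z - var_x\<^sup>2) * var_y * (var_y * var_z\<^sup>2 - var_x\<^sup>2 * var_z - var_x * var_y\<^sup>2))
    = laurent_eval ((var_y * var_z - var_x\<^sup>2) ^ 3 + var_y ^ 3 + 1)"
proof -
  have YX: "Y * X * Z = Y ^ 3 + X ^ 3 + 1"
    using XYZ_eqn by (simp add: mult_ac add_ac)
  show "laurent_eval (var_y * var_x * var_z) = laurent_eval (var_y ^ 3 + var_x ^ 3 + 1)"
    using YX by (simp only: eval3_hom eval3_var)
  show "laurent_eval (var_x * (var_x * var_z - var_y\<^sup>2) * (var_x * var_z\<^sup>2 - var_y\<^sup>2 * var_z - var_x\<^sup>2 * var_y))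
    = laurent_eval (var_x ^ 3 + (var_x * var_z - var_y\<^sup>2) ^ 3 + 1)"
    using sigma_identities(1)[OF XYZ_eqn] by (simp only: eval3_hom eval3_var)
  show "laurent_eval ((var_y * var_z - var_x\<^sup>2) * var_y * (var_y * var_z\<^sup>2 - var_x\<^sup>2 * var_z - var_x * var_y\<^sup>2))
    = laurent_eval ((var_y * var_z - var_x\<^sup>2) ^ 3 + var_y ^ 3 + 1)"
    using sigma_identities(1)[OF YX] by (simp only: eval3_hom eval3_var) (simp only: mult_ac add_ac)
qed

lemma XY_sigma_nontrivial: "X \<noteq> Y" "X * Z - Y\<^sup>2 \<noteq> Y" "Y * Z - X\<^sup>2 \<noteq> X"
proof -
  have "lookup X (1, 0) \<noteq> lookup Y (1, 0)" "lookup (X * Z - Y\<^sup>2) (3, -1) \<noteq> lookup Y (3, -1)"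
    "lookup (Y * Z - X\<^sup>2) (-1, 3) \<noteq> lookup X (-1, 3)"
    by (simp_all add: Z_def power2_eq_square distrib_left mult_single lookup_add lookup_minus lookup_single when_def)
  then show "X \<noteq> Y" "X * Z - Y\<^sup>2 \<noteq> Y" "Y * Z - X\<^sup>2 \<noteq> X"
    by metis+
qed

lemma involutions:
  "is_involution Aut_S0 tau" "is_involution Aut_S0 sigma_x" "is_involution Aut_S0 sigma_y"
proof -
  have YX: "Y * X * Z = Y ^ 3 + X ^ 3 + 1"
    using XYZ_eqn by (simp add: mult_ac add_ac)
  show "is_involution Aut_S0 tau"
    unfolding tau_def using XY_sigma_nontrivial
    by (intro S0_map_involution S0_triples) (simp_all add: eval3_var eval3_hom)
  show "is_involution Aut_S0 sigma_x"
    unfolding sigma_x_def using XY_sigma_nontrivial sigma_identities(2,3)[OF XYZ_eqn]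
    by (intro S0_map_involution S0_triples) (simp_all only: eval3_var eval3_hom simp_thms)
  show "is_involution Aut_S0 sigma_y"
    unfolding sigma_y_def using XY_sigma_nontrivial sigma_identities(2,3)[OF YX]
    by (intro S0_map_involution S0_triples) (simp_all only: eval3_var eval3_hom simp_thms
        mult.commute[of "Y\<^sup>2" X] mult.commute[of "Y\<^sup>2" "Y * Z - X\<^sup>2"])
qed

lemma generators_closed:
  "tau \<in> carrier Aut_S0" "sigma_x \<in> carrier Aut_S0" "sigma_y \<in> carrier Aut_S0"
  using involutions by (auto simp: is_involution_def)

lemma generators_square:
  "tau \<otimes>\<^bsub>Aut_S0\<^esub> tau = \<one>\<^bsub>Aut_S0\<^esub>" "sigma_x \<otimes>\<^bsub>Aut_S0\<^esub> sigma_x = \<one>\<^bsub>Aut_S0\<^esub>" "sigma_y \<otimes>\<^bsub>Aut_S0\<^esub> sigma_y = \<one>\<^bsub>Aut_S0\<^esub>"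
  using involutions by (auto simp: is_involution_def)

lemma tau_S0_class: "tau (S0_class g) = S0_class (eval3 (var_y, var_x, var_z) g)"
  unfolding tau_def by (rule S0_map_S0_class[OF S0_triples(1)])

lemma sigma_x_S0_class: "sigma_x (S0_class g) = S0_class (eval3 (var_x, var_x * var_z - var_y\<^sup>2,
    var_x * var_z\<^sup>2 - var_y\<^sup>2 * var_z - var_x\<^sup>2 * var_y) g)"
  unfolding sigma_x_def by (rule S0_map_S0_class[OF S0_triples(2)])

subsection \<open>Generation by the three involutions\<close>

lemma aut_images_tau:
  assumes "\<phi> \<in> carrier Aut_S0" "aut_images \<phi> = (p, q, r)"
  shows "aut_images (tau \<otimes>\<^bsub>Aut_S0\<^esub> \<phi>) = (q, p, r)"
  using aut_images_mult[OF generators_closed(1) assms(1) tau_S0_class tau_S0_class tau_S0_class]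
  by (simp add: eval3_var assms(2))

lemma aut_images_sigma_x:
  assumes "\<phi> \<in> carrier Aut_S0" "aut_images \<phi> = (p, q, r)"
  shows "aut_images (sigma_x \<otimes>\<^bsub>Aut_S0\<^esub> \<phi>) = (p, p * r - q\<^sup>2, p * r\<^sup>2 - q\<^sup>2 * r - p\<^sup>2 * q)"
  using aut_images_mult[OF generators_closed(2) assms(1) sigma_x_S0_class sigma_x_S0_class sigma_x_S0_class]
  by (simp add: eval3_var eval3_hom assms(2))

lemma aut_images_basic:
  "aut_images \<one>\<^bsub>Aut_S0\<^esub> = (X, Y, Z)" "aut_images tau = (Y, X, Z)"
  by (simp_all add: aut_images_def Aut_Spec_simps tau_S0_class eval3_var)

lemma generate_cancel_involution:
  assumes "t \<in> S" "t \<in> carrier Aut_S0" "t \<otimes>\<^bsub>Aut_S0\<^esub> t = \<one>\<^bsub>Aut_S0\<^esub>" "\<phi> \<in> carrier Aut_S0"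
    and "t \<otimes>\<^bsub>Aut_S0\<^esub> \<phi> \<in> generate Aut_S0 S"
  shows "\<phi> \<in> generate Aut_S0 S"
proof -
  interpret group Aut_S0 by (rule group_Aut_S0)
  have "\<phi> = t \<otimes>\<^bsub>Aut_S0\<^esub> (t \<otimes>\<^bsub>Aut_S0\<^esub> \<phi>)"
    using assms by (simp flip: m_assoc)
  then show ?thesis
    using generate.eng[OF generate.incl[OF assms(1)] assms(5)] by simp
qed

text \<open>Outside the reduced range \<open>2 b > 3 a\<close>, so \<open>sigma_x\<close> lowers
  \<open>b\<close> to \<open>3 a - b < b\<close> and the sum of the two degrees drops.\<close>

lemma Aut_S0_generated_ordered:
  assumes "\<phi> \<in> carrier Aut_S0" "tdeg (fst (aut_images \<phi>)) \<le> tdeg (fst (snd (aut_images \<phi>)))"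
  shows "\<phi> \<in> generate Aut_S0 {tau, sigma_x}"
  using assms
proof (induction "nat (tdeg (fst (aut_images \<phi>)) + tdeg (fst (snd (aut_images \<phi>))))" arbitrary: \<phi> rule: less_induct)
  case less
  interpret G: group Aut_S0 by (rule group_Aut_S0)
  let ?H = "generate Aut_S0 {tau, sigma_x}"
  interpret coord_aut "class_value \<circ> \<phi> \<circ> value_class"
    by (rule coord_aut_of_Aut_S0[OF less.prems(1)])
  have im: "aut_images \<phi> = (p, q, r)"
    by (rule aut_images_coord_aut)
  show ?case
  proof (cases "2 * tdeg q \<le> 3 * tdeg p")
    case True
    have "(p = X \<and> q = Y) \<or> (p = Y \<and> q = X)"
      using reduced_tdeg[OF _ True] less.prems(2) by (intro tdeg_1_images) (auto simp: im)
    then have "\<phi> = \<one>\<^bsub>Aut_S0\<^esub> \<or> \<phi> = tau"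
      using aut_S0_eqI[OF less.prems(1) G.one_closed] aut_S0_eqI[OF less.prems(1) generators_closed(1)]
      by (auto simp: im aut_images_basic)
    then show ?thesis
      by (auto intro: generate.one generate.incl)
  next
    case False
    define \<psi> where "\<psi> = sigma_x \<otimes>\<^bsub>Aut_S0\<^esub> \<phi>"
    have \<psi>: "\<psi> \<in> carrier Aut_S0"
      using less.prems(1) generators_closed by (simp add: \<psi>_def)
    have im\<psi>: "aut_images \<psi> = (p, p * r - q\<^sup>2, p * r\<^sup>2 - q\<^sup>2 * r - p\<^sup>2 * q)"
      unfolding \<psi>_def by (rule aut_images_sigma_x[OF less.prems(1) im])
    note im\<tau> = aut_images_tau[OF \<psi> im\<psi>]
    have "1 \<le> tdeg (p * r - q\<^sup>2)"
    proof -
      interpret b: coord_aut "class_value \<circ> \<psi> \<circ> value_class"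
        by (rule coord_aut_of_Aut_S0[OF \<psi>])
      have "b.q = p * r - q\<^sup>2"
        using im\<psi> by (simp add: aut_images_coord_aut)
      with b.tdeg_pq_pos show ?thesis by simp
    qed
    with tdeg_involution tdeg_pq_pos False
    have small: "nat (tdeg p + tdeg (p * r - q\<^sup>2)) < nat (tdeg p + tdeg q)"
      by linarith
    have "\<psi> \<in> ?H"
    proof (cases "tdeg p \<le> tdeg (p * r - q\<^sup>2)")
      case True
      then show ?thesis
        using less.hyps[OF _ \<psi>] small by (simp add: im im\<psi>)
    next
      case False
      \<comment> \<open>\<open>sigma_x\<close> may have reversed the order of the degrees;
        \<open>tau\<close> restores it and keeps their sum.\<close>
      have "tau \<otimes>\<^bsub>Aut_S0\<^esub> \<psi> \<in> ?H"
        using less.hyps[of "tau \<otimes>\<^bsub>Aut_S0\<^esub> \<psi>"] small False \<psi> generators_closed(1)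
        by (simp add: im im\<tau> add.commute)
      then show ?thesis
        by (rule generate_cancel_involution[OF _ generators_closed(1) generators_square(1) \<psi>, rotated]) simp
    qed
    then show ?thesis
      unfolding \<psi>_def
      by (rule generate_cancel_involution[OF _ generators_closed(2) generators_square(2) less.prems(1), rotated]) simp
  qed
qed

lemma Aut_S0_generated: "generate Aut_S0 {tau, sigma_x} = carrier Aut_S0"
proof
  interpret G: group Aut_S0 by (rule group_Aut_S0)
  show "generate Aut_S0 {tau, sigma_x} \<subseteq> carrier Aut_S0"
    using generators_closed by (intro G.generate_incl) auto
  show "carrier Aut_S0 \<subseteq> generate Aut_S0 {tau, sigma_x}"
  proof
    fix \<phi> assume \<phi>: "\<phi> \<in> carrier Aut_S0"
    obtain p q r where im: "aut_images \<phi> = (p, q, r)"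
      by (metis prod_cases3)
    show "\<phi> \<in> generate Aut_S0 {tau, sigma_x}"
    proof (cases "tdeg p \<le> tdeg q")
      case True
      with \<phi> show ?thesis
        by (intro Aut_S0_generated_ordered) (auto simp: im)
    next
      case False
      have "tau \<otimes>\<^bsub>Aut_S0\<^esub> \<phi> \<in> generate Aut_S0 {tau, sigma_x}"
        using False \<phi> generators_closed(1)
        by (intro Aut_S0_generated_ordered) (auto simp: aut_images_tau[OF \<phi> im])
      then show ?thesis
        by (rule generate_cancel_involution[OF _ generators_closed(1) generators_square(1) \<phi>, rotated]) simp
    qed
  qed
qed

section \<open>Groups generated by two involutions\<close>

lemma infinite_dihedral_carrier_iff: "(n, h) \<in> carrier infinite_dihedral_group \<longleftrightarrow> h = 0 \<or> h = 1"
  by (auto simp: infinite_dihedral_group_def semidirect_product_def carrier_integer_mod_group)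

lemma infinite_dihedral_carrierE:
  assumes "a \<in> carrier infinite_dihedral_group"
  obtains n h where "a = (n, h)" "h = 0 \<or> h = 1"
  using assms infinite_dihedral_carrier_iff by (metis surj_pair)

lemma group_infinite_dihedral_group: "group infinite_dihedral_group"
proof (rule groupI)
  fix a assume "a \<in> carrier infinite_dihedral_group"
  then obtain n h where a: "a = (n, h)" "h = 0 \<or> h = 1"
    by (rule infinite_dihedral_carrierE)
  show "\<exists>b\<in>carrier infinite_dihedral_group. b \<otimes>\<^bsub>infinite_dihedral_group\<^esub> a = \<one>\<^bsub>infinite_dihedral_group\<^esub>"
    using a(2) by (intro bexI[of _ "(if h = 0 then - n else n, h)"])
      (auto simp: a(1) infinite_dihedral_group_def semidirect_product_def carrier_integer_mod_group)
next
  fix a b c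
  assume "a \<in> carrier infinite_dihedral_group" "b \<in> carrier infinite_dihedral_group" "c \<in> carrier infinite_dihedral_group"
  then obtain n1 h1 n2 h2 n3 h3 where "a = (n1, h1)" "h1 = 0 \<or> h1 = 1" "b = (n2, h2)" "h2 = 0 \<or> h2 = 1"
    "c = (n3, h3)" "h3 = 0 \<or> h3 = 1"
    by (metis infinite_dihedral_carrierE)
  then show "a \<otimes>\<^bsub>infinite_dihedral_group\<^esub> b \<otimes>\<^bsub>infinite_dihedral_group\<^esub> c
      = a \<otimes>\<^bsub>infinite_dihedral_group\<^esub> (b \<otimes>\<^bsub>infinite_dihedral_group\<^esub> c)"
    by (auto simp: infinite_dihedral_group_def semidirect_product_def)
qed (auto simp: infinite_dihedral_group_def semidirect_product_def carrier_integer_mod_group)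

context group
begin

text \<open>Conjugation by \<open>t\<close> is a homomorphism that inverts \<open>s t\<close>: the
  defining relation of a dihedral group.\<close>

lemma involution_conj_pow:
  assumes "t \<in> carrier G" "s \<in> carrier G" "t \<otimes> t = \<one>" "s \<otimes> s = \<one>"
  shows "t \<otimes> (s \<otimes> t) [^] (n :: int) = (s \<otimes> t) [^] (- n) \<otimes> t"
proof -
  have inv: "inv t = t" "inv s = s"
    using assms by (simp_all add: inv_equality)
  have tt: "t \<otimes> (t \<otimes> x) = x" if "x \<in> carrier G" for x
    using that assms by (simp flip: m_assoc)
  have conj: "(\<lambda>x. t \<otimes> x \<otimes> t) \<in> hom G G"
    using assms by (auto simp: hom_def m_assoc tt)
  have "t \<otimes> (s \<otimes> t) [^] n \<otimes> t = (t \<otimes> (s \<otimes> t) \<otimes> t) [^] n"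
    using hom_int_pow[OF conj, of "s \<otimes> t" n] assms is_group by simp
  also have "t \<otimes> (s \<otimes> t) \<otimes> t = inv (s \<otimes> t)"
    using assms inv by (simp add: m_assoc inv_mult_group)
  also have "\<dots> [^] n = (s \<otimes> t) [^] (- n)"
    using assms by (simp add: int_pow_inv int_pow_neg)
  finally have "t \<otimes> (s \<otimes> t) [^] n \<otimes> t \<otimes> t = (s \<otimes> t) [^] (- n) \<otimes> t"
    by simp
  then show ?thesis
    using assms by (simp add: m_assoc)
qed

text \<open>The universal property of \<open>Z/2 * Z/2\<close>: the two reflections
  \<open>(0, 1)\<close> and \<open>(1, 1)\<close> go to \<open>t\<close> and
  \<open>s\<close>.\<close>

lemma infinite_dihedral_hom:
  assumes "t \<in> carrier G" "s \<in> carrier G" "t \<otimes> t = \<one>" "s \<otimes> s = \<one>"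
  shows "group_hom infinite_dihedral_group G (\<lambda>(n, h). (s \<otimes> t) [^] n \<otimes> (if h = 0 then \<one> else t))"
proof -
  have "(\<lambda>(n, h). (s \<otimes> t) [^] n \<otimes> (if h = 0 then \<one> else t)) \<in> hom infinite_dihedral_group G"
  proof (rule homI)
    fix a assume "a \<in> carrier infinite_dihedral_group"
    then show "(case a of (n, h) \<Rightarrow> (s \<otimes> t) [^] n \<otimes> (if h = 0 then \<one> else t)) \<in> carrier G"
      using assms by (auto split: prod.splits)
  next
    fix a b assume "a \<in> carrier infinite_dihedral_group" "b \<in> carrier infinite_dihedral_group"
    then obtain n h n' h' where ab: "a = (n, h)" "h = 0 \<or> h = 1" "b = (n', h')" "h' = 0 \<or> h' = 1"
      by (metis infinite_dihedral_carrierE)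
    have tt: "t \<otimes> (t \<otimes> x) = x" if "x \<in> carrier G" for x
      using that assms by (simp flip: m_assoc)
    have pow: "t \<otimes> ((s \<otimes> t) [^] n' \<otimes> x) = (s \<otimes> t) [^] (- n') \<otimes> (t \<otimes> x)" if "x \<in> carrier G" for x
      using involution_conj_pow[OF assms, of n'] that assms by (simp flip: m_assoc)
    have "(s \<otimes> t) [^] (n - n') = (s \<otimes> t) [^] n \<otimes> (s \<otimes> t) [^] (- n')"
      using int_pow_mult[of "s \<otimes> t" n "- n'"] assms by simp
    with ab(2,4) show "(case a \<otimes>\<^bsub>infinite_dihedral_group\<^esub> b of (n, h) \<Rightarrow> (s \<otimes> t) [^] n \<otimes> (if h = 0 then \<one> else t))
        = (case a of (n, h) \<Rightarrow> (s \<otimes> t) [^] n \<otimes> (if h = 0 then \<one> else t)) \<otimes> (case b of (n, h) \<Rightarrow> (s \<otimes> t) [^] n \<otimes> (if h = 0 then \<one> else t))"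
      unfolding ab(1,3) using assms
      by (auto simp: infinite_dihedral_group_def semidirect_product_def int_pow_mult m_assoc pow)
  qed
  then show ?thesis
    by (simp add: group_hom_def group_hom_axioms_def group_infinite_dihedral_group is_group)
qed

lemma generated_by_involutions_cases:
  assumes "t \<in> carrier G" "s \<in> carrier G" "t \<otimes> t = \<one>" "s \<otimes> s = \<one>"
    and "g \<in> generate G {t, s}"
  obtains n :: int where "g = (s \<otimes> t) [^] n" | n :: int where "g = (s \<otimes> t) [^] n \<otimes> t"
proof -
  let ?f = "\<lambda>(n, h :: int). (s \<otimes> t) [^] (n :: int) \<otimes> (if h = 0 then \<one> else t)"
  interpret f: group_hom infinite_dihedral_group G ?f
    by (rule infinite_dihedral_hom[OF assms(1-4)])
  note el = infinite_dihedral_carrier_iff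
  have "t = ?f (0, 1)" "s = ?f (1, 1)"
    using assms by (simp_all add: m_assoc)
  moreover have "(0, 1) \<in> carrier infinite_dihedral_group" "(1, 1) \<in> carrier infinite_dihedral_group"
    by (simp_all add: el)
  ultimately have "{t, s} \<subseteq> ?f ` carrier infinite_dihedral_group"
    by blast
  then have "g \<in> ?f ` carrier infinite_dihedral_group"
    using generate_subgroup_incl[OF _ f.img_is_subgroup] assms(5) by blast
  then obtain n h where "g = ?f (n, h)"
    by auto
  then show ?thesis
    using that assms(1,2) by (cases "h = 0") auto
qed

lemma iso_infinite_dihedral_group:
  assumes ts: "t \<in> carrier G" "s \<in> carrier G" "t \<otimes> t = \<one>" "s \<otimes> s = \<one>"
    and gen: "generate G {t, s} = carrier G" and t: "t \<noteq> \<one>"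
    and inf: "\<And>n :: int. (s \<otimes> t) [^] n = \<one> \<Longrightarrow> n = 0"
  shows "G \<cong> infinite_dihedral_group"
proof -
  let ?D = infinite_dihedral_group
  let ?f = "\<lambda>(n, h :: int). (s \<otimes> t) [^] (n :: int) \<otimes> (if h = 0 then \<one> else t)"
  interpret f: group_hom ?D G ?f
    by (rule infinite_dihedral_hom[OF ts])
  note el = infinite_dihedral_carrier_iff
  have "a = \<one>\<^bsub>?D\<^esub>" if a: "a \<in> carrier ?D" "?f a = \<one>" for a
  proof -
    obtain n h where nh: "a = (n, h)" "h = 0 \<or> h = 1"
      using a(1) by (rule infinite_dihedral_carrierE)
    have "h = 0"
    proof (rule ccontr)
      \<comment> \<open>Then \<open>(s t)^n = t\<close> squares to the identity, so infinite order
        forces \<open>n = 0\<close> and hence \<open>t = 1\<close>.\<close>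
      assume "h \<noteq> 0"
      with a(2) have n: "(s \<otimes> t) [^] n \<otimes> t = \<one>"
        by (simp add: nh(1))
      then have "(s \<otimes> t) [^] n = t"
        using ts inv_equality[OF n] inv_equality[OF ts(3)] by (metis int_pow_closed inv_inv m_closed)
      then have "(s \<otimes> t) [^] (n + n) = \<one>"
        using ts int_pow_mult[of "s \<otimes> t" n n] by simp
      then have "n = 0"
        using inf by fastforce
      with n ts t show False by simp
    qed
    with a(2) ts inf show ?thesis
      by (auto simp: nh(1) infinite_dihedral_group_def semidirect_product_def)
  qed
  then have "inj_on ?f (carrier ?D)"
    unfolding f.inj_iff_trivial_ker kernel_def using f.hom_one f.one_closed by blast
  moreover have "?f ` carrier ?D = carrier G"
  proof
    show "?f ` carrier ?D \<subseteq> carrier G"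
      using f.hom_closed by blast
    show "carrier G \<subseteq> ?f ` carrier ?D"
    proof
      fix g assume "g \<in> carrier G"
      then have "g \<in> generate G {t, s}"
        by (simp add: gen)
      then show "g \<in> ?f ` carrier ?D"
      proof (rule generated_by_involutions_cases[OF ts])
        fix n :: int assume "g = (s \<otimes> t) [^] n"
        then show ?thesis
          using ts el by (intro image_eqI[of _ _ "(n, 0)"]) auto
      next
        fix n :: int assume "g = (s \<otimes> t) [^] n \<otimes> t"
        then show ?thesis
          using ts el by (intro image_eqI[of _ _ "(n, 1)"]) auto
      qed
    qed
  qed
  ultimately have "?f \<in> iso ?D G"
    using f.homh by (simp add: iso_def bij_betw_def)
  then have "?D \<cong> G"
    by (auto simp: is_iso_def)
  then show ?thesis
    by (rule group.iso_sym[OF group_infinite_dihedral_group])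
qed

end

section \<open>The action on positive real points\<close>

lemma S0_value_S0_class:
  assumes "p \<in> S0_pos"
  shows "S0_value p (S0_class g) = eval3 p g"
proof -
  obtain x y z where p: "p = (x, y, z)" "x * y * z = x ^ 3 + y ^ 3 + 1"
    using assms by (auto simp: S0_pos_def)
  have "eval3 p h = eval3 p g" if "h \<in> S0_class g" for h
  proof -
    have "S0_eqn dvd h - g"
      using that by (simp add: S0_class_iff eval3_hom flip: laurent_eval_eq_0_iff)
    then obtain k where "h - g = S0_eqn * k"
      by (elim dvdE)
    then have "eval3 p (h - g) = eval3 p S0_eqn * eval3 p k"
      by (simp only: eval3_hom)
    then show ?thesis
      by (simp add: eval3_hom p eval3_S0_eqn)
  qed
  then have "eval3 p ` S0_class g = (\<lambda>h. eval3 p g) ` S0_class g"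
    by (intro image_cong refl)
  also have "\<dots> = {eval3 p g}"
    using S0_class_iff[of g g] by blast
  finally have "eval3 p ` S0_class g = {eval3 p g}" .
  then show ?thesis by (simp add: S0_value_def)
qed

lemma aut_S0_classE:
  assumes "\<phi> \<in> carrier Aut_S0"
  obtains h where "\<phi> (S0_class g) = S0_class h"
proof -
  have "\<phi> (S0_class g) \<in> carrier S0_ring"
    using assms by (auto simp: Aut_Spec_simps ring_hom_closed)
  then show ?thesis
    using that by (auto simp: carrier_S0_ring)
qed

text \<open>The left side is a homomorphism in \<open>g\<close>, hence evaluation at the point of
  its values on the variables, and that point is \<open>S0_pos_action \<phi> p\<close>.\<close>

lemma S0_value_aut:
  assumes "\<phi> \<in> carrier Aut_S0" "p \<in> S0_pos"
  shows "S0_value p (\<phi> (S0_class g)) = eval3 (S0_pos_action \<phi> p) g"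
proof -
  have hom: "\<phi> \<in> ring_hom S0_ring S0_ring"
    using assms(1) by (simp add: Aut_Spec_simps)
  have "ring_map (\<lambda>g. S0_value p (\<phi> (S0_class g)))"
    unfolding ring_map_def
  proof (intro conjI allI)
    have "\<phi> (S0_class 1) = S0_class 1"
      using ring_hom_one[OF hom] by (simp add: S0_class_simps)
    then show "S0_value p (\<phi> (S0_class 1)) = 1"
      by (simp add: S0_value_S0_class[OF assms(2)] eval3_hom)
  next
    fix g h
    obtain g' h' where gh: "\<phi> (S0_class g) = S0_class g'" "\<phi> (S0_class h) = S0_class h'"
      by (metis aut_S0_classE[OF assms(1)])
    have "\<phi> (S0_class (g + h)) = S0_class (g' + h')" "\<phi> (S0_class (g * h)) = S0_class (g' * h')"
      by (simp_all add: S0_class_simps ring_hom_add[OF hom] ring_hom_mult[OF hom] gh)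
    then show "S0_value p (\<phi> (S0_class (g + h))) = S0_value p (\<phi> (S0_class g)) + S0_value p (\<phi> (S0_class h))"
      "S0_value p (\<phi> (S0_class (g * h))) = S0_value p (\<phi> (S0_class g)) * S0_value p (\<phi> (S0_class h))"
      by (simp_all add: gh S0_value_S0_class[OF assms(2)] eval3_hom)
  qed
  from ring_map_eq_eval3[OF this, of g] show ?thesis
    using assms(2) by (simp add: S0_pos_action_def)
qed

text \<open>Positivity of the intermediate point is assumed because
  \<open>S0_pos_action_closed\<close> is itself derived from this rule.\<close>

lemma S0_pos_action_mult:
  assumes "\<phi> \<in> carrier Aut_S0" "\<psi> \<in> carrier Aut_S0" "p \<in> S0_pos" "S0_pos_action \<psi> p \<in> S0_pos"
  shows "S0_pos_action (\<phi> \<otimes>\<^bsub>Aut_S0\<^esub> \<psi>) p = S0_pos_action \<phi> (S0_pos_action \<psi> p)"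
proof -
  have "S0_value p ((\<phi> \<otimes>\<^bsub>Aut_S0\<^esub> \<psi>) (S0_class g)) = S0_value (S0_pos_action \<psi> p) (\<phi> (S0_class g))" for g
  proof -
    obtain h where h: "\<phi> (S0_class g) = S0_class h"
      by (rule aut_S0_classE[OF assms(1)])
    then show ?thesis
      using assms by (simp add: Aut_Spec_simps(2) compose_def S0_value_aut S0_value_S0_class)
  qed
  then show ?thesis
    using assms(3,4) by (simp add: S0_pos_action_def)
qed

lemma S0_pos_action_generators:
  assumes "(x, y, z) \<in> S0_pos"
  shows "S0_pos_action tau (x, y, z) = (y, x, z)"
    and "S0_pos_action sigma_x (x, y, z) = (x, x * z - y\<^sup>2, x * z\<^sup>2 - y\<^sup>2 * z - x\<^sup>2 * y)"
  using assms by (simp_all add: S0_pos_action_def tau_S0_class sigma_x_S0_class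
      S0_value_S0_class eval3_hom eval3_var)

lemma S0_pos_action_one: "p \<in> S0_pos \<Longrightarrow> S0_pos_action \<one>\<^bsub>Aut_S0\<^esub> p = p"
  by (cases p) (simp add: S0_pos_action_def Aut_Spec_simps S0_value_S0_class eval3_var)

lemma S0_pos_involution: "(x, y, z) \<in> S0_pos \<Longrightarrow> y * (x * z - y\<^sup>2) = x ^ 3 + 1"
  by (simp add: S0_pos_def algebra_simps power2_eq_square power3_eq_cube)

text \<open>Generation reduces this to \<open>tau\<close> and \<open>sigma_x\<close>. For
  \<open>sigma_x\<close>, \<open>y * y' = x ^ 3 + 1\<close> gives \<open>y' > 0\<close>, and then
  the equation gives \<open>z' > 0\<close>.\<close>

lemma S0_pos_action_closed:
  assumes "\<phi> \<in> carrier Aut_S0" "p \<in> S0_pos"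
  shows "S0_pos_action \<phi> p \<in> S0_pos"
proof -
  have tau: "S0_pos_action tau p \<in> S0_pos" if "p \<in> S0_pos" for p
  proof (cases p)
    case (fields x y z)
    with that show ?thesis
      by (simp add: S0_pos_action_generators) (auto simp: S0_pos_def mult_ac)
  qed
  have sigma: "S0_pos_action sigma_x p \<in> S0_pos" if "p \<in> S0_pos" for p
  proof (cases p)
    case (fields x y z)
    with that have p: "(x, y, z) \<in> S0_pos" by simp
    define y' where "y' = x * z - y\<^sup>2"
    define z' where "z' = x * z\<^sup>2 - y\<^sup>2 * z - x\<^sup>2 * y"
    have pos: "x > 0" "y > 0" "x * y * z = x ^ 3 + y ^ 3 + 1"
      using p by (auto simp: S0_pos_def)
    have "y * y' > 0"
      using S0_pos_involution[OF p] pos by (simp add: y'_def add_pos_pos)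
    then have y': "y' > 0"
      using pos by (simp add: zero_less_mult_iff)
    have eqn: "x * y' * z' = x ^ 3 + y' ^ 3 + 1"
      unfolding y'_def z'_def by (rule sigma_identities(1)[OF pos(3)])
    then have "x * y' * z' > 0"
      using pos y' by (simp add: add_pos_pos)
    then have "z' > 0"
      using pos y' by (intro zero_less_mult_pos[of "x * y'" z']) auto
    with y' pos eqn have "(x, y', z') \<in> S0_pos"
      by (simp add: S0_pos_def)
    then show ?thesis
      using p by (simp add: fields S0_pos_action_generators y'_def z'_def)
  qed
  interpret group Aut_S0 by (rule group_Aut_S0)
  have inv: "inv\<^bsub>Aut_S0\<^esub> tau = tau" "inv\<^bsub>Aut_S0\<^esub> sigma_x = sigma_x"
    using generators_closed generators_square by (simp_all add: inv_equality)
  have "\<phi> \<in> generate Aut_S0 {tau, sigma_x}"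
    using assms(1) by (simp add: Aut_S0_generated)
  then have "\<forall>p\<in>S0_pos. S0_pos_action \<phi> p \<in> S0_pos"
  proof (induction \<phi> rule: generate.induct)
    case (eng \<phi> \<psi>)
    then have "\<phi> \<in> carrier Aut_S0" "\<psi> \<in> carrier Aut_S0"
      by (simp_all add: Aut_S0_generated)
    with eng.IH show ?case
      by (simp add: S0_pos_action_mult)
  qed (use tau sigma inv in \<open>auto simp: S0_pos_action_one\<close>)
  with assms(2) show ?thesis by blast
qed

lemma S0_pos_action_inv:
  assumes "\<phi> \<in> carrier Aut_S0" "p \<in> S0_pos"
  shows "S0_pos_action (inv\<^bsub>Aut_S0\<^esub> \<phi>) (S0_pos_action \<phi> p) = p"
proof -
  interpret group Aut_S0 by (rule group_Aut_S0)
  show ?thesis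
    using assms S0_pos_action_mult[of "inv\<^bsub>Aut_S0\<^esub> \<phi>" \<phi> p]
    by (simp add: S0_pos_action_closed S0_pos_action_one)
qed

lemma group_action_S0_pos: "group_action Aut_S0 S0_pos S0_pos_action"
proof -
  interpret group Aut_S0 by (rule group_Aut_S0)
  have Bij: "S0_pos_action \<phi> \<in> Bij S0_pos" if \<phi>: "\<phi> \<in> carrier Aut_S0" for \<phi>
  proof -
    have "bij_betw (S0_pos_action \<phi>) S0_pos S0_pos"
    proof (rule bij_betwI[of _ _ _ "S0_pos_action (inv\<^bsub>Aut_S0\<^esub> \<phi>)"])
      fix p assume "p \<in> S0_pos"
      then show "S0_pos_action (inv\<^bsub>Aut_S0\<^esub> \<phi>) (S0_pos_action \<phi> p) = p"
        "S0_pos_action \<phi> (S0_pos_action (inv\<^bsub>Aut_S0\<^esub> \<phi>) p) = p"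
        using S0_pos_action_inv[OF \<phi>] S0_pos_action_inv[of "inv\<^bsub>Aut_S0\<^esub> \<phi>" p] \<phi> by simp_all
    qed (use \<phi> in \<open>auto simp: S0_pos_action_closed\<close>)
    then show ?thesis
      by (simp add: Bij_def S0_pos_action_def)
  qed
  have "S0_pos_action \<in> hom Aut_S0 (BijGroup S0_pos)"
  proof (rule homI)
    fix \<phi> \<psi> assume "\<phi> \<in> carrier Aut_S0" "\<psi> \<in> carrier Aut_S0"
    then show "S0_pos_action (\<phi> \<otimes>\<^bsub>Aut_S0\<^esub> \<psi>) = S0_pos_action \<phi> \<otimes>\<^bsub>BijGroup S0_pos\<^esub> S0_pos_action \<psi>"
      using Bij by (intro extensionalityI[of _ S0_pos])
        (auto simp: BijGroup_def compose_def S0_pos_action_mult S0_pos_action_closed, auto simp: S0_pos_action_def)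
  qed (use Bij in \<open>simp add: BijGroup_def\<close>)
  then show ?thesis
    by (simp add: group_action_def group_hom_def group_hom_axioms_def group_BijGroup is_group)
qed

subsection \<open>The orbit of a positive point\<close>

abbreviation rho :: "poly3 set \<Rightarrow> poly3 set" where
  "rho \<equiv> sigma_x \<otimes>\<^bsub>Aut_S0\<^esub> tau"

text \<open>The first coordinates along the orbit of the translation subgroup are the cluster variables
  \<open>\<dots>, x, y, (y\<^sup>3 + 1) / x, \<dots>\<close> of rank two with exchange relation
  \<open>x\<^sub>n\<^sub>-\<^sub>1 x\<^sub>n\<^sub>+\<^sub>1 = x\<^sub>n\<^sup>3 + 1\<close>.\<close>

definition orbit_coord :: "real \<times> real \<times> real \<Rightarrow> int \<Rightarrow> real" where
  "orbit_coord p n = fst (S0_pos_action (rho [^]\<^bsub>Aut_S0\<^esub> n) p)"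

lemma rho_closed: "rho \<in> carrier Aut_S0"
  using generators_closed group.is_monoid[OF group_Aut_S0] by (simp add: monoid.m_closed)

lemma S0_pos_action_rho_pow:
  assumes "p \<in> S0_pos"
  obtains z where "S0_pos_action (rho [^]\<^bsub>Aut_S0\<^esub> n) p = (orbit_coord p n, orbit_coord p (n + 1), z)"
    "orbit_coord p n > 0" "orbit_coord p (n + 1) > 0"
    "orbit_coord p n * orbit_coord p (n + 2) = orbit_coord p (n + 1) ^ 3 + 1"
proof -
  interpret group Aut_S0 by (rule group_Aut_S0)
  have closed: "S0_pos_action (rho [^]\<^bsub>Aut_S0\<^esub> n) p \<in> S0_pos" for n :: int
    using assms rho_closed by (intro S0_pos_action_closed) auto
  have step: "S0_pos_action (rho [^]\<^bsub>Aut_S0\<^esub> (n + 1)) p = (y, y * z - x\<^sup>2, y * z\<^sup>2 - x\<^sup>2 * z - y\<^sup>2 * x)"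
    if xyz: "S0_pos_action (rho [^]\<^bsub>Aut_S0\<^esub> n) p = (x, y, z)" for n :: int and x y z
  proof -
    have p': "(x, y, z) \<in> S0_pos"
      using closed[of n] by (simp add: xyz)
    then have p'': "(y, x, z) \<in> S0_pos"
      by (auto simp: S0_pos_def mult_ac)
    \<comment> \<open>With the 1 on the left, \<open>rho\<close> is the factor that acts last on
      points: first \<open>tau\<close> swaps, then \<open>sigma_x\<close> replaces the second
      entry.\<close>
    have "S0_pos_action (rho [^]\<^bsub>Aut_S0\<^esub> (1 + n)) p = S0_pos_action rho (x, y, z)"
      using S0_pos_action_mult[OF rho_closed _ assms closed[of n]] rho_closed
      by (simp add: int_pow_mult xyz)
    also have "\<dots> = (y, y * z - x\<^sup>2, y * z\<^sup>2 - x\<^sup>2 * z - y\<^sup>2 * x)"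
      using S0_pos_action_mult[OF generators_closed(2,1) p'] p' p''
      by (simp add: S0_pos_action_generators)
    finally show ?thesis by (simp add: add.commute)
  qed
  obtain x y z where xyz: "S0_pos_action (rho [^]\<^bsub>Aut_S0\<^esub> n) p = (x, y, z)"
    by (metis prod_cases3)
  note n1 = step[OF xyz]
  note n2 = step[OF n1, unfolded add.assoc one_add_one]
  have X: "orbit_coord p n = x" "orbit_coord p (n + 1) = y" "orbit_coord p (n + 2) = y * z - x\<^sup>2"
    using xyz n1 n2 by (simp_all add: orbit_coord_def)
  have "(x, y, z) \<in> S0_pos"
    using closed[of n] by (simp add: xyz)
  then have "x > 0" "y > 0" "x * (y * z - x\<^sup>2) = y ^ 3 + 1"
    by (auto simp: S0_pos_def algebra_simps power2_eq_square power3_eq_cube)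
  then show ?thesis
    using that X xyz by simp
qed

section \<open>Growth of the ratios along an orbit\<close>

definition orbit_ratio :: "real \<times> real \<times> real \<Rightarrow> int \<Rightarrow> real" where
  "orbit_ratio p n = orbit_coord p (n + 1) / orbit_coord p n"

lemma orbit_coord_facts:
  assumes "p \<in> S0_pos"
  shows "orbit_coord p n > 0" "orbit_coord p (n - 1) * orbit_coord p (n + 1) = orbit_coord p n ^ 3 + 1"
proof -
  show "orbit_coord p n > 0"
    by (rule S0_pos_action_rho_pow[OF assms, of n])
  have "orbit_coord p (n - 1) * orbit_coord p (n - 1 + 2) = orbit_coord p (n - 1 + 1) ^ 3 + 1"
    by (rule S0_pos_action_rho_pow[OF assms, of "n - 1"])
  then show "orbit_coord p (n - 1) * orbit_coord p (n + 1) = orbit_coord p n ^ 3 + 1"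
    by (simp add: algebra_simps)
qed

lemma orbit_ratio_pos: "p \<in> S0_pos \<Longrightarrow> orbit_ratio p n > 0"
  by (simp add: orbit_ratio_def orbit_coord_facts)

lemma orbit_ratio_step:
  assumes "p \<in> S0_pos"
  shows "3 / 2 * orbit_ratio p (n - 1) \<le> orbit_ratio p n"
proof -
  define w where "w = orbit_coord p n"
  define a where "a = orbit_coord p (n - 1)"
  define b where "b = orbit_coord p (n + 1)"
  have pos: "w > 0" "a > 0" "b > 0" and ab: "a * b = w ^ 3 + 1"
    using orbit_coord_facts[OF assms] by (simp_all add: w_def a_def b_def)
  \<comment> \<open>Consecutive ratios have quotient
    \<open>a * b / w\<^sup>2 = (w ^ 3 + 1) / w\<^sup>2\<close>; the square certifies that this is at
    least 3/2.\<close>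
  have "w ^ 3 + 1 - 3 / 2 * w\<^sup>2 = (w - 1)\<^sup>2 * (w + 1 / 2) + 1 / 2"
    by (simp add: power2_eq_square power3_eq_cube field_simps)
  moreover have "(w - 1)\<^sup>2 * (w + 1 / 2) \<ge> 0"
    using pos by simp
  ultimately have "3 / 2 * w\<^sup>2 \<le> a * b"
    using ab by linarith
  then have "3 / 2 * (w / a) \<le> b / w"
    using pos by (simp add: field_simps power2_eq_square)
  then show ?thesis
    by (simp add: orbit_ratio_def w_def a_def b_def)
qed

lemma orbit_ratio_growth:
  assumes "p \<in> S0_pos"
  shows "(3 / 2) ^ k * orbit_ratio p n \<le> orbit_ratio p (n + int k)"
proof (induction k)
  case (Suc k)
  then have "3 / 2 * ((3 / 2) ^ k * orbit_ratio p n) \<le> 3 / 2 * orbit_ratio p (n + int k)"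
    by (intro mult_left_mono) auto
  then have "(3 / 2) ^ Suc k * orbit_ratio p n \<le> 3 / 2 * orbit_ratio p (n + int k)"
    by (simp only: power_Suc mult.assoc)
  also have "\<dots> \<le> orbit_ratio p (n + int (Suc k))"
    using orbit_ratio_step[OF assms, of "n + int (Suc k)"] by (simp add: add.assoc)
  finally show ?case .
qed simp

lemma orbit_ratio_mono:
  assumes "p \<in> S0_pos" "m < n"
  shows "orbit_ratio p m < orbit_ratio p n"
proof -
  have "1 * orbit_ratio p m < (3 / 2) ^ nat (n - m) * orbit_ratio p m"
    using assms orbit_ratio_pos[OF assms(1), of m] by (intro mult_strict_right_mono one_less_power) auto
  also have "\<dots> \<le> orbit_ratio p n"
    using orbit_ratio_growth[OF assms(1), of "nat (n - m)" m] assms(2) by simp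
  finally show ?thesis by simp
qed

text \<open>Geometric growth takes the ratios above 1 in one direction and below 1 in the other. At
  the crossing \<open>orbit_coord p n\<close> is no larger than its two neighbours.\<close>

lemma orbit_ratio_crossing:
  assumes "p \<in> S0_pos"
  obtains n where "orbit_ratio p (n - 1) \<le> 1" "1 \<le> orbit_ratio p n"
proof (cases "orbit_ratio p 0 < 1")
  case True
  obtain k where "1 / orbit_ratio p 0 < (3 / 2) ^ k"
    using real_arch_pow[of "3 / 2" "1 / orbit_ratio p 0"] by auto
  then have "1 < (3 / 2) ^ k * orbit_ratio p 0"
    using orbit_ratio_pos[OF assms, of 0] by (simp add: field_simps)
  with orbit_ratio_growth[OF assms, of k 0] have ex: "1 \<le> orbit_ratio p (int k)"
    by simp
  define l where "l = (LEAST k. 1 \<le> orbit_ratio p (int k))"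
  have l: "1 \<le> orbit_ratio p (int l)"
    unfolding l_def by (rule LeastI[of _ k]) (rule ex)
  with True have "l \<noteq> 0"
    by (cases l) auto
  then have "\<not> 1 \<le> orbit_ratio p (int (l - 1))"
    unfolding l_def by (intro not_less_Least) auto
  with l \<open>l \<noteq> 0\<close> show ?thesis
    by (intro that[of "int l"]) (auto simp: of_nat_diff)
next
  case False
  obtain k where "orbit_ratio p 0 < (3 / 2) ^ k"
    using real_arch_pow[of "3 / 2" "orbit_ratio p 0"] by auto
  moreover have "(3 / 2) ^ k * orbit_ratio p (- int k) \<le> orbit_ratio p 0"
    using orbit_ratio_growth[OF assms, of k "- int k"] by simp
  ultimately have "(3 / 2) ^ k * orbit_ratio p (- int k) < (3 / 2) ^ k * 1"
    by linarith
  then have ex: "orbit_ratio p (- int k) < 1"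
    using mult_less_cancel_left_pos[of "(3 / 2) ^ k" "orbit_ratio p (- int k)" 1] by simp
  define l where "l = (LEAST k. orbit_ratio p (- int k) < 1)"
  have l: "orbit_ratio p (- int l) < 1"
    unfolding l_def by (rule LeastI[of _ k]) (rule ex)
  with False have "l \<noteq> 0"
    by (cases l) auto
  then have "\<not> orbit_ratio p (- int (l - 1)) < 1"
    unfolding l_def by (intro not_less_Least) auto
  with l \<open>l \<noteq> 0\<close> show ?thesis
    \<comment> \<open>The ratio is below 1 at \<open>- l\<close> and at least 1 at
      \<open>- (l - 1)\<close>, so the crossing index is \<open>1 - l\<close>.\<close>
    by (intro that[of "1 - int l"]) (auto simp: of_nat_diff)
qed

lemma orbit_ratio_le_1_iff:
  assumes "p \<in> S0_pos"
  shows "orbit_ratio p n \<le> 1 \<longleftrightarrow> orbit_coord p (n + 1) \<le> orbit_coord p n"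
    and "1 \<le> orbit_ratio p n \<longleftrightarrow> orbit_coord p n \<le> orbit_coord p (n + 1)"
  using orbit_coord_facts(1)[OF assms, of n] by (simp_all add: orbit_ratio_def field_simps)

lemma rho_pow_eq_one_imp:
  assumes "rho [^]\<^bsub>Aut_S0\<^esub> (n :: int) = \<one>\<^bsub>Aut_S0\<^esub>"
  shows "n = 0"
proof -
  interpret group Aut_S0 by (rule group_Aut_S0)
  \<comment> \<open>A concrete point, \<open>1 * 1 * 3 = 1 + 1 + 1\<close>; the strict growth of its
    ratios tells the powers of \<open>rho\<close> apart.\<close>
  have p: "(1, 1, 3) \<in> S0_pos"
    by (simp add: S0_pos_def)
  have "orbit_coord (1, 1, 3) n = orbit_coord (1, 1, 3) 0"
    by (simp add: orbit_coord_def assms)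
  moreover have "orbit_coord (1, 1, 3) (n + 1) = orbit_coord (1, 1, 3) (0 + 1)"
    using rho_closed by (simp add: orbit_coord_def assms int_pow_mult)
  ultimately have "orbit_ratio (1, 1, 3) n = orbit_ratio (1, 1, 3) 0"
    by (simp add: orbit_ratio_def)
  with orbit_ratio_mono[OF p, of n 0] orbit_ratio_mono[OF p, of 0 n] show ?thesis
    by linarith
qed

subsection \<open>The fundamental domain\<close>

text \<open>Since \<open>y * (x * z - y\<^sup>2) = x ^ 3 + 1\<close>, the last bound says that
  \<open>sigma_x\<close> does not decrease \<open>y\<close>. The set is the chamber between the
  fixed curves of \<open>tau\<close> and \<open>sigma_x\<close>.\<close>

definition S0_domain :: "(real \<times> real \<times> real) set" where
  "S0_domain = {(x, y, z). (x, y, z) \<in> S0_pos \<and> x \<le> y \<and> y \<le> sqrt (x ^ 3 + 1)}"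

lemma S0_domain_iff:
  "(x, y, z) \<in> S0_domain \<longleftrightarrow> (x, y, z) \<in> S0_pos \<and> x \<le> y \<and> y\<^sup>2 \<le> x ^ 3 + 1"
proof -
  have "y \<le> sqrt (x ^ 3 + 1) \<longleftrightarrow> y\<^sup>2 \<le> x ^ 3 + 1" if "(x, y, z) \<in> S0_pos"
    using that sqrt_ge_absD[of y "x ^ 3 + 1"] real_le_rsqrt[of y "x ^ 3 + 1"] by (auto simp: S0_pos_def)
  then show ?thesis by (auto simp: S0_domain_def)
qed

lemma closedin_S0_domain: "closedin (top_of_set S0_pos) S0_domain"
proof -
  have eq: "S0_domain = S0_pos \<inter> ({p. fst p \<le> fst (snd p)} \<inter> {p. fst (snd p) \<le> sqrt (fst p ^ 3 + 1)})"
    by (auto simp: S0_domain_def)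
  show ?thesis
    unfolding eq by (intro closedin_closed_Int closed_Int closed_Collect_le continuous_intros)
qed

text \<open>Take a local minimum of the orbit sequence as \<open>x\<close> and its smaller neighbour
  as \<open>y\<close>. The product of both neighbours is \<open>x ^ 3 + 1\<close>, which gives
  \<open>y\<^sup>2 \<le> x ^ 3 + 1\<close>; if the smaller neighbour is on the left,
  \<open>tau\<close> reverses the pair.\<close>

lemma S0_pos_domain_translate:
  assumes "p \<in> S0_pos"
  obtains \<phi> where "\<phi> \<in> carrier Aut_S0" "S0_pos_action \<phi> p \<in> S0_domain"
proof -
  interpret group Aut_S0 by (rule group_Aut_S0)
  obtain n where n: "orbit_ratio p (n - 1) \<le> 1" "1 \<le> orbit_ratio p n"
    by (rule orbit_ratio_crossing[OF assms])
  let ?X = "orbit_coord p"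
  have le: "?X n \<le> ?X (n - 1)" "?X n \<le> ?X (n + 1)"
    using n orbit_ratio_le_1_iff[OF assms, of "n - 1"] orbit_ratio_le_1_iff[OF assms, of n] by auto
  have closed: "S0_pos_action (rho [^]\<^bsub>Aut_S0\<^esub> m) p \<in> S0_pos" for m :: int
    using assms rho_closed by (intro S0_pos_action_closed) auto
  note X = orbit_coord_facts[OF assms]
  show ?thesis
  proof (cases "?X (n + 1) \<le> ?X (n - 1)")
    case True
    have "?X (n + 1) ^ 2 \<le> ?X (n - 1) * ?X (n + 1)"
      unfolding power2_eq_square using True X(1)[of "n + 1"] by (intro mult_right_mono) auto
    moreover obtain z where z: "S0_pos_action (rho [^]\<^bsub>Aut_S0\<^esub> n) p = (?X n, ?X (n + 1), z)"
      by (rule S0_pos_action_rho_pow[OF assms])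
    ultimately have "S0_pos_action (rho [^]\<^bsub>Aut_S0\<^esub> n) p \<in> S0_domain"
      using closed[of n] le X(2)[of n] by (simp add: S0_domain_iff)
    then show ?thesis
      using rho_closed by (intro that) auto
  next
    case False
    have sq: "?X (n - 1) ^ 2 \<le> ?X (n - 1) * ?X (n + 1)"
      unfolding power2_eq_square using False X(1)[of "n - 1"] by (intro mult_left_mono) auto
    obtain z where z: "S0_pos_action (rho [^]\<^bsub>Aut_S0\<^esub> (n - 1)) p = (?X (n - 1), ?X (n - 1 + 1), z)"
      by (rule S0_pos_action_rho_pow[OF assms])
    have pos: "(?X (n - 1), ?X n, z) \<in> S0_pos"
      using closed[of "n - 1"] by (simp add: z)
    then have "(?X n, ?X (n - 1), z) \<in> S0_pos"
      by (auto simp: S0_pos_def mult_ac)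
    then have "S0_pos_action (tau \<otimes>\<^bsub>Aut_S0\<^esub> rho [^]\<^bsub>Aut_S0\<^esub> (n - 1)) p \<in> S0_domain"
      using S0_pos_action_mult[OF generators_closed(1) int_pow_closed[OF rho_closed] assms closed[of "n - 1"]]
        pos le sq X(2)[of n] by (simp add: z S0_pos_action_generators S0_domain_iff)
    then show ?thesis
      using rho_closed generators_closed(1) by (intro that) auto
  qed
qed

text \<open>Strictness makes index 0 the only crossing of the ratios, and makes the right neighbour
  strictly smaller than the left one, so neither a translation nor a reflection can return to the
  domain.\<close>

lemma S0_domain_strict_stabilizer:
  assumes s: "(x, y, z) \<in> S0_pos" "x < y" "y\<^sup>2 < x ^ 3 + 1"
    and \<phi>: "\<phi> \<in> carrier Aut_S0" "S0_pos_action \<phi> (x, y, z) \<in> S0_domain"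
  shows "\<phi> = \<one>\<^bsub>Aut_S0\<^esub>"
proof -
  interpret group Aut_S0 by (rule group_Aut_S0)
  let ?p = "(x, y, z)"
  let ?X = "orbit_coord ?p"
  note X = orbit_coord_facts[OF s(1)]
  have closed: "S0_pos_action (rho [^]\<^bsub>Aut_S0\<^esub> m) ?p \<in> S0_pos" for m :: int
    using s(1) rho_closed by (intro S0_pos_action_closed) auto
  have "S0_pos_action (rho [^]\<^bsub>Aut_S0\<^esub> (0 :: int)) ?p = ?p"
    using s(1) by (simp add: S0_pos_action_one)
  moreover obtain w where "S0_pos_action (rho [^]\<^bsub>Aut_S0\<^esub> (0 :: int)) ?p = (?X 0, ?X (0 + 1), w)"
    by (rule S0_pos_action_rho_pow[OF s(1)])
  ultimately have X01: "?X 0 = x" "?X 1 = y"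
    by (metis prod.inject add_0)+
  have "?X 1 * ?X 1 < ?X (-1) * ?X 1"
    using X(2)[of 0] s(3) by (simp add: X01 power2_eq_square)
  then have X_1: "?X 1 < ?X (-1)"
    using X(1)[of 1] by (subst (asm) mult_less_cancel_right_pos) auto
  have u0: "orbit_ratio ?p 0 > 1"
    using orbit_ratio_le_1_iff(1)[OF s(1), of 0] s(2) X01 by (simp add: not_le[symmetric])
  have u1: "orbit_ratio ?p (-1) < 1"
    using orbit_ratio_le_1_iff(2)[OF s(1), of "-1"] s(2) X01 X_1 by (simp add: not_le[symmetric])
  have ge: "n \<ge> 0" if "1 \<le> orbit_ratio ?p n" for n
    using that u1 orbit_ratio_mono[OF s(1), of n "-1"] by (cases "n = -1") force+
  have le: "n \<le> -1" if "orbit_ratio ?p n \<le> 1" for n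
    using that u0 orbit_ratio_mono[OF s(1), of 0 n] by (cases "n = 0") force+
  have ratio: "?X a \<le> ?X b \<longleftrightarrow> ?X a ^ 2 \<le> ?X a * ?X b" "?X a \<le> ?X b \<longleftrightarrow> ?X a ^ 2 \<le> ?X b * ?X a" for a b
    using X(1)[of a] by (simp_all add: power2_eq_square)
  have "\<phi> \<in> generate Aut_S0 {tau, sigma_x}"
    using \<phi>(1) by (simp add: Aut_S0_generated)
  \<comment> \<open>The inverse is decomposed so that \<open>\<phi>\<close> itself has the power of
    \<open>rho\<close> on the right, acting first on the point, where orbit coordinates describe
    it.\<close>
  then consider (pow) n :: int where "inv\<^bsub>Aut_S0\<^esub> \<phi> = rho [^]\<^bsub>Aut_S0\<^esub> n" | (refl) n :: int where "inv\<^bsub>Aut_S0\<^esub> \<phi> = rho [^]\<^bsub>Aut_S0\<^esub> n \<otimes>\<^bsub>Aut_S0\<^esub> tau"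
    using generated_by_involutions_cases[OF generators_closed(1,2) generators_square(1,2), of "inv\<^bsub>Aut_S0\<^esub> \<phi>"]
      \<phi>(1) by (metis Aut_S0_generated inv_closed)
  then show ?thesis
  proof cases
    case pow
    have \<phi>_eq: "\<phi> = rho [^]\<^bsub>Aut_S0\<^esub> (- n)"
      using pow \<phi>(1) rho_closed by (metis int_pow_neg inv_inv)
    define m where "m = - n"
    obtain w where w: "S0_pos_action \<phi> ?p = (?X m, ?X (m + 1), w)"
      unfolding \<phi>_eq m_def by (rule S0_pos_action_rho_pow[OF s(1)])
    have "?X m \<le> ?X (m + 1)" "?X (m + 1) ^ 2 \<le> ?X (m - 1) * ?X (m + 1)"
      using \<phi>(2) X(2)[of m] by (simp_all add: w S0_domain_iff)
    moreover from this have "?X m \<le> ?X (m - 1)"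
      using ratio(2)[of "m + 1" "m - 1"] by simp
    ultimately have "m \<ge> 0" "m - 1 \<le> -1"
      using orbit_ratio_le_1_iff[OF s(1), of m] orbit_ratio_le_1_iff[OF s(1), of "m - 1"] ge[of m] le[of "m - 1"] by simp_all
    then have "m = 0" by simp
    then show ?thesis
      using \<phi>_eq by (simp add: m_def)
  next
    case refl
    have "\<phi> = inv\<^bsub>Aut_S0\<^esub> (rho [^]\<^bsub>Aut_S0\<^esub> n \<otimes>\<^bsub>Aut_S0\<^esub> tau)"
      using refl \<phi>(1) by (metis inv_inv)
    also have "\<dots> = tau \<otimes>\<^bsub>Aut_S0\<^esub> rho [^]\<^bsub>Aut_S0\<^esub> (- n)"
      using rho_closed generators_closed(1) inv_equality[OF generators_square(1) generators_closed(1,1)]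
      by (simp add: inv_mult_group int_pow_neg)
    finally have \<phi>_eq: "\<phi> = tau \<otimes>\<^bsub>Aut_S0\<^esub> rho [^]\<^bsub>Aut_S0\<^esub> (- n)" .
    define m where "m = - n"
    obtain w where w: "S0_pos_action (rho [^]\<^bsub>Aut_S0\<^esub> m) ?p = (?X m, ?X (m + 1), w)"
      by (rule S0_pos_action_rho_pow[OF s(1)])
    have "S0_pos_action \<phi> ?p = (?X (m + 1), ?X m, w)"
      using S0_pos_action_mult[OF generators_closed(1) int_pow_closed[OF rho_closed] s(1) closed[of m]] closed[of m]
      by (simp add: \<phi>_eq m_def[symmetric] w S0_pos_action_generators)
    with \<phi>(2) have "?X (m + 1) \<le> ?X m" and sq: "?X m ^ 2 \<le> ?X (m + 1) ^ 3 + 1"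
      by (simp_all add: S0_domain_iff)
    moreover from this have m2: "?X m \<le> ?X (m + 2)"
      using X(2)[of "m + 1"] ratio(1)[of m "m + 2"] by (simp add: add.assoc)
    ultimately have "m \<le> -1" "m + 1 \<ge> 0"
      using orbit_ratio_le_1_iff[OF s(1), of m] orbit_ratio_le_1_iff[OF s(1), of "m + 1"] ge[of "m + 1"] le[of m]
      by (simp_all add: add.assoc)
    then have "m = -1" by simp
    \<comment> \<open>The remaining reflection would put the left neighbour in place of
      \<open>y\<close>, but it is the larger of the two.\<close>
    with m2 X_1 show ?thesis by simp
  qed
qed

text \<open>At an interior point \<open>y\<close> can be moved both ways within the domain with
  \<open>x\<close> fixed; moving down makes the first bound strict, moving up the second.\<close>

lemma S0_domain_interior_strict:
  assumes "(x, y, z) \<in> (top_of_set S0_pos) interior_of S0_domain"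
  shows "(x, y, z) \<in> S0_pos \<and> x < y \<and> y\<^sup>2 < x ^ 3 + 1"
proof -
  obtain U where "openin (top_of_set S0_pos) U" "(x, y, z) \<in> U" "U \<subseteq> S0_domain"
    using assms by (auto simp: interior_of_def)
  then obtain V where V: "open V" "(x, y, z) \<in> V" "S0_pos \<inter> V \<subseteq> S0_domain" and p: "(x, y, z) \<in> S0_pos"
    by (auto simp: openin_open)
  have pos: "x > 0" "y > 0" and eqn: "x * y * z = x ^ 3 + y ^ 3 + 1"
    using p by (auto simp: S0_pos_def)
  \<comment> \<open>A curve in the surface through the point: the second coordinate varies and the
    third is solved from the equation.\<close>
  define \<gamma> where "\<gamma> e = (x, e, (x ^ 3 + e ^ 3 + 1) / (x * e))" for e :: real
  have "\<gamma> y = (x, y, z)"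
    using pos eqn by (simp add: \<gamma>_def field_simps)
  moreover have "isCont \<gamma> y"
    unfolding \<gamma>_def using pos by (intro continuous_intros) auto
  ultimately have "(\<gamma> \<longlongrightarrow> (x, y, z)) (at y)"
    by (simp add: isCont_def)
  then have "\<forall>\<^sub>F e in at y. \<gamma> e \<in> V"
    using V(1,2) by (rule topological_tendstoD)
  moreover have "\<forall>\<^sub>F e in at y. e > 0"
    using order_tendstoD(1)[OF tendsto_ident_at pos(2)] .
  ultimately have "\<forall>\<^sub>F e in at y. \<gamma> e \<in> S0_domain"
  proof eventually_elim
    case (elim e)
    have "x * e * ((x ^ 3 + e ^ 3 + 1) / (x * e)) = x ^ 3 + e ^ 3 + 1" "(x ^ 3 + e ^ 3 + 1) / (x * e) > 0"
      using pos elim by (simp_all add: add_pos_pos)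
    then have "\<gamma> e \<in> S0_pos"
      using pos elim by (simp add: \<gamma>_def S0_pos_def)
    with elim V(3) show ?case by blast
  qed
  then have ev: "\<forall>\<^sub>F e in at y. x \<le> e \<and> e\<^sup>2 \<le> x ^ 3 + 1"
    by (rule eventually_mono) (simp add: \<gamma>_def S0_domain_iff)
  then obtain d where d: "d > 0" "\<And>e. e \<noteq> y \<Longrightarrow> dist e y < d \<Longrightarrow> x \<le> e \<and> e\<^sup>2 \<le> x ^ 3 + 1"
    unfolding eventually_at by auto
  have "x \<le> y - d / 2"
    using d(2)[of "y - d / 2"] d(1) by (simp add: dist_real_def)
  moreover have "(y + d / 2)\<^sup>2 \<le> x ^ 3 + 1"
    using d(2)[of "y + d / 2"] d(1) by (simp add: dist_real_def)
  moreover have "y\<^sup>2 < (y + d / 2)\<^sup>2"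
    using pos d(1) by (intro power_strict_mono) auto
  ultimately show ?thesis
    using p d(1) by simp
qed

lemma S0_fundamental_domain: "fundamental_domain Aut_S0 (top_of_set S0_pos) S0_pos_action S0_domain"
  unfolding fundamental_domain_def topspace_euclidean_subtopology
proof (intro conjI ballI impI)
  interpret group Aut_S0 by (rule group_Aut_S0)
  show "group_action Aut_S0 S0_pos S0_pos_action"
    by (rule group_action_S0_pos)
  show "closedin (top_of_set S0_pos) S0_domain"
    by (rule closedin_S0_domain)
  have sub: "S0_domain \<subseteq> S0_pos"
    by (auto simp: S0_domain_def)
  show "(\<Union>\<phi>\<in>carrier Aut_S0. S0_pos_action \<phi> ` S0_domain) = S0_pos"
  proof
    show "(\<Union>\<phi>\<in>carrier Aut_S0. S0_pos_action \<phi> ` S0_domain) \<subseteq> S0_pos"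
      using sub S0_pos_action_closed by blast
    show "S0_pos \<subseteq> (\<Union>\<phi>\<in>carrier Aut_S0. S0_pos_action \<phi> ` S0_domain)"
    proof
      fix p assume p: "p \<in> S0_pos"
      obtain \<phi> where \<phi>: "\<phi> \<in> carrier Aut_S0" "S0_pos_action \<phi> p \<in> S0_domain"
        by (rule S0_pos_domain_translate[OF p])
      have "p = S0_pos_action (inv\<^bsub>Aut_S0\<^esub> \<phi>) (S0_pos_action \<phi> p)"
        by (rule S0_pos_action_inv[OF \<phi>(1) p, symmetric])
      with \<phi> show "p \<in> (\<Union>\<phi>\<in>carrier Aut_S0. S0_pos_action \<phi> ` S0_domain)"
        using inv_closed by blast
    qed
  qed
  fix \<phi> assume \<phi>: "\<phi> \<in> carrier Aut_S0" "\<phi> \<noteq> \<one>\<^bsub>Aut_S0\<^esub>"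
  show "top_of_set S0_pos interior_of S0_domain \<inter> top_of_set S0_pos interior_of (S0_pos_action \<phi> ` S0_domain) = {}"
  proof (rule ccontr)
    assume "top_of_set S0_pos interior_of S0_domain \<inter> top_of_set S0_pos interior_of (S0_pos_action \<phi> ` S0_domain) \<noteq> {}"
    then obtain x y z where s: "(x, y, z) \<in> top_of_set S0_pos interior_of S0_domain"
      "(x, y, z) \<in> top_of_set S0_pos interior_of (S0_pos_action \<phi> ` S0_domain)"
      by auto
    \<comment> \<open>The inverse of \<open>\<phi>\<close> carries a strict point of the domain back
      into the domain, so the stabilizer lemma applies to it.\<close>
    obtain t where t: "(x, y, z) = S0_pos_action \<phi> t" "t \<in> S0_domain"
      using subsetD[OF interior_of_subset s(2)] by (rule imageE)
    have "S0_pos_action (inv\<^bsub>Aut_S0\<^esub> \<phi>) (x, y, z) = t"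
      unfolding t(1) using t(2) sub by (intro S0_pos_action_inv \<phi>(1)) auto
    with t(2) have "S0_pos_action (inv\<^bsub>Aut_S0\<^esub> \<phi>) (x, y, z) \<in> S0_domain"
      by simp
    moreover have "(x, y, z) \<in> S0_pos" "x < y" "y\<^sup>2 < x ^ 3 + 1"
      using S0_domain_interior_strict[OF s(1)] by simp_all
    ultimately have "inv\<^bsub>Aut_S0\<^esub> \<phi> = \<one>\<^bsub>Aut_S0\<^esub>"
      by (intro S0_domain_strict_stabilizer inv_closed \<phi>(1))
    then have "\<phi> = \<one>\<^bsub>Aut_S0\<^esub>"
      using \<phi>(1) by (simp add: inv_eq_1_iff)
    with \<phi>(2) show False ..
  qed
qed

theorem mainTheorem1:
  shows "((\<forall>g\<in>{tau, sigma_x, sigma_y}. is_involution Aut_S0 g) \<and>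
          generate Aut_S0 {tau, sigma_x, sigma_y} = carrier Aut_S0) \<and>
         Aut_S0 \<cong> infinite_dihedral_group \<and>
         fundamental_domain Aut_S0 (top_of_set S0_pos) S0_pos_action
           {(x, y, z). (x, y, z) \<in> S0_pos \<and> x \<le> y \<and> y \<le> sqrt (x ^ 3 + 1)}"
proof (intro conjI)
  interpret group Aut_S0 by (rule group_Aut_S0)
  show "\<forall>g\<in>{tau, sigma_x, sigma_y}. is_involution Aut_S0 g"
    using involutions by blast
  have "generate Aut_S0 {tau, sigma_x} \<subseteq> generate Aut_S0 {tau, sigma_x, sigma_y}"
    by (rule mono_generate) auto
  moreover have "generate Aut_S0 {tau, sigma_x, sigma_y} \<subseteq> carrier Aut_S0"
    using generators_closed by (intro generate_incl) auto
  ultimately show "generate Aut_S0 {tau, sigma_x, sigma_y} = carrier Aut_S0"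
    by (simp add: Aut_S0_generated)
  have "tau \<noteq> \<one>\<^bsub>Aut_S0\<^esub>"
    using involutions(1) by (simp add: is_involution_def)
  then show "Aut_S0 \<cong> infinite_dihedral_group"
    by (intro iso_infinite_dihedral_group[OF generators_closed(1,2) generators_square(1,2) Aut_S0_generated]
        rho_pow_eq_one_imp)
  show "fundamental_domain Aut_S0 (top_of_set S0_pos) S0_pos_action
      {(x, y, z). (x, y, z) \<in> S0_pos \<and> x \<le> y \<and> y \<le> sqrt (x ^ 3 + 1)}"
    using S0_fundamental_domain by (simp only: S0_domain_def)
qed

end
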